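(* Let $(\Sigma,D)$ be an affine surface equipped with a $D$-parallel (nonzero) nilpotent $(1,1)$-tensor field $T$, and suppose that the Ricci tensor $\rho^D$ is non-symmetric, i.e. $\rho^D_{sk}\neq0$ (at every point). Let $\Phi$ be a symmetric $(0,2)$-tensor field on $\Sigma$ and $h\in\mathcal{C}^\infty(\Sigma)$ a non-constant function. If $(T^*\Sigma,g_{D,\Phi,T},f=h\circ\pi)$ is a Bach-flat gradient Ricci soliton, then $(T^*\Sigma,g_{D,\Phi,T})$ is neither half conformally flat nor conformally Einstein.
   Context: An affine surface $(\Sigma,D)$ is a smooth connected surface with a torsion free affine connection $D$, with Christoffel symbols ${}^D\Gamma_{ij}{}^k$. Its Ricci tensor is $\rho^D(X,Y)=\operatorname{tr}\{Z\mapsto R^D(Z,X)Y\}$ with $R^D(X,Y)=[D_X,D_Y]-D_{[X,Y]}$, and $\rho^D_{sk}(X,Y)=\frac12\{\rho^D(X,Y)-\rho^D(Y,X)\}$. Nilpotent means $T^2=0$, $T\neq0$. Let $\pi\colon T^*\Sigma\to\Sigma$ be the cotangent bundle. Local coordinates $(x^i)$ on $\Sigma$ induce coordinates $(x^i,x_{i'})$ on $T^*\Sigma$ by writing a covector as $\sum x_{i'}dx^i$. For a vector field $X$ on $\Sigma$, $\iota X(p,\alpha)=\alpha(X_p)$, and the complete lift $X^C$ is determined by $X^C(\iota Z)=\iota[X,Z]$ for all $Z$; $\iota T$ is the one-form with $\iota T(X^C)=\iota(TX)$; $g_D$ is the metric with $g_D(X^C,Y^C)=-\iota(D_XY+D_YX)$.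 Then $g_{D,\Phi,T}=\iota T\circ\iota T+g_D+\pi^*\Phi$, where $\omega_1\circ\omega_2=\frac12(\omega_1\otimes\omega_2+\omega_2\otimes\omega_1)$; it has neutral signature. In induced coordinates, with $T\partial_i=T_i^k\partial_k$, $$g_{D,\Phi,T}=2\,dx^i\circ dx_{i'}+\{\tfrac12x_{r'}x_{s'}(T_i^rT_j^s+T_j^rT_i^s)-2x_{k'}{}^D\Gamma_{ij}{}^k+\Phi_{ij}\}\,dx^i\circ dx^j .$$ A triple $(M,g,f)$ is a gradient Ricci soliton if $\operatorname{Hes}_f+\rho=\lambda g$ for some $\lambda\in\mathbb{R}$ ($\operatorname{Hes}_f=\nabla df$, $\rho$ the Ricci tensor). It is Bach-flat if the Bach tensor $\mathfrak{B}_{ij}=\nabla^k\nabla^\ell W_{kij\ell}+\frac12\rho^{k\ell}W_{kij\ell}$ vanishes, $W$ being the Weyl tensor. A four-dimensional metric is half conformally flat if it is self-dual ($W^-=0$) or anti-self-dual ($W^+=0$). $(M,g)$ is conformally Einstein if every point has an open neighborhood $\mathcal{U}$ and a positive smooth function $\varphi$ on $\mathcal{U}$ with $(\mathcal{U},\varphi^{-2}g)$ Einstein. *)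

theory Defs
  imports "HOL-Analysis.Analysis"
begin

section \<open>Partial derivatives and smooth functions on subsets of \<open>real ^ 'n\<close>\<close>

definition pd :: "'n \<Rightarrow> (real ^ 'n::finite \<Rightarrow> real) \<Rightarrow> real ^ 'n \<Rightarrow> real" where
  "pd i f x = frechet_derivative f (at x) (axis i 1)"

primrec Ck_on :: "nat \<Rightarrow> (real ^ 'n::finite \<Rightarrow> real) \<Rightarrow> (real ^ 'n) set \<Rightarrow> bool" where
  "Ck_on 0 f U \<longleftrightarrow> continuous_on U f"
| "Ck_on (Suc k) f U \<longleftrightarrow> (\<forall>x\<in>U. f differentiable (at x)) \<and> (\<forall>i. Ck_on k (pd i f) U)"

definition smooth_on :: "(real ^ 'n::finite) set \<Rightarrow> (real ^ 'n \<Rightarrow> real) \<Rightarrow> bool" where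
  "smooth_on U f \<longleftrightarrow> (\<forall>k. Ck_on k f U)"


section \<open>Smooth manifolds\<close>

text \<open>
  A manifold is given by its point set and an indexed atlas: \<open>crd M a\<close> maps the chart domain
  \<open>cdom M a\<close> injectively onto an open subset of \<open>real ^ 'n\<close>.  The topology is the one induced
  by the charts.  Tensor fields are families, indexed by the charts, of component functions in
  the respective coordinates that obey the usual transformation law on overlaps.
\<close>

record ('p, 'i, 'n) mfd =
  pts :: "'p set"
  idx :: "'i set"
  cdom :: "'i \<Rightarrow> 'p set"
  crd :: "'i \<Rightarrow> 'p \<Rightarrow> real ^ 'n"

definition crange :: "('p, 'i, 'n::finite) mfd \<Rightarrow> 'i \<Rightarrow> (real ^ 'n) set" where
  "crange M a = crd M a ` cdom M a"

definition cpar :: "('p, 'i, 'n::finite) mfd \<Rightarrow> 'i \<Rightarrow> real ^ 'n \<Rightarrow> 'p" where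
  "cpar M a = inv_into (cdom M a) (crd M a)"

definition overlap :: "('p, 'i, 'n::finite) mfd \<Rightarrow> 'i \<Rightarrow> 'i \<Rightarrow> (real ^ 'n) set" where
  "overlap M a b = crd M a ` (cdom M a \<inter> cdom M b)"

definition transition :: "('p, 'i, 'n::finite) mfd \<Rightarrow> 'i \<Rightarrow> 'i \<Rightarrow> real ^ 'n \<Rightarrow> real ^ 'n" where
  "transition M a b x = crd M b (cpar M a x)"

definition jac :: "('p, 'i, 'n::finite) mfd \<Rightarrow> 'i \<Rightarrow> 'i \<Rightarrow> real ^ 'n \<Rightarrow> real ^ 'n ^ 'n" where
  "jac M a b x = (\<chi> k i. pd i (\<lambda>y. transition M a b y $ k) x)"

definition smooth_atlas :: "('p, 'i, 'n::finite) mfd \<Rightarrow> bool" where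
  "smooth_atlas M \<longleftrightarrow>
     (\<Union>a\<in>idx M. cdom M a) = pts M \<and>
     (\<forall>a\<in>idx M. inj_on (crd M a) (cdom M a) \<and> open (crange M a)) \<and>
     (\<forall>a\<in>idx M. \<forall>b\<in>idx M. open (overlap M a b) \<and>
        (\<forall>k. smooth_on (overlap M a b) (\<lambda>x. transition M a b x $ k)))"

definition mtop :: "('p, 'i, 'n::finite) mfd \<Rightarrow> 'p topology" where
  "mtop M = topology (\<lambda>W. W \<subseteq> pts M \<and> (\<forall>a\<in>idx M. open (crd M a ` (W \<inter> cdom M a))))"

lemma openin_mtop:
  assumes "\<And>a. a \<in> idx M \<Longrightarrow> inj_on (crd M a) (cdom M a)"
  shows "openin (mtop M) W \<longleftrightarrow>
    W \<subseteq> pts M \<and> (\<forall>a\<in>idx M. open (crd M a ` (W \<inter> cdom M a)))"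
proof -
  let ?L = "\<lambda>W. W \<subseteq> pts M \<and> (\<forall>a\<in>idx M. open (crd M a ` (W \<inter> cdom M a)))"
  have int: "?L (V \<inter> W)" if V: "?L V" and W: "?L W" for V W
  proof (intro conjI ballI)
    show "V \<inter> W \<subseteq> pts M" using V by blast
    fix a assume a: "a \<in> idx M"
    have "V \<inter> W \<inter> cdom M a = (V \<inter> cdom M a) \<inter> (W \<inter> cdom M a)"
      by blast
    then have "crd M a ` (V \<inter> W \<inter> cdom M a)
        = crd M a ` (V \<inter> cdom M a) \<inter> crd M a ` (W \<inter> cdom M a)"
      by (simp only: inj_on_image_Int[OF assms[OF a] Int_lower2 Int_lower2])
    then show "open (crd M a ` (V \<inter> W \<inter> cdom M a))"
      using V W a by auto
  qed
  have un: "?L (\<Union>\<K>)" if K: "\<forall>K\<in>\<K>. ?L K" for \<K>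
  proof (intro conjI ballI)
    show "\<Union>\<K> \<subseteq> pts M" using K by blast
    fix a assume a: "a \<in> idx M"
    have "crd M a ` (\<Union>\<K> \<inter> cdom M a) = (\<Union>K\<in>\<K>. crd M a ` (K \<inter> cdom M a))" by blast
    then show "open (crd M a ` (\<Union>\<K> \<inter> cdom M a))" using K a by auto
  qed
  have "istopology ?L"
    unfolding istopology_def using int un by blast
  then show ?thesis unfolding mtop_def by (simp add: topology_inverse')
qed

definition smooth_manifold :: "('p, 'i, 'n::finite) mfd \<Rightarrow> bool" where
  "smooth_manifold M \<longleftrightarrow>
     smooth_atlas M \<and> Hausdorff_space (mtop M) \<and> second_countable (mtop M)"

definition restrict_mfd :: "('p, 'i, 'n::finite) mfd \<Rightarrow> 'p set \<Rightarrow> ('p, 'i, 'n) mfd" where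
  "restrict_mfd M U = M\<lparr>pts := pts M \<inter> U, cdom := (\<lambda>a. cdom M a \<inter> U)\<rparr>"

definition smooth_function :: "('p, 'i, 'n::finite) mfd \<Rightarrow> ('p \<Rightarrow> real) \<Rightarrow> bool" where
  "smooth_function M f \<longleftrightarrow> (\<forall>a\<in>idx M. smooth_on (crange M a) (\<lambda>x. f (cpar M a x)))"

text \<open>Symmetric \<open>(0,2)\<close>-tensor fields; \<open>\<Phi> a x $ i $ j\<close> is \<open>\<Phi>(\<partial>\<^sub>i,\<partial>\<^sub>j)\<close>.\<close>

definition sym_tensor02 ::
    "('p, 'i, 'n::finite) mfd \<Rightarrow> ('i \<Rightarrow> real ^ 'n \<Rightarrow> real ^ 'n ^ 'n) \<Rightarrow> bool" where
  "sym_tensor02 M \<Phi> \<longleftrightarrow>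
     (\<forall>a\<in>idx M. \<forall>i j. smooth_on (crange M a) (\<lambda>x. \<Phi> a x $ i $ j)) \<and>
     (\<forall>a\<in>idx M. \<forall>x\<in>crange M a. transpose (\<Phi> a x) = \<Phi> a x) \<and>
     (\<forall>a\<in>idx M. \<forall>b\<in>idx M. \<forall>x\<in>overlap M a b.
        \<Phi> a x = transpose (jac M a b x) ** \<Phi> b (transition M a b x) ** jac M a b x)"

text \<open>\<open>(1,1)\<close>-tensor fields; \<open>T\<partial>\<^sub>j\<close> is the sum of the \<open>T a x $ k $ j\<close> times \<open>\<partial>\<^sub>k\<close>.\<close>

definition tensor11 ::
    "('p, 'i, 'n::finite) mfd \<Rightarrow> ('i \<Rightarrow> real ^ 'n \<Rightarrow> real ^ 'n ^ 'n) \<Rightarrow> bool" where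
  "tensor11 M T \<longleftrightarrow>
     (\<forall>a\<in>idx M. \<forall>k j. smooth_on (crange M a) (\<lambda>x. T a x $ k $ j)) \<and>
     (\<forall>a\<in>idx M. \<forall>b\<in>idx M. \<forall>x\<in>overlap M a b.
        jac M a b x ** T a x = T b (transition M a b x) ** jac M a b x)"

definition nilpotent11 ::
    "('p, 'i, 'n::finite) mfd \<Rightarrow> ('i \<Rightarrow> real ^ 'n \<Rightarrow> real ^ 'n ^ 'n) \<Rightarrow> bool" where
  "nilpotent11 M T \<longleftrightarrow>
     (\<forall>a\<in>idx M. \<forall>x\<in>crange M a. T a x ** T a x = 0) \<and>
     \<not> (\<forall>a\<in>idx M. \<forall>x\<in>crange M a. T a x = 0)"


section \<open>Connections and curvature in coordinates\<close>

text \<open>\<open>\<Gamma> x i j k\<close> is the coefficient of \<open>\<partial>\<^sub>k\<close> in the covariant derivative of \<open>\<partial>\<^sub>j\<close> along \<open>\<partial>\<^sub>i\<close>.\<close>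

type_synonym 'n christ = "real ^ 'n \<Rightarrow> 'n \<Rightarrow> 'n \<Rightarrow> 'n \<Rightarrow> real"

text \<open>The coefficient of \<open>\<partial>\<^sub>l\<close> in \<open>R(\<partial>\<^sub>i,\<partial>\<^sub>j)\<partial>\<^sub>k\<close>, where \<open>R(X,Y) = [D\<^sub>X,D\<^sub>Y] - D\<^bsub>[X,Y]\<^esub>\<close>.\<close>

definition riem :: "'n::finite christ \<Rightarrow> real ^ 'n \<Rightarrow> 'n \<Rightarrow> 'n \<Rightarrow> 'n \<Rightarrow> 'n \<Rightarrow> real" where
  "riem \<Gamma> x i j k l =
     pd i (\<lambda>y. \<Gamma> y j k l) x - pd j (\<lambda>y. \<Gamma> y i k l) x
     + (\<Sum>m\<in>UNIV. \<Gamma> x j k m * \<Gamma> x i m l - \<Gamma> x i k m * \<Gamma> x j m l)"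

text \<open>\<open>\<rho>(X,Y) = tr {Z \<mapsto> R(Z,X)Y}\<close>.\<close>

definition ricci :: "'n::finite christ \<Rightarrow> real ^ 'n \<Rightarrow> 'n \<Rightarrow> 'n \<Rightarrow> real" where
  "ricci \<Gamma> x j k = (\<Sum>i\<in>UNIV. riem \<Gamma> x i j k i)"

definition ricci_skew :: "'n::finite christ \<Rightarrow> real ^ 'n \<Rightarrow> 'n \<Rightarrow> 'n \<Rightarrow> real" where
  "ricci_skew \<Gamma> x j k = (ricci \<Gamma> x j k - ricci \<Gamma> x k j) / 2"

definition hessian :: "'n::finite christ \<Rightarrow> (real ^ 'n \<Rightarrow> real) \<Rightarrow> real ^ 'n \<Rightarrow> 'n \<Rightarrow> 'n \<Rightarrow> real" where
  "hessian \<Gamma> f x i j = pd i (pd j f) x - (\<Sum>k\<in>UNIV. \<Gamma> x i j k * pd k f x)"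

text \<open>
  Covariant derivative of a covariant tensor field whose components are indexed by lists;
  the index of the differentiating direction is put in front.
\<close>

primrec covd :: "'n::finite christ \<Rightarrow> ('n list \<Rightarrow> real ^ 'n \<Rightarrow> real) \<Rightarrow> 'n list \<Rightarrow> real ^ 'n \<Rightarrow> real"
  where
  "covd \<Gamma> t [] x = 0"
| "covd \<Gamma> t (a # js) x =
     pd a (t js) x
     - (\<Sum>r<length js. \<Sum>m\<in>UNIV. \<Gamma> x a (js ! r) m * t (js[r := m]) x)"

definition affine_connection ::
    "('p, 'i, 'n::finite) mfd \<Rightarrow> ('i \<Rightarrow> 'n christ) \<Rightarrow> bool" where
  "affine_connection M \<Gamma> \<longleftrightarrow>
     (\<forall>a\<in>idx M. \<forall>i j k. smooth_on (crange M a) (\<lambda>x. \<Gamma> a x i j k)) \<and>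
     (\<forall>a\<in>idx M. \<forall>b\<in>idx M. \<forall>x\<in>overlap M a b. \<forall>i j m.
        (\<Sum>k\<in>UNIV. \<Gamma> a x i j k * jac M a b x $ m $ k) =
        pd i (pd j (\<lambda>y. transition M a b y $ m)) x
        + (\<Sum>r\<in>UNIV. \<Sum>s\<in>UNIV.
             \<Gamma> b (transition M a b x) r s m * jac M a b x $ r $ i * jac M a b x $ s $ j))"

definition torsion_free :: "('p, 'i, 'n::finite) mfd \<Rightarrow> ('i \<Rightarrow> 'n christ) \<Rightarrow> bool" where
  "torsion_free M \<Gamma> \<longleftrightarrow>
     (\<forall>a\<in>idx M. \<forall>x\<in>crange M a. \<forall>i j k. \<Gamma> a x i j k = \<Gamma> a x j i k)"

definition affine_surface :: "('p, 'i, 2) mfd \<Rightarrow> ('i \<Rightarrow> 2 christ) \<Rightarrow> bool" where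
  "affine_surface S \<Gamma> \<longleftrightarrow>
     smooth_manifold S \<and> connected_space (mtop S) \<and>
     affine_connection S \<Gamma> \<and> torsion_free S \<Gamma>"

definition parallel11 :: "('p, 'i, 'n::finite) mfd \<Rightarrow> ('i \<Rightarrow> 'n christ) \<Rightarrow>
    ('i \<Rightarrow> real ^ 'n \<Rightarrow> real ^ 'n ^ 'n) \<Rightarrow> bool" where
  "parallel11 M \<Gamma> T \<longleftrightarrow>
     (\<forall>a\<in>idx M. \<forall>x\<in>crange M a. \<forall>i j k.
        pd i (\<lambda>y. T a y $ k $ j) x
        + (\<Sum>m\<in>UNIV. \<Gamma> a x i m k * T a x $ m $ j - \<Gamma> a x i j m * T a x $ k $ m) = 0)"

definition ricci_nowhere_symmetric ::
    "('p, 'i, 'n::finite) mfd \<Rightarrow> ('i \<Rightarrow> 'n christ) \<Rightarrow> bool" where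
  "ricci_nowhere_symmetric M \<Gamma> \<longleftrightarrow>
     (\<forall>a\<in>idx M. \<forall>x\<in>crange M a. \<exists>i j. ricci_skew (\<Gamma> a) x i j \<noteq> 0)"


section \<open>Pseudo-Riemannian geometry\<close>

text \<open>A metric is given in coordinates by \<open>g x $ i $ j\<close>, and \<open>matrix_inv (g x) $ i $ j\<close> raises indices.\<close>

definition levi_civita :: "(real ^ 'n::finite \<Rightarrow> real ^ 'n ^ 'n) \<Rightarrow> 'n christ" where
  "levi_civita g x i j k =
     (\<Sum>l\<in>UNIV. matrix_inv (g x) $ k $ l *
        (pd i (\<lambda>y. g y $ j $ l) x + pd j (\<lambda>y. g y $ i $ l) x - pd l (\<lambda>y. g y $ i $ j) x)) / 2"

abbreviation ric :: "(real ^ 'n::finite \<Rightarrow> real ^ 'n ^ 'n) \<Rightarrow> real ^ 'n \<Rightarrow> 'n \<Rightarrow> 'n \<Rightarrow> real" where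
  "ric g \<equiv> ricci (levi_civita g)"

definition scal :: "(real ^ 'n::finite \<Rightarrow> real ^ 'n ^ 'n) \<Rightarrow> real ^ 'n \<Rightarrow> real" where
  "scal g x = (\<Sum>i\<in>UNIV. \<Sum>j\<in>UNIV. matrix_inv (g x) $ i $ j * ric g x i j)"

text \<open>\<open>R(X,Y,Z,V) = g(R(X,Y)Z,V)\<close>; with this convention and the above \<open>\<rho>\<close>, the unit sphere has
  \<open>R\<^bsub>ijkl\<^esub> = g\<^bsub>jk\<^esub>g\<^bsub>il\<^esub> - g\<^bsub>ik\<^esub>g\<^bsub>jl\<^esub>\<close> and positive Ricci tensor.\<close>

definition riem_low ::
    "(real ^ 'n::finite \<Rightarrow> real ^ 'n ^ 'n) \<Rightarrow> real ^ 'n \<Rightarrow> 'n \<Rightarrow> 'n \<Rightarrow> 'n \<Rightarrow> 'n \<Rightarrow> real" where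
  "riem_low g x i j k l = (\<Sum>m\<in>UNIV. riem (levi_civita g) x i j k m * g x $ m $ l)"

definition weyl ::
    "(real ^ 'n::finite \<Rightarrow> real ^ 'n ^ 'n) \<Rightarrow> real ^ 'n \<Rightarrow> 'n \<Rightarrow> 'n \<Rightarrow> 'n \<Rightarrow> 'n \<Rightarrow> real" where
  "weyl g x i j k l =
     riem_low g x i j k l
     - (ric g x j k * g x $ i $ l + g x $ j $ k * ric g x i l
        - ric g x i k * g x $ j $ l - g x $ i $ k * ric g x j l) / (real CARD('n) - 2)
     + scal g x * (g x $ j $ k * g x $ i $ l - g x $ i $ k * g x $ j $ l)
       / ((real CARD('n) - 1) * (real CARD('n) - 2))"

definition weyl_list :: "(real ^ 'n::finite \<Rightarrow> real ^ 'n ^ 'n) \<Rightarrow> 'n list \<Rightarrow> real ^ 'n \<Rightarrow> real" where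
  "weyl_list g js x = weyl g x (js ! 0) (js ! 1) (js ! 2) (js ! 3)"

definition bach :: "(real ^ 'n::finite \<Rightarrow> real ^ 'n ^ 'n) \<Rightarrow> real ^ 'n \<Rightarrow> 'n \<Rightarrow> 'n \<Rightarrow> real" where
  "bach g x i j =
     (\<Sum>k\<in>UNIV. \<Sum>l\<in>UNIV. \<Sum>r\<in>UNIV. \<Sum>s\<in>UNIV.
        matrix_inv (g x) $ k $ r * matrix_inv (g x) $ l $ s *
        (covd (levi_civita g) (covd (levi_civita g) (weyl_list g)) [r, s, k, i, j, l] x
         + ric g x r s * weyl g x k i j l / 2))"

definition bach_flat ::
    "('p, 'i, 'n::finite) mfd \<Rightarrow> ('i \<Rightarrow> real ^ 'n \<Rightarrow> real ^ 'n ^ 'n) \<Rightarrow> bool" where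
  "bach_flat M g \<longleftrightarrow> (\<forall>a\<in>idx M. \<forall>x\<in>crange M a. \<forall>i j. bach (g a) x i j = 0)"

definition gradient_ricci_soliton :: "('p, 'i, 'n::finite) mfd \<Rightarrow>
    ('i \<Rightarrow> real ^ 'n \<Rightarrow> real ^ 'n ^ 'n) \<Rightarrow> ('p \<Rightarrow> real) \<Rightarrow> bool" where
  "gradient_ricci_soliton M g f \<longleftrightarrow>
     smooth_function M f \<and>
     (\<exists>lam::real. \<forall>a\<in>idx M. \<forall>x\<in>crange M a. \<forall>i j.
        hessian (levi_civita (g a)) (\<lambda>y. f (cpar M a y)) x i j + ric (g a) x i j
        = lam * g a x $ i $ j)"

definition einstein ::
    "('p, 'i, 'n::finite) mfd \<Rightarrow> ('i \<Rightarrow> real ^ 'n \<Rightarrow> real ^ 'n ^ 'n) \<Rightarrow> bool" where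
  "einstein M g \<longleftrightarrow>
     (\<exists>lam::real. \<forall>a\<in>idx M. \<forall>x\<in>crange M a. \<forall>i j. ric (g a) x i j = lam * g a x $ i $ j)"

text \<open>The metric \<open>\<phi>\<close> to the power \<open>-2\<close> times \<open>g\<close>.\<close>

definition conformal_metric :: "('p, 'i, 'n::finite) mfd \<Rightarrow> ('p \<Rightarrow> real) \<Rightarrow>
    ('i \<Rightarrow> real ^ 'n \<Rightarrow> real ^ 'n ^ 'n) \<Rightarrow> 'i \<Rightarrow> real ^ 'n \<Rightarrow> real ^ 'n ^ 'n" where
  "conformal_metric M \<phi> g a x = (1 / (\<phi> (cpar M a x))\<^sup>2) *\<^sub>R g a x"

definition conformally_einstein ::
    "('p, 'i, 'n::finite) mfd \<Rightarrow> ('i \<Rightarrow> real ^ 'n \<Rightarrow> real ^ 'n ^ 'n) \<Rightarrow> bool" where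
  "conformally_einstein M g \<longleftrightarrow>
     (\<forall>p\<in>pts M. \<exists>U \<phi>. openin (mtop M) U \<and> p \<in> U \<and> (\<forall>q\<in>U. \<phi> q > 0) \<and>
        smooth_function (restrict_mfd M U) \<phi> \<and>
        einstein (restrict_mfd M U) (conformal_metric (restrict_mfd M U) \<phi> g))"


section \<open>Self-duality in dimension four, neutral signature\<close>

text \<open>
  Coordinates are labelled by the four-element type \<open>2 + 2\<close>, as on the cotangent bundle of a
  surface.  An orientation is a sign \<open>ori a x\<close> telling whether the coordinate frame of chart \<open>a\<close>,
  ordered as \<open>Inl 1, Inl 2, Inr 1, Inr 2\<close>, is positively oriented at \<open>x\<close>.
\<close>

definition orientation ::
    "('p, 'i, 'n::finite) mfd \<Rightarrow> ('i \<Rightarrow> real ^ 'n \<Rightarrow> real) \<Rightarrow> bool" where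
  "orientation M ori \<longleftrightarrow>
     (\<forall>a\<in>idx M. continuous_on (crange M a) (ori a) \<and> ori a ` crange M a \<subseteq> {-1, 1}) \<and>
     (\<forall>a\<in>idx M. \<forall>b\<in>idx M. \<forall>x\<in>overlap M a b.
        ori a x = sgn (det (jac M a b x)) * ori b (transition M a b x))"

text \<open>The sign of the permutation sending \<open>Inl 1, Inl 2, Inr 1, Inr 2\<close> to \<open>i, j, k, l\<close>,
  or \<open>0\<close> if two of the indices agree.\<close>

definition perm_symbol :: "2 + 2 \<Rightarrow> 2 + 2 \<Rightarrow> 2 + 2 \<Rightarrow> 2 + 2 \<Rightarrow> real" where
  "perm_symbol i j k l =
     det (\<chi> r. axis (case r of Inl u \<Rightarrow> if u = 1 then i else j
                             | Inr u \<Rightarrow> if u = 1 then k else l) (1::real) :: real ^ (2 + 2) ^ (2 + 2))"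

definition vol_form :: "real \<Rightarrow> real ^ (2 + 2) ^ (2 + 2) \<Rightarrow> 2 + 2 \<Rightarrow> 2 + 2 \<Rightarrow> 2 + 2 \<Rightarrow> 2 + 2 \<Rightarrow> real" where
  "vol_form s G i j k l = s * sqrt \<bar>det G\<bar> * perm_symbol i j k l"

text \<open>The Hodge star applied to the first pair of indices of the Weyl tensor.  In neutral signature
  it squares to the identity on two-forms and commutes with the Weyl operator, so
  \<open>weyl_pm 1\<close> and \<open>weyl_pm (-1)\<close> below are the self-dual and anti-self-dual parts of \<open>W\<close>.\<close>

definition star_weyl :: "real \<Rightarrow> (real ^ (2 + 2) \<Rightarrow> real ^ (2 + 2) ^ (2 + 2)) \<Rightarrow> real ^ (2 + 2) \<Rightarrow>
    2 + 2 \<Rightarrow> 2 + 2 \<Rightarrow> 2 + 2 \<Rightarrow> 2 + 2 \<Rightarrow> real" where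
  "star_weyl s g x i j k l =
     (\<Sum>p\<in>UNIV. \<Sum>q\<in>UNIV. \<Sum>u\<in>UNIV. \<Sum>v\<in>UNIV.
        vol_form s (g x) i j p q * matrix_inv (g x) $ p $ u * matrix_inv (g x) $ q $ v
        * weyl g x u v k l) / 2"

definition weyl_pm :: "real \<Rightarrow> real \<Rightarrow> (real ^ (2 + 2) \<Rightarrow> real ^ (2 + 2) ^ (2 + 2)) \<Rightarrow>
    real ^ (2 + 2) \<Rightarrow> 2 + 2 \<Rightarrow> 2 + 2 \<Rightarrow> 2 + 2 \<Rightarrow> 2 + 2 \<Rightarrow> real" where
  "weyl_pm e s g x i j k l = (weyl g x i j k l + e * star_weyl s g x i j k l) / 2"

definition self_dual :: "('p, 'i, 2 + 2) mfd \<Rightarrow> ('i \<Rightarrow> real ^ (2 + 2) \<Rightarrow> real) \<Rightarrow>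
    ('i \<Rightarrow> real ^ (2 + 2) \<Rightarrow> real ^ (2 + 2) ^ (2 + 2)) \<Rightarrow> bool" where
  "self_dual M ori g \<longleftrightarrow>
     (\<forall>a\<in>idx M. \<forall>x\<in>crange M a. \<forall>i j k l. weyl_pm (-1) (ori a x) (g a) x i j k l = 0)"

definition anti_self_dual :: "('p, 'i, 2 + 2) mfd \<Rightarrow> ('i \<Rightarrow> real ^ (2 + 2) \<Rightarrow> real) \<Rightarrow>
    ('i \<Rightarrow> real ^ (2 + 2) \<Rightarrow> real ^ (2 + 2) ^ (2 + 2)) \<Rightarrow> bool" where
  "anti_self_dual M ori g \<longleftrightarrow>
     (\<forall>a\<in>idx M. \<forall>x\<in>crange M a. \<forall>i j k l. weyl_pm 1 (ori a x) (g a) x i j k l = 0)"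

definition half_conformally_flat :: "('p, 'i, 2 + 2) mfd \<Rightarrow>
    ('i \<Rightarrow> real ^ (2 + 2) \<Rightarrow> real ^ (2 + 2) ^ (2 + 2)) \<Rightarrow> bool" where
  "half_conformally_flat M g \<longleftrightarrow>
     (\<exists>ori. orientation M ori \<and> (self_dual M ori g \<or> anti_self_dual M ori g))"


section \<open>The cotangent bundle and its induced coordinates\<close>

text \<open>A covector at \<open>p\<close> is the family of its components in all charts around \<open>p\<close>
  (and \<open>0\<close> for the other indices).\<close>

definition covector :: "('p, 'i, 'n::finite) mfd \<Rightarrow> 'p \<Rightarrow> ('i \<Rightarrow> real ^ 'n) \<Rightarrow> bool" where
  "covector M p \<alpha> \<longleftrightarrow>
     (\<forall>a\<in>idx M. \<forall>b\<in>idx M. p \<in> cdom M a \<and> p \<in> cdom M b \<longrightarrow>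
        \<alpha> a = transpose (jac M a b (crd M a p)) *v \<alpha> b) \<and>
     (\<forall>a. \<not> (a \<in> idx M \<and> p \<in> cdom M a) \<longrightarrow> \<alpha> a = 0)"

definition base :: "real ^ ('n::finite + 'n) \<Rightarrow> real ^ 'n" where
  "base \<xi> = (\<chi> i. \<xi> $ Inl i)"

definition fibre :: "real ^ ('n::finite + 'n) \<Rightarrow> real ^ 'n" where
  "fibre \<xi> = (\<chi> i. \<xi> $ Inr i)"

definition join :: "real ^ 'n \<Rightarrow> real ^ 'n \<Rightarrow> real ^ ('n::finite + 'n)" where
  "join x y = (\<chi> s. case s of Inl i \<Rightarrow> x $ i | Inr i \<Rightarrow> y $ i)"

definition cotangent ::
    "('p, 'i, 'n::finite) mfd \<Rightarrow> ('p \<times> ('i \<Rightarrow> real ^ 'n), 'i, 'n + 'n) mfd" where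
  "cotangent M =
     \<lparr>pts = {(p, \<alpha>). p \<in> pts M \<and> covector M p \<alpha>},
      idx = idx M,
      cdom = (\<lambda>a. {(p, \<alpha>). p \<in> cdom M a \<and> covector M p \<alpha>}),
      crd = (\<lambda>a (p, \<alpha>). join (crd M a p) (\<alpha> a))\<rparr>"

text \<open>
  \<open>\<iota>X\<close>, the complete lift \<open>X\<^sup>C\<close>, \<open>\<iota>T\<close>, and \<open>g\<^sub>D\<close> in induced coordinates;
  the lemmas below verify the defining identities.
\<close>

definition iota :: "(real ^ 'n \<Rightarrow> real ^ 'n) \<Rightarrow> real ^ ('n::finite + 'n) \<Rightarrow> real" where
  "iota X \<xi> = (\<Sum>k\<in>UNIV. fibre \<xi> $ k * X (base \<xi>) $ k)"

definition complete_lift ::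
    "(real ^ 'n \<Rightarrow> real ^ 'n) \<Rightarrow> real ^ ('n::finite + 'n) \<Rightarrow> real ^ ('n + 'n)" where
  "complete_lift X \<xi> =
     join (X (base \<xi>)) (\<chi> j. - (\<Sum>k\<in>UNIV. fibre \<xi> $ k * pd j (\<lambda>x. X x $ k) (base \<xi>)))"

definition iota11 ::
    "(real ^ 'n \<Rightarrow> real ^ 'n ^ 'n) \<Rightarrow> real ^ ('n::finite + 'n) \<Rightarrow> real ^ ('n + 'n)" where
  "iota11 T \<xi> = join (\<chi> i. \<Sum>k\<in>UNIV. fibre \<xi> $ k * T (base \<xi>) $ k $ i) 0"

definition riemann_extension ::
    "'n christ \<Rightarrow> real ^ ('n::finite + 'n) \<Rightarrow> real ^ ('n + 'n) ^ ('n + 'n)" where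
  "riemann_extension \<Gamma> \<xi> = (\<chi> s t. case s of
       Inl i \<Rightarrow> (case t of Inl j \<Rightarrow> - 2 * (\<Sum>k\<in>UNIV. fibre \<xi> $ k * \<Gamma> (base \<xi>) i j k)
                        | Inr j \<Rightarrow> if i = j then 1 else 0)
     | Inr i \<Rightarrow> (case t of Inl j \<Rightarrow> if i = j then 1 else 0 | Inr j \<Rightarrow> 0))"

definition sym_prod :: "real ^ 'm \<Rightarrow> real ^ 'm \<Rightarrow> real ^ 'm ^ 'm::finite" where
  "sym_prod u v = (\<chi> s t. (u $ s * v $ t + v $ s * u $ t) / 2)"

definition pullback02 ::
    "(real ^ 'n \<Rightarrow> real ^ 'n ^ 'n) \<Rightarrow> real ^ ('n::finite + 'n) \<Rightarrow> real ^ ('n + 'n) ^ ('n + 'n)" where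
  "pullback02 \<Phi> \<xi> = (\<chi> s t. case s of
       Inl i \<Rightarrow> (case t of Inl j \<Rightarrow> \<Phi> (base \<xi>) $ i $ j | Inr j \<Rightarrow> 0)
     | Inr i \<Rightarrow> 0)"

definition modified_extension :: "('i \<Rightarrow> 'n christ) \<Rightarrow> ('i \<Rightarrow> real ^ 'n \<Rightarrow> real ^ 'n ^ 'n) \<Rightarrow>
    ('i \<Rightarrow> real ^ 'n \<Rightarrow> real ^ 'n ^ 'n) \<Rightarrow>
    'i \<Rightarrow> real ^ ('n::finite + 'n) \<Rightarrow> real ^ ('n + 'n) ^ ('n + 'n)" where
  "modified_extension \<Gamma> \<Phi> T a \<xi> =
     sym_prod (iota11 (T a) \<xi>) (iota11 (T a) \<xi>)
     + riemann_extension (\<Gamma> a) \<xi> + pullback02 (\<Phi> a) \<xi>"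

definition lie_bracket :: "(real ^ 'n::finite \<Rightarrow> real ^ 'n) \<Rightarrow> (real ^ 'n \<Rightarrow> real ^ 'n) \<Rightarrow>
    real ^ 'n \<Rightarrow> real ^ 'n" where
  "lie_bracket X Y x =
     (\<chi> k. \<Sum>i\<in>UNIV. X x $ i * pd i (\<lambda>y. Y y $ k) x - Y x $ i * pd i (\<lambda>y. X y $ k) x)"

definition cov_deriv :: "'n::finite christ \<Rightarrow> (real ^ 'n \<Rightarrow> real ^ 'n) \<Rightarrow>
    (real ^ 'n \<Rightarrow> real ^ 'n) \<Rightarrow> real ^ 'n \<Rightarrow> real ^ 'n" where
  "cov_deriv \<Gamma> X Y x =
     (\<chi> k. (\<Sum>i\<in>UNIV. X x $ i * pd i (\<lambda>y. Y y $ k) x)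
          + (\<Sum>i\<in>UNIV. \<Sum>j\<in>UNIV. \<Gamma> x i j k * X x $ i * Y x $ j))"

lemma join_simps [simp]:
  "join x y $ Inl i = x $ i" "join x y $ Inr i = y $ i"
  "base (join x y) = x" "fibre (join x y) = y"
  by (simp_all add: join_def base_def fibre_def vec_eq_iff)

lemma sum_UNIV_Plus:
  fixes f :: "'a::finite + 'b::finite \<Rightarrow> real"
  shows "sum f UNIV = (\<Sum>i\<in>UNIV. f (Inl i)) + (\<Sum>i\<in>UNIV. f (Inr i))"
  by (subst UNIV_Plus_UNIV[symmetric], subst sum.Plus) auto

lemma crange_cotangent_subset:
  "\<xi> \<in> crange (cotangent M) a \<Longrightarrow> base \<xi> \<in> crange M a"
  by (auto simp: crange_def cotangent_def)

lemma derivative_eq_sum_pd: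
  fixes f :: "real ^ 'n::finite \<Rightarrow> real"
  assumes "f differentiable (at x)"
  shows "frechet_derivative f (at x) v = (\<Sum>i\<in>UNIV. v $ i * pd i f x)"
proof -
  have l: "linear (frechet_derivative f (at x))"
    by (rule linear_frechet_derivative[OF assms])
  have "frechet_derivative f (at x) v
      = frechet_derivative f (at x) (\<Sum>i\<in>UNIV. v $ i *\<^sub>R axis i 1)"
    by (simp add: basis_expansion flip: scalar_mult_eq_scaleR)
  then show ?thesis
    by (simp add: linear_sum[OF l] linear_cmul[OF l] pd_def)
qed

lemma complete_lift_iota:
  assumes X: "\<And>k. (\<lambda>x. X x $ k) differentiable (at (base \<xi>))"
    and Z: "\<And>k. (\<lambda>x. Z x $ k) differentiable (at (base \<xi>))"
  shows "frechet_derivative (iota Z) (at \<xi>) (complete_lift X \<xi>) = iota (lie_bracket X Z) \<xi>"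
proof -
  let ?D = "\<lambda>k. frechet_derivative (\<lambda>x. Z x $ k) (at (base \<xi>))"
  have lb: "bounded_linear (base :: real ^ ('a + 'a) \<Rightarrow> real ^ 'a)"
    unfolding base_def by (intro linear_conv_bounded_linear[THEN iffD1] linearI)
      (auto simp: vec_eq_iff)
  have lf: "bounded_linear (\<lambda>\<xi> :: real ^ ('a + 'a). fibre \<xi> $ k)" for k
    unfolding fibre_def by (intro linear_conv_bounded_linear[THEN iffD1] linearI) auto
  have Zb: "((\<lambda>\<eta>. Z (base \<eta>) $ k) has_derivative (\<lambda>v. ?D k (base v))) (at \<xi>)" for k
  proof -
    have "((\<lambda>x. Z x $ k) has_derivative ?D k) (at (base \<xi>))"
      using Z[of k] by (simp add: frechet_derivative_works)
    from has_derivative_compose[OF bounded_linear_imp_has_derivative[OF lb] this]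
    show ?thesis .
  qed
  have "(iota Z has_derivative
      (\<lambda>v. \<Sum>k\<in>UNIV. fibre \<xi> $ k * ?D k (base v) + fibre v $ k * Z (base \<xi>) $ k)) (at \<xi>)"
    unfolding iota_def[abs_def]
    by (intro has_derivative_sum has_derivative_mult Zb bounded_linear_imp_has_derivative lf)
  then have "frechet_derivative (iota Z) (at \<xi>) (complete_lift X \<xi>)
      = (\<Sum>k\<in>UNIV. fibre \<xi> $ k * ?D k (X (base \<xi>)))
        - (\<Sum>k\<in>UNIV. \<Sum>m\<in>UNIV. fibre \<xi> $ m * pd k (\<lambda>x. X x $ m) (base \<xi>) * Z (base \<xi>) $ k)"
    by (simp add: frechet_derivative_at[symmetric] complete_lift_def sum.distrib sum_negf
        sum_distrib_right)
  also have "(\<Sum>k\<in>UNIV. \<Sum>m\<in>UNIV. fibre \<xi> $ m * pd k (\<lambda>x. X x $ m) (base \<xi>) * Z (base \<xi>) $ k)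
      = (\<Sum>m\<in>UNIV. \<Sum>k\<in>UNIV. fibre \<xi> $ m * pd k (\<lambda>x. X x $ m) (base \<xi>) * Z (base \<xi>) $ k)"
    by (rule sum.swap)
  finally show ?thesis
    unfolding iota_def[of "lie_bracket X Z"]
    by (simp add: lie_bracket_def derivative_eq_sum_pd[OF Z] sum_distrib_left
        sum_subtractf right_diff_distrib mult_ac)
qed

lemma iota11_complete_lift:
  "iota11 T \<xi> \<bullet> complete_lift X \<xi> = iota (\<lambda>x. T x *v X x) \<xi>"
proof -
  have "iota11 T \<xi> \<bullet> complete_lift X \<xi>
      = (\<Sum>i\<in>UNIV. \<Sum>k\<in>UNIV. fibre \<xi> $ k * T (base \<xi>) $ k $ i * X (base \<xi>) $ i)"
    by (simp add: inner_vec_def sum_UNIV_Plus iota11_def complete_lift_def sum_distrib_right)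
  also have "\<dots> = (\<Sum>k\<in>UNIV. \<Sum>i\<in>UNIV. fibre \<xi> $ k * T (base \<xi>) $ k $ i * X (base \<xi>) $ i)"
    by (rule sum.swap)
  finally show ?thesis
    by (simp add: iota_def matrix_vector_mult_def sum_distrib_left mult_ac)
qed

lemma riemann_extension_complete_lift:
  assumes sym: "\<And>i j k. \<Gamma> (base \<xi>) i j k = \<Gamma> (base \<xi>) j i k"
  shows "complete_lift X \<xi> \<bullet> (riemann_extension \<Gamma> \<xi> *v complete_lift Y \<xi>)
    = - iota (\<lambda>x. cov_deriv \<Gamma> X Y x + cov_deriv \<Gamma> Y X x) \<xi>"
proof -
  define p x y where "p = fibre \<xi>" and "x = X (base \<xi>)" and "y = Y (base \<xi>)"
  define G where "G = \<Gamma> (base \<xi>)"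
  define dX dY where "dX i k = pd i (\<lambda>x. X x $ k) (base \<xi>)"
    and "dY i k = pd i (\<lambda>x. Y x $ k) (base \<xi>)" for i k
  note defs = p_def[symmetric] x_def[symmetric] y_def[symmetric] G_def[symmetric]
    dX_def[symmetric] dY_def[symmetric]
  define Q where "Q = (\<Sum>i\<in>UNIV. \<Sum>j\<in>UNIV. \<Sum>k\<in>UNIV. p $ k * G i j k * x $ i * y $ j)"
  define A where "A = (\<Sum>i\<in>UNIV. \<Sum>k\<in>UNIV. p $ k * (x $ i * dY i k))"
  define B where "B = (\<Sum>i\<in>UNIV. \<Sum>k\<in>UNIV. p $ k * (y $ i * dX i k))"
  have if_sum: "(\<Sum>j\<in>UNIV. (if i = j then 1 else 0) * f j) = f i" for i :: 'a and f :: "'a \<Rightarrow> real"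
    by (simp add: if_distrib[of "\<lambda>z. z * _"] cong: if_cong)
  have "complete_lift X \<xi> \<bullet> (riemann_extension \<Gamma> \<xi> *v complete_lift Y \<xi>)
      = (\<Sum>i\<in>UNIV. x $ i * ((\<Sum>j\<in>UNIV. - 2 * (\<Sum>k\<in>UNIV. p $ k * G i j k) * y $ j)
            - (\<Sum>k\<in>UNIV. p $ k * dY i k)))
        + (\<Sum>i\<in>UNIV. - (\<Sum>k\<in>UNIV. p $ k * dX i k) * y $ i)"
    by (simp add: inner_vec_def sum_UNIV_Plus matrix_vector_mult_def riemann_extension_def
        complete_lift_def if_sum sum_negf defs)
  also have "\<dots> = - 2 * Q - A - B"
    by (simp add: Q_def A_def B_def sum_distrib_left sum_distrib_right sum_subtractf sum_negf
        right_diff_distrib mult_ac)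
  also have "\<dots> = - iota (\<lambda>x. cov_deriv \<Gamma> X Y x + cov_deriv \<Gamma> Y X x) \<xi>"
  proof -
    have sw: "(\<Sum>k\<in>UNIV. \<Sum>i\<in>UNIV. \<Sum>j\<in>UNIV. f i j k) = (\<Sum>i\<in>UNIV. \<Sum>j\<in>UNIV. \<Sum>k\<in>UNIV. f i j k)"
      for f :: "'a \<Rightarrow> 'a \<Rightarrow> 'a \<Rightarrow> real"
      by (subst sum.swap, rule sum.cong[OF refl], rule sum.swap)
    have A': "A = (\<Sum>k\<in>UNIV. \<Sum>i\<in>UNIV. p $ k * (x $ i * dY i k))"
      unfolding A_def by (rule sum.swap)
    have B': "B = (\<Sum>k\<in>UNIV. \<Sum>i\<in>UNIV. p $ k * (y $ i * dX i k))"
      unfolding B_def by (rule sum.swap)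
    have Q1: "(\<Sum>k\<in>UNIV. \<Sum>i\<in>UNIV. \<Sum>j\<in>UNIV. p $ k * (G i j k * x $ i * y $ j)) = Q"
      unfolding Q_def by (subst sw) (simp add: mult_ac)
    have "(\<Sum>k\<in>UNIV. \<Sum>i\<in>UNIV. \<Sum>j\<in>UNIV. p $ k * (G i j k * y $ i * x $ j))
        = (\<Sum>i\<in>UNIV. \<Sum>j\<in>UNIV. \<Sum>k\<in>UNIV. p $ k * (G j i k * y $ i * x $ j))"
      by (subst sw) (simp add: G_def sym mult_ac)
    also have "\<dots> = Q"
      unfolding Q_def by (subst sum.swap) (simp add: mult_ac)
    finally have Q2: "(\<Sum>k\<in>UNIV. \<Sum>i\<in>UNIV. \<Sum>j\<in>UNIV. p $ k * (G i j k * y $ i * x $ j)) = Q" .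
    have "iota (\<lambda>x. cov_deriv \<Gamma> X Y x + cov_deriv \<Gamma> Y X x) \<xi> = A + Q + (B + Q)"
      unfolding A' B'
      by (subst Q1[symmetric], subst Q2[symmetric])
        (simp add: iota_def cov_deriv_def defs distrib_left sum.distrib sum_distrib_left)
    then show ?thesis by simp
  qed
  finally show ?thesis .
qed

lemma modified_extension_components:
  "modified_extension \<Gamma> \<Phi> T a \<xi> $ Inl i $ Inl j =
     (\<Sum>r\<in>UNIV. \<Sum>s\<in>UNIV. fibre \<xi> $ r * fibre \<xi> $ s *
        (T a (base \<xi>) $ r $ i * T a (base \<xi>) $ s $ j
         + T a (base \<xi>) $ r $ j * T a (base \<xi>) $ s $ i)) / 2
     - 2 * (\<Sum>k\<in>UNIV. fibre \<xi> $ k * \<Gamma> a (base \<xi>) i j k) + \<Phi> a (base \<xi>) $ i $ j"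
  "modified_extension \<Gamma> \<Phi> T a \<xi> $ Inl i $ Inr j = (if i = j then 1 else 0)"
  "modified_extension \<Gamma> \<Phi> T a \<xi> $ Inr i $ Inl j = (if i = j then 1 else 0)"
  "modified_extension \<Gamma> \<Phi> T a \<xi> $ Inr i $ Inr j = 0"
proof -
  let ?u = "\<lambda>i. \<Sum>r\<in>UNIV. fibre \<xi> $ r * T a (base \<xi>) $ r $ i"
  have "(\<Sum>r\<in>UNIV. \<Sum>s\<in>UNIV. fibre \<xi> $ r * fibre \<xi> $ s *
        (T a (base \<xi>) $ r $ i * T a (base \<xi>) $ s $ j
         + T a (base \<xi>) $ r $ j * T a (base \<xi>) $ s $ i)) = ?u i * ?u j + ?u j * ?u i"
    unfolding sum_product by (simp add: distrib_left sum.distrib mult_ac)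
  then show "modified_extension \<Gamma> \<Phi> T a \<xi> $ Inl i $ Inl j =
     (\<Sum>r\<in>UNIV. \<Sum>s\<in>UNIV. fibre \<xi> $ r * fibre \<xi> $ s *
        (T a (base \<xi>) $ r $ i * T a (base \<xi>) $ s $ j
         + T a (base \<xi>) $ r $ j * T a (base \<xi>) $ s $ i)) / 2
     - 2 * (\<Sum>k\<in>UNIV. fibre \<xi> $ k * \<Gamma> a (base \<xi>) i j k) + \<Phi> a (base \<xi>) $ i $ j"
    by (simp only: modified_extension_def sym_prod_def iota11_def riemann_extension_def
        pullback02_def vector_add_component vec_lambda_beta sum.case join_simps)
      simp
qed (simp_all add: modified_extension_def sym_prod_def iota11_def riemann_extension_def
    pullback02_def)

end

theory Submission
  imports Defs
begin

text \<open>
  In induced coordinates the metric is a Walker metric, with matrix \<open>((A, I), (I, 0))\<close>, where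
  \<open>A\<^sub>i\<^sub>j = u\<^sub>i u\<^sub>j - 2 y\<^sub>k \<Gamma>\<^sub>i\<^sub>j\<^sup>k + \<Phi>\<^sub>i\<^sub>j\<close>, \<open>y\<close> denotes the fibre coordinates and \<open>u = \<iota>T\<close>.
  Its Christoffel symbols are explicit, and those with an upper base index
  vanish as soon as a lower index is a fibre index.  The Ricci tensor is annihilated by the vertical
  directions because \<open>T\<close> squares to zero and hence is trace free.

  \<^emph>\<open>Half conformal flatness.\<close>  The vertical plane picks out one of the two types of two-forms.  On the
  other type the Weyl tensor has components quadratic in \<open>T\<close>, coming from \<open>u \<otimes> u\<close> by two
  fibre derivatives.  On the type containing the vertical plane it pairs \<open>\<partial>\<^sub>1 \<and> \<partial>\<^sub>2\<close> with the
  trace form to give the trace of \<open>R\<^sup>D(\<partial>\<^sub>1,\<partial>\<^sub>2)\<close> along the zero section, a nonzero multiple of the skew part of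
  \<open>\<rho>\<^sup>D\<close>.  Neither vanishes, so both halves of the Weyl tensor are nonzero
  (\<open>weyl_pm_nonzero\<close>).

  \<^emph>\<open>Conformally Einstein.\<close>  If \<open>F\<^sup>-\<^sup>2 g\<close> is Einstein, then \<open>2 Hes F + F \<rho>\<close> is a multiple of \<open>g\<close>
  (\<open>ricci_conformal\<close>); eliminating \<open>\<rho>\<close> with the soliton equation, so is \<open>2 Hes F - F Hes f\<close>.
  Its vertical and mixed components say that \<open>F\<close> is affine on the fibres, with fibre gradient a vector field \<open>\<beta>\<close> that satisfies \<open>T \<beta> = 0\<close> and \<open>D\<beta> = \<eta> Id\<close>.  Since \<open>T\<close>
  is parallel, \<open>\<eta> T = D(T \<beta>) = 0\<close>; so \<open>\<beta>\<close> is parallel and is killed by the curvature.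
  The curvature commutes with \<open>T\<close> and has nonzero trace, hence it is injective on the kernel of \<open>T\<close>, and \<open>\<beta> = 0\<close>
  (\<open>homothetic_kernel_field_zero\<close>).  So \<open>F\<close> is a function on the surface.  The horizontal
  components say that \<open>\<omega> = 2 dF - F dh\<close> satisfies \<open>\<omega> \<circ> T = 0\<close> and \<open>D\<omega> = - dF \<otimes> dh\<close>.  Applying \<open>T\<close> once more gives
  \<open>dF \<circ> T = dh \<circ> T = 0\<close>; the Ricci identity then yields \<open>\<omega> \<circ> R\<^sup>D = 0\<close>, so \<open>\<omega> = 0\<close> by the same
  argument as for \<open>\<beta>\<close>, and therefore \<open>dF \<otimes> dh = 0\<close> and \<open>dh = 0\<close>
  (\<open>soliton_conformal_factor_critical\<close>).

  This takes place at a point with \<open>dh \<noteq> 0\<close>, which exists because the surface is connected and \<open>h\<close> is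
  not constant.  A parallel tensor that is nonzero somewhere on a connected manifold vanishes nowhere
  (\<open>parallel11_nowhere_zero\<close>), so \<open>T\<close> is nonzero at that point too.
\<close>

section \<open>Calculus of partial derivatives\<close>

lemma pd_cong:
  assumes "open U" "x \<in> U" "\<And>y. y \<in> U \<Longrightarrow> f y = g y"
  shows "pd i f x = pd i g x"
proof -
  have "(f has_derivative D) (at x) \<longleftrightarrow> (g has_derivative D) (at x)" for D
    using has_derivative_transform_within_open[of f D x UNIV U g]
      has_derivative_transform_within_open[of g D x UNIV U f] assms by auto
  then show ?thesis by (simp add: pd_def frechet_derivative_def)
qed

lemma pd_eqI: "(f has_derivative D) (at x) \<Longrightarrow> D (axis i 1) = d \<Longrightarrow> pd i f x = d"
  by (auto simp: pd_def frechet_derivative_at[symmetric])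

lemma has_derivative_pd:
  "f differentiable (at x) \<Longrightarrow> (f has_derivative (\<lambda>v. \<Sum>i\<in>UNIV. v $ i * pd i f x)) (at x)"
  using derivative_eq_sum_pd[of f x] frechet_derivative_works[of f "at x"]
  by (metis (no_types, lifting) ext)

lemma pd_const [simp]: "pd i (\<lambda>x. c) x = 0"
  by (rule pd_eqI) (auto intro!: derivative_eq_intros)

lemma pd_add:
  "f differentiable (at x) \<Longrightarrow> g differentiable (at x) \<Longrightarrow> pd i (\<lambda>y. f y + g y) x = pd i f x + pd i g x"
  by (rule pd_eqI, rule has_derivative_add; (subst (asm) frechet_derivative_works)?) (auto simp: pd_def)

lemma pd_diff:
  "f differentiable (at x) \<Longrightarrow> g differentiable (at x) \<Longrightarrow> pd i (\<lambda>y. f y - g y) x = pd i f x - pd i g x"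
  by (rule pd_eqI, rule has_derivative_diff; (subst (asm) frechet_derivative_works)?) (auto simp: pd_def)

lemma pd_minus: "f differentiable (at x) \<Longrightarrow> pd i (\<lambda>y. - f y) x = - pd i f x"
  by (rule pd_eqI, rule has_derivative_minus; (subst (asm) frechet_derivative_works)?) (auto simp: pd_def)

lemma pd_mult:
  "f differentiable (at x) \<Longrightarrow> g differentiable (at x) \<Longrightarrow>
    pd i (\<lambda>y. f y * g y) x = f x * pd i g x + pd i f x * g x"
  by (rule pd_eqI, rule has_derivative_mult; (subst (asm) frechet_derivative_works)?) (auto simp: pd_def)

lemma pd_sum:
  "finite I \<Longrightarrow> (\<And>k. k \<in> I \<Longrightarrow> f k differentiable (at x)) \<Longrightarrow>
    pd i (\<lambda>y. \<Sum>k\<in>I. f k y) x = (\<Sum>k\<in>I. pd i (f k) x)"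
  by (rule pd_eqI, rule has_derivative_sum, subst (asm) frechet_derivative_works) (auto simp: pd_def)

lemma pd_cmult: "f differentiable (at x) \<Longrightarrow> pd i (\<lambda>y. c * f y) x = c * pd i f x"
  by (simp add: pd_mult)

lemma pd_compose:
  fixes F :: "real ^ 'n::finite \<Rightarrow> real ^ 'm::finite"
  assumes F: "\<And>m. (\<lambda>y. F y $ m) differentiable (at x)" and f: "f differentiable (at (F x))"
  shows "pd i (\<lambda>y. f (F y)) x = (\<Sum>m\<in>UNIV. pd m f (F x) * pd i (\<lambda>y. F y $ m) x)"
    and "(\<lambda>y. f (F y)) differentiable (at x)"
proof -
  let ?D = "\<lambda>m. frechet_derivative (\<lambda>y. F y $ m) (at x)"
  have "(F has_derivative (\<lambda>v. \<chi> m. ?D m v)) (at x)"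
    using F by (subst has_derivative_componentwise_within)
      (auto simp: Basis_vec_def inner_axis frechet_derivative_works)
  from has_derivative_compose[OF this has_derivative_pd[OF f]]
  have "((\<lambda>y. f (F y)) has_derivative (\<lambda>v. \<Sum>m\<in>UNIV. ?D m v * pd m f (F x))) (at x)"
    by (simp add: o_def)
  then show "pd i (\<lambda>y. f (F y)) x = (\<Sum>m\<in>UNIV. pd m f (F x) * pd i (\<lambda>y. F y $ m) x)"
      "(\<lambda>y. f (F y)) differentiable (at x)"
    by (auto intro!: pd_eqI sum.cong simp: differentiable_def pd_def[of _ "\<lambda>y. F y $ _"])
qed

lemma smooth_on_differentiable: "smooth_on U f \<Longrightarrow> x \<in> U \<Longrightarrow> f differentiable (at x)"
  by (metis smooth_on_def Ck_on.simps(2))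

lemma smooth_on_pd: "smooth_on U f \<Longrightarrow> smooth_on U (pd i f)"
  by (metis smooth_on_def Ck_on.simps(2))

lemma smooth_on_continuous: "smooth_on U f \<Longrightarrow> continuous_on U f"
  by (metis smooth_on_def Ck_on.simps(1))

lemma Ck_on_subset: "Ck_on k f U \<Longrightarrow> V \<subseteq> U \<Longrightarrow> Ck_on k f V"
  by (induction k arbitrary: f) (auto intro: continuous_on_subset)

lemma smooth_on_subset: "smooth_on U f \<Longrightarrow> V \<subseteq> U \<Longrightarrow> smooth_on V f"
  by (meson smooth_on_def Ck_on_subset)

lemma Ck_on_cong:
  "open U \<Longrightarrow> (\<And>x. x \<in> U \<Longrightarrow> f x = g x) \<Longrightarrow> Ck_on k f U \<Longrightarrow> Ck_on k g U"
proof (induction k arbitrary: f g)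
  case 0 then show ?case using continuous_on_cong by (metis Ck_on.simps(1))
next
  case (Suc k)
  have "g differentiable (at x)" if "x \<in> U" for x
  proof -
    have "f differentiable (at x)" using Suc.prems that by auto
    then show ?thesis
      unfolding differentiable_def
      using has_derivative_transform_within_open[OF _ Suc.prems(1) that, of f _ UNIV g] Suc.prems(2)
      by blast
  qed
  moreover have "Ck_on k (pd i g) U" for i
    by (rule Suc.IH[of "pd i f"]) (use Suc.prems pd_cong[of U _ f g] in auto)
  ultimately show ?case by simp
qed

lemma pd_mvt:
  fixes f :: "real ^ 'n::finite \<Rightarrow> real"
  assumes "0 < s" and d: "\<And>t. 0 \<le> t \<Longrightarrow> t \<le> s \<Longrightarrow> f differentiable (at (x + t *\<^sub>R axis i 1))"
  shows "\<exists>t. 0 < t \<and> t < s \<and> f (x + s *\<^sub>R axis i 1) - f x = s * pd i f (x + t *\<^sub>R axis i 1)"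
proof -
  have D: "((\<lambda>t. f (x + t *\<^sub>R axis i 1)) has_real_derivative pd i f (x + t *\<^sub>R axis i 1)) (at t)"
    if "0 \<le> t" "t \<le> s" for t
  proof -
    have g: "((\<lambda>t. x + t *\<^sub>R axis i 1) has_derivative (\<lambda>h. h *\<^sub>R axis i 1)) (at t)"
      by (auto intro!: derivative_eq_intros)
    have "(f has_derivative frechet_derivative f (at (x + t *\<^sub>R axis i 1))) (at (x + t *\<^sub>R axis i 1))"
      using d[OF that] by (simp add: frechet_derivative_works)
    note diff_chain = has_derivative_compose[OF g this]
    have "linear (frechet_derivative f (at (x + t *\<^sub>R axis i 1)))"
      by (rule linear_frechet_derivative[OF d[OF that]])
    then show ?thesis
      using diff_chain by (simp add: has_field_derivative_def o_def linear_cmul pd_def mult_commute_abs)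
  qed
  from MVT2[OF assms(1) D] show ?thesis by auto
qed

text \<open>Schwarz's theorem.  Applying the mean value theorem twice, in either order, writes the second
  difference quotient over a small parallelogram as a value of each mixed derivative near \<open>x\<close>.\<close>

lemma pd_commute:
  fixes f :: "real ^ 'n::finite \<Rightarrow> real"
  assumes U: "open U" "x \<in> U" and f: "smooth_on U f"
  shows "pd i (pd j f) x = pd j (pd i f) x"
proof -
  obtain r where r: "r > 0" "ball x r \<subseteq> U" using U openE by blast
  have inU: "x + a *\<^sub>R axis i 1 + b *\<^sub>R axis j 1 \<in> U"
    if "0 \<le> a" "a < r/2" "0 \<le> b" "b < r/2" for a b :: real and i j
  proof -
    have "norm (a *\<^sub>R axis i 1 + b *\<^sub>R axis j (1::real) :: real ^ 'n) \<le> a + b"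
      using that by (intro norm_triangle_le) simp
    then have "x + a *\<^sub>R axis i 1 + b *\<^sub>R axis j 1 \<in> ball x r"
      using that norm_minus_cancel[of "a *\<^sub>R axis i 1 + b *\<^sub>R axis j (1::real) :: real ^ 'n"]
      by (simp add: dist_norm)
    then show ?thesis using r by auto
  qed
  have dq: "\<exists>a b. 0 < a \<and> a < s \<and> 0 < b \<and> b < s \<and>
      f (x + s *\<^sub>R axis i 1 + s *\<^sub>R axis j 1) - f (x + s *\<^sub>R axis i 1) - f (x + s *\<^sub>R axis j 1) + f x
      = s * s * pd j (pd i f) (x + a *\<^sub>R axis i 1 + b *\<^sub>R axis j 1)"
    if s: "0 < s" "s < r/2" for s i j
  proof -
    \<comment> \<open>the second difference is the increment of the first difference \<open>?g\<close>\<close>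
    let ?g = "\<lambda>y. f (y + s *\<^sub>R axis j 1) - f y"
    have tr: "((\<lambda>y. y + c) has_derivative (\<lambda>v. v)) (at y)" for y c :: "real ^ 'n"
      by (auto intro!: derivative_eq_intros)
    have shift: "(\<lambda>y. f (y + c)) differentiable (at y)" "pd i (\<lambda>y. f (y + c)) y = pd i f (y + c)"
      if "y + c \<in> U" for y c
    proof -
      have "(f has_derivative frechet_derivative f (at (y + c))) (at (y + c))"
        using smooth_on_differentiable[OF f that] by (simp add: frechet_derivative_works)
      note * = has_derivative_compose[OF tr this]
      show "(\<lambda>y. f (y + c)) differentiable (at y)" using * by (auto simp: differentiable_def)
      show "pd i (\<lambda>y. f (y + c)) y = pd i f (y + c)" by (rule pd_eqI[OF *]) (simp add: pd_def)
    qed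
    have inU0: "x + t *\<^sub>R axis i 1 \<in> U" "x + t *\<^sub>R axis i 1 + s *\<^sub>R axis j 1 \<in> U"
      if "0 \<le> t" "t \<le> s" for t
      using inU[of t 0 i j] inU[of t s i j] that s by auto
    have "\<exists>a. 0 < a \<and> a < s \<and> ?g (x + s *\<^sub>R axis i 1) - ?g x = s * pd i ?g (x + a *\<^sub>R axis i 1)"
      using s(1) by (intro pd_mvt differentiable_diff shift smooth_on_differentiable[OF f])
        (use inU0 in auto)
    then obtain a where a: "0 < a" "a < s"
      "?g (x + s *\<^sub>R axis i 1) - ?g x = s * pd i ?g (x + a *\<^sub>R axis i 1)" by blast
    have "\<exists>b. 0 < b \<and> b < s \<and> pd i f (x + a *\<^sub>R axis i 1 + s *\<^sub>R axis j 1) - pd i f (x + a *\<^sub>R axis i 1)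
        = s * pd j (pd i f) (x + a *\<^sub>R axis i 1 + b *\<^sub>R axis j 1)"
      using s(1) a s by (intro pd_mvt smooth_on_differentiable[OF smooth_on_pd[OF f]] inU) auto
    then obtain b where b: "0 < b" "b < s" "pd i f (x + a *\<^sub>R axis i 1 + s *\<^sub>R axis j 1) - pd i f (x + a *\<^sub>R axis i 1)
        = s * pd j (pd i f) (x + a *\<^sub>R axis i 1 + b *\<^sub>R axis j 1)" by blast
    have "pd i ?g (x + a *\<^sub>R axis i 1)
        = pd i f (x + a *\<^sub>R axis i 1 + s *\<^sub>R axis j 1) - pd i f (x + a *\<^sub>R axis i 1)"
      using a s inU0[of a]
      by (subst pd_diff) (auto simp: shift smooth_on_differentiable[OF f])
    with a b show ?thesis by (intro exI[of _ a] exI[of _ b]) (auto simp: algebra_simps)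
  qed
  have lim: "(\<lambda>n. G (x + a n *\<^sub>R axis i 1 + b n *\<^sub>R axis j 1)) \<longlonglongrightarrow> G x"
    if G: "continuous_on U G" and ab: "\<And>n. 0 < a n \<and> a n < s n \<and> 0 < b n \<and> b n < s n"
      and s: "s \<longlonglongrightarrow> 0" for G :: "real ^ 'n \<Rightarrow> real" and a b s and i j :: 'n
  proof -
    have a: "a \<longlonglongrightarrow> 0" by (rule tendsto_sandwich[OF _ _ tendsto_const s]) (use ab in \<open>auto intro: always_eventually less_imp_le\<close>)
    have b: "b \<longlonglongrightarrow> 0" by (rule tendsto_sandwich[OF _ _ tendsto_const s]) (use ab in \<open>auto intro: always_eventually less_imp_le\<close>)
    have "(\<lambda>n. x + a n *\<^sub>R axis i 1 + b n *\<^sub>R axis j 1) \<longlonglongrightarrow> x + 0 *\<^sub>R axis i 1 + 0 *\<^sub>R axis j 1"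
      by (intro tendsto_intros a b)
    moreover have "isCont G x" using G U continuous_on_eq_continuous_at by blast
    ultimately show ?thesis
      using isCont_tendsto_compose[of x G "\<lambda>n. x + a n *\<^sub>R axis i 1 + b n *\<^sub>R axis j 1" sequentially]
      by simp
  qed
  define s where "s n = (r/3) * inverse (real (Suc n))" for n
  have s0: "s \<longlonglongrightarrow> 0"
    unfolding s_def using tendsto_mult_right[OF LIMSEQ_inverse_real_of_nat, of "r/3"] by (simp add: mult.commute)
  have s: "0 < s n" "s n < r/2" for n
  proof -
    show "0 < s n" using r by (simp add: s_def)
    have "inverse (real (Suc n)) \<le> 1" by (simp add: inverse_eq_divide)
    then have "s n \<le> r/3 * 1" unfolding s_def using r by (intro mult_left_mono) auto
    then show "s n < r/2" using r by simp
  qed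
  define \<Delta> where "\<Delta> n = f (x + s n *\<^sub>R axis i 1 + s n *\<^sub>R axis j 1) - f (x + s n *\<^sub>R axis i 1)
    - f (x + s n *\<^sub>R axis j 1) + f x" for n
  have "\<forall>n. \<exists>a b. 0 < a \<and> a < s n \<and> 0 < b \<and> b < s n \<and>
      \<Delta> n = s n * s n * pd j (pd i f) (x + a *\<^sub>R axis i 1 + b *\<^sub>R axis j 1)"
    unfolding \<Delta>_def using dq[OF s] by blast
  then obtain a b where ab: "\<And>n. 0 < a n \<and> a n < s n \<and> 0 < b n \<and> b n < s n"
    and 1: "\<And>n. \<Delta> n = s n * s n * pd j (pd i f) (x + a n *\<^sub>R axis i 1 + b n *\<^sub>R axis j 1)"
    by metis
  have "\<forall>n. \<exists>a b. 0 < a \<and> a < s n \<and> 0 < b \<and> b < s n \<and>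
      \<Delta> n = s n * s n * pd i (pd j f) (x + a *\<^sub>R axis j 1 + b *\<^sub>R axis i 1)"
    unfolding \<Delta>_def using dq[OF s, of _ j i] by (simp add: algebra_simps)
  then obtain c d where cd: "\<And>n. 0 < c n \<and> c n < s n \<and> 0 < d n \<and> d n < s n"
    and 2: "\<And>n. \<Delta> n = s n * s n * pd i (pd j f) (x + c n *\<^sub>R axis j 1 + d n *\<^sub>R axis i 1)"
    by metis
  have "pd j (pd i f) (x + a n *\<^sub>R axis i 1 + b n *\<^sub>R axis j 1)
      = pd i (pd j f) (x + c n *\<^sub>R axis j 1 + d n *\<^sub>R axis i 1)" for n
    using 1[of n] 2[of n] s(1)[of n] by simp
  moreover have "continuous_on U (pd j (pd i f))" "continuous_on U (pd i (pd j f))"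
    by (intro smooth_on_continuous smooth_on_pd f)+
  ultimately show ?thesis
    using lim[OF _ ab s0, of "pd j (pd i f)" i j] lim[OF _ cd s0, of "pd i (pd j f)" j i]
    by (metis (mono_tags, lifting) LIMSEQ_unique tendsto_cong always_eventually)
qed

lemma Ck_on_SucD: "Ck_on (Suc k) f U \<Longrightarrow> Ck_on k f U"
proof (induction k arbitrary: f)
  case 0
  then show ?case
    by (auto intro!: continuous_at_imp_continuous_on differentiable_imp_continuous_within)
qed auto

lemma Ck_on_add: "open U \<Longrightarrow> Ck_on k f U \<Longrightarrow> Ck_on k g U \<Longrightarrow> Ck_on k (\<lambda>x. f x + g x) U"
proof (induction k arbitrary: f g)
  case (Suc k)
  have "Ck_on k (pd i (\<lambda>x. f x + g x)) U" for i
    by (rule Ck_on_cong[of _ "\<lambda>x. pd i f x + pd i g x"]) (use Suc in \<open>auto simp: pd_add\<close>)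
  then show ?case using Suc.prems by auto
qed (auto intro: continuous_intros)

lemma Ck_on_mult: "open U \<Longrightarrow> Ck_on k f U \<Longrightarrow> Ck_on k g U \<Longrightarrow> Ck_on k (\<lambda>x. f x * g x) U"
proof (induction k arbitrary: f g)
  case (Suc k)
  have "Ck_on k (pd i (\<lambda>x. f x * g x)) U" for i
    by (rule Ck_on_cong[of _ "\<lambda>x. f x * pd i g x + pd i f x * g x"])
      (use Suc Suc.prems(2,3)[THEN Ck_on_SucD] in \<open>auto simp: pd_mult intro!: Ck_on_add Suc.IH\<close>)
  then show ?case using Suc.prems by auto
qed (auto intro: continuous_intros)

lemma Ck_on_const: "Ck_on k (\<lambda>x. c) U"
proof (induction k arbitrary: c)
  case (Suc k)
  have "pd i (\<lambda>x. c) = (\<lambda>x. 0)" for i :: 'a by auto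
  then show ?case using Suc by simp
qed auto

lemma smooth_on_const: "smooth_on U (\<lambda>x. c)"
  by (simp add: smooth_on_def Ck_on_const)

lemma smooth_on_add: "open U \<Longrightarrow> smooth_on U f \<Longrightarrow> smooth_on U g \<Longrightarrow> smooth_on U (\<lambda>x. f x + g x)"
  by (simp add: smooth_on_def Ck_on_add)

lemma smooth_on_mult: "open U \<Longrightarrow> smooth_on U f \<Longrightarrow> smooth_on U g \<Longrightarrow> smooth_on U (\<lambda>x. f x * g x)"
  by (simp add: smooth_on_def Ck_on_mult)

lemma smooth_on_diff: "open U \<Longrightarrow> smooth_on U f \<Longrightarrow> smooth_on U g \<Longrightarrow> smooth_on U (\<lambda>x. f x - g x)"
  using smooth_on_add[of U f "\<lambda>x. (-1) * g x"] smooth_on_mult[of U "\<lambda>x. -1" g] smooth_on_const by force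

lemma smooth_on_sum: "finite I \<Longrightarrow> open U \<Longrightarrow> (\<And>k. k \<in> I \<Longrightarrow> smooth_on U (f k)) \<Longrightarrow> smooth_on U (\<lambda>x. \<Sum>k\<in>I. f k x)"
  by (induction I rule: finite_induct) (auto intro: smooth_on_const smooth_on_add)

lemma differentiable_divide_const:
  fixes f :: "real ^ 'n::finite \<Rightarrow> real"
  shows "f differentiable (at x) \<Longrightarrow> (\<lambda>y. f y / c) differentiable (at x)"
  by (simp add: divide_inverse differentiable_mult)

lemma pd_divide: "f differentiable (at x) \<Longrightarrow> pd i (\<lambda>y. f y / c) x = pd i f x / c"
  using pd_cmult[of f x i "inverse c"] by (simp add: divide_inverse mult.commute)

lemma differentiable_component: "(\<lambda>x::real ^ 'n::finite. x $ k) differentiable (at x)"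
  by (intro linear_imp_differentiable linearI) auto

lemma pd_component: "pd i (\<lambda>x::real ^ 'n::finite. x $ k) x = (if i = k then 1 else 0)"
  by (rule pd_eqI[of _ "\<lambda>v. v $ k"])
    (auto simp: axis_def intro!: linear_imp_has_derivative linearI)

lemma smooth_on_component: "smooth_on U (\<lambda>x::real ^ 'n::finite. x $ k)"
proof -
  have "Ck_on m (\<lambda>x::real ^ 'n. x $ k) U" for m
  proof (cases m)
    case (Suc m')
    have "pd i (\<lambda>x::real ^ 'n. x $ k) = (\<lambda>_. if i = k then 1 else 0)" for i
      by (rule ext) (rule pd_component)
    then show ?thesis using Suc by (simp add: differentiable_component Ck_on_const)
  qed (auto intro!: continuous_intros)
  then show ?thesis by (simp add: smooth_on_def)
qed

section \<open>The Ricci tensor under a conformal change\<close>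

lemma sum_kronecker:
  fixes f :: "'n::finite \<Rightarrow> real"
  shows "(\<Sum>i\<in>UNIV. (if i = j then 1 else 0) * f i) = f j" "(\<Sum>i\<in>UNIV. (if j = i then 1 else 0) * f i) = f j"
    "(\<Sum>i\<in>UNIV. f i * (if i = j then 1 else 0)) = f j" "(\<Sum>i\<in>UNIV. f i * (if j = i then 1 else 0)) = f j"
  by (simp_all add: if_distrib[of "\<lambda>z. z * _"] if_distrib[of "\<lambda>z. _ * z"] cong: if_cong)

text \<open>The difference \<open>C\<close> is that of the Levi-Civita connections of \<open>F\<^sup>-\<^sup>2 g\<close> and \<open>g\<close>, with
  \<open>\<psi> = d ln F\<close> and \<open>v\<close> its gradient.  The sum over \<open>v\<close> on the right is left in a form that
  cancels against the derivative of \<open>g\<close> in the divergence of \<open>C\<close>, by metric compatibility.\<close>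

lemma ricci_conformal_quadratic_part:
  fixes \<Gamma> C :: "'n::finite \<Rightarrow> 'n \<Rightarrow> 'n \<Rightarrow> real" and g :: "'n \<Rightarrow> 'n \<Rightarrow> real" and \<psi> v :: "'n \<Rightarrow> real"
  defines "n \<equiv> real CARD('n)"
  assumes \<Gamma>: "\<And>i j k. \<Gamma> i j k = \<Gamma> j i k" and g: "\<And>i j. g i j = g j i"
    and v: "\<And>i. (\<Sum>j\<in>UNIV. g i j * v j) = \<psi> i"
    and C: "\<And>i j k. C i j k = - ((if k = i then 1 else 0) * \<psi> j + (if k = j then 1 else 0) * \<psi> i - g i j * v k)"
  shows "(\<Sum>i\<in>UNIV. \<Sum>m\<in>UNIV. (\<Gamma> j k m + C j k m) * (\<Gamma> i m i + C i m i)
        - (\<Gamma> i k m + C i k m) * (\<Gamma> j m i + C j m i))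
    = (\<Sum>i\<in>UNIV. \<Sum>m\<in>UNIV. \<Gamma> j k m * \<Gamma> i m i - \<Gamma> i k m * \<Gamma> j m i)
      + (n - 2) * (\<psi> j * \<psi> k - (\<Sum>m\<in>UNIV. \<Gamma> j k m * \<psi> m))
      - (\<Sum>i\<in>UNIV. v i * (\<Sum>m\<in>UNIV. \<Gamma> i j m * g m k + \<Gamma> i k m * g j m))
      + g j k * ((\<Sum>m\<in>UNIV. v m * (\<Sum>i\<in>UNIV. \<Gamma> i m i)) - (n - 2) * (\<Sum>m\<in>UNIV. v m * \<psi> m))"
proof -
  define t where "t m = (\<Sum>i\<in>UNIV. \<Gamma> i m i)" for m
  define N where "N = (\<Sum>m\<in>UNIV. v m * \<psi> m)"
  have CX: "(\<Sum>m\<in>UNIV. C i k m * X m) = - (\<psi> k * X i + \<psi> i * X k - g i k * (\<Sum>m\<in>UNIV. v m * X m))" for i k X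
  proof -
    have "(\<Sum>m\<in>UNIV. C i k m * X m) = (\<Sum>m\<in>UNIV. - ((if m = i then 1 else 0) * (\<psi> k * X m))
        - ((if m = k then 1 else 0) * (\<psi> i * X m)) + g i k * (v m * X m))"
      by (rule sum.cong) (auto simp: C algebra_simps)
    then show ?thesis
      by (simp only: sum.distrib sum_subtractf sum_negf sum_kronecker sum_distrib_left[symmetric]; simp)
  qed
  have Ctr: "(\<Sum>i\<in>UNIV. C i m i) = - n * \<psi> m" for m
  proof -
    have "(\<Sum>i\<in>UNIV. C i m i) = (\<Sum>i\<in>UNIV. - \<psi> m - (if i = m then 1 else 0) * \<psi> i + g m i * v i)"
      by (rule sum.cong) (auto simp: C g algebra_simps)
    also have "\<dots> = - n * \<psi> m"
      by (simp only: sum.distrib sum_subtractf sum_kronecker v) (simp add: n_def)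
    finally show ?thesis .
  qed
  have vC: "(\<Sum>m\<in>UNIV. v m * C j m i) = - (if i = j then 1 else 0) * N" for i
  proof -
    have "(\<Sum>m\<in>UNIV. v m * C j m i) = (\<Sum>m\<in>UNIV. - ((if i = j then 1 else 0) * (v m * \<psi> m))
       - ((if i = m then 1 else 0) * (v m * \<psi> j)) + v i * (g j m * v m))"
      by (rule sum.cong) (auto simp: C algebra_simps)
    also have "\<dots> = - ((if i = j then 1 else 0) * N)"
      by (simp only: sum.distrib sum_subtractf sum_negf sum_kronecker sum_distrib_left[symmetric] v N_def; simp)
    finally show ?thesis by simp
  qed
  have GC: "(\<Sum>i\<in>UNIV. \<Sum>m\<in>UNIV. \<Gamma> i k m * C j m i)
      = - (\<Sum>m\<in>UNIV. \<Gamma> j k m * \<psi> m) - \<psi> j * t k + (\<Sum>i\<in>UNIV. v i * (\<Sum>m\<in>UNIV. \<Gamma> i k m * g j m))"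
  proof -
    have "(\<Sum>i\<in>UNIV. \<Sum>m\<in>UNIV. \<Gamma> i k m * C j m i) = (\<Sum>i\<in>UNIV. \<Sum>m\<in>UNIV.
        - ((if i = j then 1 else 0) * (\<Gamma> i k m * \<psi> m)) - ((if i = m then 1 else 0) * (\<psi> j * \<Gamma> i k m))
          + v i * (\<Gamma> i k m * g j m))"
      by (intro sum.cong) (auto simp: C algebra_simps)
    also have "\<dots> = - (\<Sum>i\<in>UNIV. (if i = j then 1 else 0) * (\<Sum>m\<in>UNIV. \<Gamma> i k m * \<psi> m))
        - (\<Sum>i\<in>UNIV. \<psi> j * \<Gamma> i k i) + (\<Sum>i\<in>UNIV. v i * (\<Sum>m\<in>UNIV. \<Gamma> i k m * g j m))"
      by (simp only: sum.distrib sum_subtractf sum_negf sum_kronecker sum_distrib_left[symmetric])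
    finally show ?thesis
      by (simp only: sum_kronecker t_def; simp add: sum_distrib_left)
  qed
  have A: "(\<Sum>i\<in>UNIV. \<Sum>m\<in>UNIV. (\<Gamma> j k m + C j k m) * (\<Gamma> i m i + C i m i))
      = (\<Sum>m\<in>UNIV. \<Gamma> j k m * t m) - n * (\<Sum>m\<in>UNIV. \<Gamma> j k m * \<psi> m)
        - \<psi> k * t j - \<psi> j * t k + g j k * (\<Sum>m\<in>UNIV. v m * t m) + 2 * n * \<psi> j * \<psi> k - n * g j k * N"
  proof -
    have "(\<Sum>i\<in>UNIV. \<Sum>m\<in>UNIV. (\<Gamma> j k m + C j k m) * (\<Gamma> i m i + C i m i))
        = (\<Sum>m\<in>UNIV. (\<Gamma> j k m + C j k m) * (\<Sum>i\<in>UNIV. \<Gamma> i m i + C i m i))"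
      by (subst sum.swap) (simp only: sum_distrib_left)
    also have "\<dots> = (\<Sum>m\<in>UNIV. \<Gamma> j k m * t m) - n * (\<Sum>m\<in>UNIV. \<Gamma> j k m * \<psi> m)
        + (\<Sum>m\<in>UNIV. C j k m * (t m - n * \<psi> m))"
      by (simp add: sum.distrib Ctr t_def[symmetric] algebra_simps sum_subtractf sum_distrib_left)
    finally have *: "(\<Sum>i\<in>UNIV. \<Sum>m\<in>UNIV. (\<Gamma> j k m + C j k m) * (\<Gamma> i m i + C i m i))
        = (\<Sum>m\<in>UNIV. \<Gamma> j k m * t m) - n * (\<Sum>m\<in>UNIV. \<Gamma> j k m * \<psi> m)
        + (\<Sum>m\<in>UNIV. C j k m * (t m - n * \<psi> m))" .
    have vt: "(\<Sum>m\<in>UNIV. v m * (t m - n * \<psi> m)) = (\<Sum>m\<in>UNIV. v m * t m) - n * N"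
      by (simp add: N_def algebra_simps sum_subtractf sum_distrib_left)
    show ?thesis
      unfolding * CX vt by (simp add: algebra_simps)
  qed
  have B: "(\<Sum>i\<in>UNIV. \<Sum>m\<in>UNIV. (\<Gamma> i k m + C i k m) * (\<Gamma> j m i + C j m i))
      = (\<Sum>i\<in>UNIV. \<Sum>m\<in>UNIV. \<Gamma> i k m * \<Gamma> j m i)
        + (\<Sum>i\<in>UNIV. \<Sum>m\<in>UNIV. \<Gamma> i k m * C j m i)
        - \<psi> k * (t j - n * \<psi> j)
        - (\<Sum>i\<in>UNIV. \<psi> i * \<Gamma> j k i) - (\<Sum>i\<in>UNIV. C j k i * \<psi> i)
        + (\<Sum>i\<in>UNIV. g i k * (\<Sum>m\<in>UNIV. v m * \<Gamma> j m i)) - g j k * N"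
  proof -
    have 1: "(\<Sum>i\<in>UNIV. \<Sum>m\<in>UNIV. (\<Gamma> i k m + C i k m) * (\<Gamma> j m i + C j m i))
        = (\<Sum>i\<in>UNIV. \<Sum>m\<in>UNIV. \<Gamma> i k m * \<Gamma> j m i)
        + (\<Sum>i\<in>UNIV. \<Sum>m\<in>UNIV. \<Gamma> i k m * C j m i)
        + (\<Sum>i\<in>UNIV. \<Sum>m\<in>UNIV. C i k m * (\<Gamma> j m i + C j m i))"
      by (simp add: distrib_left distrib_right sum.distrib)
    have VX: "(\<Sum>m\<in>UNIV. v m * (\<Gamma> j m i + C j m i))
        = (\<Sum>m\<in>UNIV. v m * \<Gamma> j m i) - (if i = j then 1 else 0) * N" for i
      by (simp only: distrib_left sum.distrib vC; simp)
    have Csym: "C j i k = C i j k" for i k using g[of i j] by (auto simp: C)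
    have "(\<Sum>i\<in>UNIV. \<Sum>m\<in>UNIV. C i k m * (\<Gamma> j m i + C j m i))
        = (\<Sum>i\<in>UNIV. - (\<psi> k * (\<Gamma> i j i + C i j i)) - \<psi> i * \<Gamma> j k i - C j k i * \<psi> i
            + g i k * (\<Sum>m\<in>UNIV. v m * \<Gamma> j m i) - (if i = j then 1 else 0) * (g i k * N))"
      unfolding CX VX by (intro sum.cong refl) (simp add: \<Gamma>[of j] Csym algebra_simps)
    also have "\<dots> = - (\<psi> k * (t j - n * \<psi> j)) - (\<Sum>i\<in>UNIV. \<psi> i * \<Gamma> j k i) - (\<Sum>i\<in>UNIV. C j k i * \<psi> i)
        + (\<Sum>i\<in>UNIV. g i k * (\<Sum>m\<in>UNIV. v m * \<Gamma> j m i)) - g j k * N"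
      by (simp only: sum.distrib sum_subtractf sum_negf sum_kronecker sum_distrib_left[symmetric] Ctr t_def; simp)
    finally show ?thesis using 1 by simp
  qed
  have S: "(\<Sum>i\<in>UNIV. g i k * (\<Sum>m\<in>UNIV. v m * \<Gamma> j m i)) = (\<Sum>i\<in>UNIV. v i * (\<Sum>m\<in>UNIV. \<Gamma> i j m * g m k))"
    unfolding sum_distrib_left by (subst sum.swap) (simp add: \<Gamma>[of j] mult_ac)
  have D: "(\<Sum>i\<in>UNIV. \<Sum>m\<in>UNIV. \<Gamma> j k m * \<Gamma> i m i) = (\<Sum>m\<in>UNIV. \<Gamma> j k m * t m)"
    by (subst sum.swap) (simp add: t_def sum_distrib_left)
  have E: "(\<Sum>i\<in>UNIV. \<psi> i * \<Gamma> j k i) = (\<Sum>m\<in>UNIV. \<Gamma> j k m * \<psi> m)" by (simp add: mult.commute)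
  have F: "(\<Sum>i\<in>UNIV. v i * (\<Sum>m\<in>UNIV. \<Gamma> i j m * g m k + \<Gamma> i k m * g j m))
      = (\<Sum>i\<in>UNIV. v i * (\<Sum>m\<in>UNIV. \<Gamma> i j m * g m k)) + (\<Sum>i\<in>UNIV. v i * (\<Sum>m\<in>UNIV. \<Gamma> i k m * g j m))"
    by (simp add: sum.distrib distrib_left)
  show ?thesis
    unfolding sum_subtractf A B GC S D E F CX
    unfolding t_def[symmetric] N_def[symmetric]
    by (simp add: algebra_simps)
qed


lemma matrix_inv_eqI:
  fixes A B :: "'a::semiring_1 ^ 'n ^ 'n"
  assumes "A ** B = mat 1" "B ** A = mat 1"
  shows "matrix_inv A = B"
proof -
  have "A ** matrix_inv A = mat 1 \<and> matrix_inv A ** A = mat 1"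
    unfolding matrix_inv_def by (rule someI[of _ B]) (use assms in simp)
  then have "matrix_inv A = (B ** A) ** matrix_inv A" "A ** matrix_inv A = mat 1"
    using assms by simp_all
  then show ?thesis by (metis matrix_mul_assoc matrix_mul_rid)
qed

lemma levi_civita_lower:
  assumes "\<And>i j. g x $ i $ j = g x $ j $ i" and "matrix_inv (g x) ** g x = mat 1"
  shows "(\<Sum>k\<in>UNIV. levi_civita g x i j k * g x $ k $ m)
    = (pd i (\<lambda>y. g y $ j $ m) x + pd j (\<lambda>y. g y $ i $ m) x - pd m (\<lambda>y. g y $ i $ j) x) / 2"
proof -
  let ?E = "\<lambda>l. pd i (\<lambda>y. g y $ j $ l) x + pd j (\<lambda>y. g y $ i $ l) x - pd l (\<lambda>y. g y $ i $ j) x"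
  have inv: "(\<Sum>k\<in>UNIV. g x $ m $ k * matrix_inv (g x) $ k $ l) = (if m = l then 1 else 0)" for l
  proof -
    have "g x ** matrix_inv (g x) = mat 1"
      using assms(2) matrix_left_right_inverse by blast
    then show ?thesis
      by (simp add: matrix_matrix_mult_def vec_eq_iff mat_def)
  qed
  have "(\<Sum>k\<in>UNIV. levi_civita g x i j k * g x $ k $ m)
      = (\<Sum>k\<in>UNIV. \<Sum>l\<in>UNIV. g x $ m $ k * matrix_inv (g x) $ k $ l * (?E l / 2))"
    by (simp add: levi_civita_def sum_distrib_left sum_distrib_right sum_divide_distrib assms(1)[of _ m] mult_ac)
  also have "\<dots> = (\<Sum>l\<in>UNIV. (if m = l then 1 else 0) * (?E l / 2))"
    by (subst sum.swap) (simp only: sum_distrib_right[symmetric] inv)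
  also have "\<dots> = ?E m / 2" by (simp only: sum_kronecker)
  finally show ?thesis .
qed

lemma levi_civita_sym:
  assumes "\<And>y. y \<in> V \<Longrightarrow> \<forall>i j. g y $ i $ j = g y $ j $ i" "open V" "x \<in> V"
  shows "levi_civita g x i j k = levi_civita g x j i k"
  using pd_cong[OF assms(2,3), of "\<lambda>y. g y $ i $ j" "\<lambda>y. g y $ j $ i"] assms(1)
  unfolding levi_civita_def by (auto simp: algebra_simps)

lemma levi_civita_conformal:
  fixes g :: "real ^ 'n::finite \<Rightarrow> real ^ 'n ^ 'n"
  assumes F: "F differentiable (at x)" "F x > 0"
    and g: "\<And>i j. g x $ i $ j = g x $ j $ i" "matrix_inv (g x) ** g x = mat 1"
    and dg: "\<And>i j. (\<lambda>y. g y $ i $ j) differentiable (at x)"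
  shows "levi_civita (\<lambda>y. (1 / (F y)\<^sup>2) *\<^sub>R g y) x i j k = levi_civita g x i j k
    - ((if k = i then 1 else 0) * (pd j F x / F x) + (if k = j then 1 else 0) * (pd i F x / F x)
       - g x $ i $ j * (\<Sum>l\<in>UNIV. matrix_inv (g x) $ k $ l * (pd l F x / F x)))"
proof -
  have inv: "matrix_inv ((1 / (F x)\<^sup>2) *\<^sub>R g x) = (F x)\<^sup>2 *\<^sub>R matrix_inv (g x)"
  proof (rule matrix_inv_eqI)
    have "matrix_inv (g x) ** g x = mat 1" "g x ** matrix_inv (g x) = mat 1"
      using g(2) matrix_left_right_inverse by blast+
    then show "(1 / (F x)\<^sup>2) *\<^sub>R g x ** (F x)\<^sup>2 *\<^sub>R matrix_inv (g x) = mat 1"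
      "(F x)\<^sup>2 *\<^sub>R matrix_inv (g x) ** (1 / (F x)\<^sup>2) *\<^sub>R g x = mat 1"
      using F(2) by (simp_all add: matrix_scalar_ac)
  qed
  have pdg: "pd i (\<lambda>y. ((1 / (F y)\<^sup>2) *\<^sub>R g y) $ j $ l) x
      = pd i (\<lambda>y. g y $ j $ l) x / (F x)\<^sup>2 - 2 * pd i F x / (F x)^3 * g x $ j $ l" for i j l
  proof (rule pd_eqI)
    have dF: "(F has_derivative frechet_derivative F (at x)) (at x)"
      using F by (simp add: frechet_derivative_works)
    have dG: "((\<lambda>y. g y $ j $ l) has_derivative frechet_derivative (\<lambda>y. g y $ j $ l) (at x)) (at x)"
      using dg by (simp add: frechet_derivative_works)
    have "((\<lambda>y. g y $ j $ l / (F y)^2) has_derivative (\<lambda>v. (frechet_derivative (\<lambda>y. g y $ j $ l) (at x) v * (F x)^2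
        - g x $ j $ l * (2 * (frechet_derivative F (at x) v * F x))) / ((F x)^2 * (F x)^2))) (at x)"
      using F(2) by (auto intro!: derivative_eq_intros dF dG simp: field_simps)
    then show "((\<lambda>y. ((1 / (F y)\<^sup>2) *\<^sub>R g y) $ j $ l) has_derivative (\<lambda>v. (frechet_derivative (\<lambda>y. g y $ j $ l) (at x) v * (F x)^2
        - g x $ j $ l * (2 * (frechet_derivative F (at x) v * F x))) / ((F x)^2 * (F x)^2))) (at x)"
      by (simp add: divide_inverse mult.commute)
    show "(frechet_derivative (\<lambda>y. g y $ j $ l) (at x) (axis i 1) * (F x)^2
        - g x $ j $ l * (2 * (frechet_derivative F (at x) (axis i 1) * F x))) / ((F x)^2 * (F x)^2)
        = pd i (\<lambda>y. g y $ j $ l) x / (F x)\<^sup>2 - 2 * pd i F x / (F x)^3 * g x $ j $ l"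
      using F(2) by (simp add: pd_def field_simps power2_eq_square power3_eq_cube)
  qed
  have d: "(\<Sum>l\<in>UNIV. matrix_inv (g x) $ k $ l * g x $ j $ l) = (if k = j then 1 else 0)" for k j
  proof -
    have "(matrix_inv (g x) ** g x) $ k $ j = (if k = j then 1 else 0)"
      using g(2) by (simp add: mat_def)
    then show ?thesis by (simp add: matrix_matrix_mult_def g(1)[of j])
  qed
  let ?E = "\<lambda>l. pd i (\<lambda>y. g y $ j $ l) x + pd j (\<lambda>y. g y $ i $ l) x - pd l (\<lambda>y. g y $ i $ j) x"
  have "levi_civita (\<lambda>y. (1 / (F y)\<^sup>2) *\<^sub>R g y) x i j k
      = (\<Sum>l\<in>UNIV. matrix_inv (g x) $ k $ l * ?E l / 2
        - (pd i F x / F x) * (matrix_inv (g x) $ k $ l * g x $ j $ l)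
        - (pd j F x / F x) * (matrix_inv (g x) $ k $ l * g x $ i $ l)
        + g x $ i $ j * (matrix_inv (g x) $ k $ l * (pd l F x / F x)))"
    unfolding levi_civita_def inv pdg sum_divide_distrib
    using F(2) by (intro sum.cong refl) (simp add: field_simps power2_eq_square power3_eq_cube)
  also have "\<dots> = levi_civita g x i j k - (pd i F x / F x) * (if k = j then 1 else 0)
      - (pd j F x / F x) * (if k = i then 1 else 0)
      + g x $ i $ j * (\<Sum>l\<in>UNIV. matrix_inv (g x) $ k $ l * (pd l F x / F x))"
    by (simp only: sum.distrib sum_subtractf sum_distrib_left[symmetric] d levi_civita_def sum_divide_distrib)
  finally show ?thesis by (simp add: algebra_simps)
qed

text \<open>Only the class of the Ricci tensor modulo multiples of \<open>g\<close> is recorded, since trace-free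
  Ricci curvature is all that the Einstein condition sees; the Laplacian of \<open>F\<close> and the norm of
  its gradient are absorbed into \<open>\<theta>\<close>.\<close>

lemma ricci_conformal:
  fixes g :: "real ^ 'n::finite \<Rightarrow> real ^ 'n ^ 'n"
  assumes V: "open V" "x \<in> V"
    and F: "smooth_on V F" "\<And>y. y \<in> V \<Longrightarrow> F y > 0"
    and g: "\<And>y i j. y \<in> V \<Longrightarrow> g y $ i $ j = g y $ j $ i" "\<And>y. y \<in> V \<Longrightarrow> matrix_inv (g y) ** g y = mat 1"
    and dg: "\<And>y i j. y \<in> V \<Longrightarrow> (\<lambda>y. g y $ i $ j) differentiable (at y)"
    and dinv: "\<And>i j. (\<lambda>y. matrix_inv (g y) $ i $ j) differentiable (at x)"
    and d\<Gamma>: "\<And>i j k. (\<lambda>y. levi_civita g y i j k) differentiable (at x)"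
  shows "\<exists>\<theta>. \<forall>j k. ric (\<lambda>y. (1 / (F y)\<^sup>2) *\<^sub>R g y) x j k = ric g x j k
    + (real CARD('n) - 2) / F x * hessian (levi_civita g) F x j k + \<theta> * g x $ j $ k"
proof -
  define n where "n = real CARD('n)"
  define \<psi> where "\<psi> i y = pd i F y / F y" for i y
  define v where "v k y = (\<Sum>l\<in>UNIV. matrix_inv (g y) $ k $ l * \<psi> l y)" for k y
  define \<Gamma> where "\<Gamma> = levi_civita g"
  define C where "C y i j k = - ((if k = i then 1 else 0) * \<psi> j y + (if k = j then 1 else 0) * \<psi> i y
    - g y $ i $ j * v k y)" for y i j k
  have F0: "F y \<noteq> 0" if "y \<in> V" for y using F(2)[OF that] by simp
  have dF: "F differentiable (at y)" "pd i F differentiable (at y)" if "y \<in> V" for y i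
    using F(1) smooth_on_differentiable smooth_on_pd that by blast+
  have LC: "levi_civita (\<lambda>y. (1 / (F y)\<^sup>2) *\<^sub>R g y) y i j k = \<Gamma> y i j k + C y i j k" if "y \<in> V" for y i j k
    using levi_civita_conformal[OF dF(1)[OF that] F(2)[OF that] g(1)[OF that] g(2)[OF that] dg[OF that]]
    by (simp add: \<Gamma>_def C_def \<psi>_def v_def)
  have d\<psi>: "\<psi> i differentiable (at x)" for i
    unfolding \<psi>_def[abs_def] using V dF F0 by (intro differentiable_divide) auto
  have dv: "v k differentiable (at x)" for k
    unfolding v_def[abs_def] by (intro differentiable_sum ballI differentiable_mult dinv d\<psi>) simp
  note d\<Gamma>' = d\<Gamma>[folded \<Gamma>_def]
  note dgx = dg[OF V(2)]
  have dC: "(\<lambda>y. C y i j k) differentiable (at x)" for i j k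
    unfolding C_def by (intro differentiable_minus differentiable_diff differentiable_add differentiable_mult
      d\<psi> dv dgx differentiable_const)
  have \<psi>sym: "pd j (\<psi> k) x = pd k (\<psi> j) x" for j k
  proof -
    have "pd j (\<psi> k) x = (pd j (pd k F) x * F x - pd k F x * pd j F x) / (F x * F x)" for j k
    proof (rule pd_eqI)
      show "(\<psi> k has_derivative (\<lambda>h. (frechet_derivative (pd k F) (at x) h * F x
          - pd k F x * frechet_derivative F (at x) h) / (F x * F x))) (at x)"
        unfolding \<psi>_def[abs_def]
        using dF[OF V(2)] F0[OF V(2)]
        by (intro has_derivative_divide') (simp_all add: frechet_derivative_works)
    qed (simp add: pd_def)
    moreover have "pd j (pd k F) x = pd k (pd j F) x" by (rule pd_commute[OF V F(1)])
    ultimately show ?thesis by (simp add: mult.commute)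
  qed
  have inv: "(\<Sum>l\<in>UNIV. g y $ i $ l * matrix_inv (g y) $ l $ k) = (if i = k then 1 else 0)" if "y \<in> V" for y i k
  proof -
    have "g y ** matrix_inv (g y) = mat 1"
      using g(2)[OF that] matrix_left_right_inverse by blast
    then show ?thesis by (simp add: matrix_matrix_mult_def vec_eq_iff mat_def)
  qed
  have gv: "(\<Sum>j\<in>UNIV. g y $ i $ j * v j y) = \<psi> i y" if "y \<in> V" for y i
  proof -
    have "(\<Sum>j\<in>UNIV. g y $ i $ j * v j y) = (\<Sum>l\<in>UNIV. (\<Sum>j\<in>UNIV. g y $ i $ j * matrix_inv (g y) $ j $ l) * \<psi> l y)"
      unfolding v_def sum_distrib_left sum_distrib_right by (subst sum.swap) (simp add: mult_ac)
    then show ?thesis by (simp only: inv[OF that] sum_kronecker)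
  qed
  have trC: "(\<Sum>i\<in>UNIV. C y i k i) = - n * \<psi> k y" if "y \<in> V" for y k
  proof -
    have "(\<Sum>i\<in>UNIV. C y i k i) = (\<Sum>i\<in>UNIV. - \<psi> k y - (if i = k then 1 else 0) * \<psi> i y + g y $ k $ i * v i y)"
      by (rule sum.cong) (auto simp: C_def g(1)[OF that, of _ k] algebra_simps)
    also have "\<dots> = - n * \<psi> k y"
      by (simp only: sum.distrib sum_subtractf sum_kronecker gv[OF that]) (simp add: n_def)
    finally show ?thesis .
  qed
  have trdC: "(\<Sum>i\<in>UNIV. pd j (\<lambda>y. C y i k i) x) = - n * pd j (\<psi> k) x" for j k
  proof -
    have "(\<Sum>i\<in>UNIV. pd j (\<lambda>y. C y i k i) x) = pd j (\<lambda>y. \<Sum>i\<in>UNIV. C y i k i) x"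
      by (rule pd_sum[symmetric]) (auto intro: dC)
    also have "\<dots> = pd j (\<lambda>y. - n * \<psi> k y) x" by (rule pd_cong[OF V trC])
    finally show ?thesis by (simp only: pd_cmult[OF d\<psi>])
  qed
  have divC: "(\<Sum>i\<in>UNIV. pd i (\<lambda>y. C y j k i) x) = - 2 * pd j (\<psi> k) x
      + (\<Sum>i\<in>UNIV. pd i (\<lambda>y. g y $ j $ k) x * v i x) + g x $ j $ k * (\<Sum>i\<in>UNIV. pd i (v i) x)" for j k
  proof -
    have "pd i (\<lambda>y. C y j k i) x = - ((if i = j then 1 else 0) * pd i (\<psi> k) x) - (if i = k then 1 else 0) * pd i (\<psi> j) x
        + pd i (\<lambda>y. g y $ j $ k) x * v i x + g x $ j $ k * pd i (v i) x" for i
      unfolding C_def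
      by (simp only: pd_minus pd_diff pd_add pd_mult pd_const differentiable_diff differentiable_add differentiable_mult
          d\<psi> dv dgx differentiable_const; simp add: algebra_simps)
    then have "(\<Sum>i\<in>UNIV. pd i (\<lambda>y. C y j k i) x) = - pd j (\<psi> k) x - pd k (\<psi> j) x
      + (\<Sum>i\<in>UNIV. pd i (\<lambda>y. g y $ j $ k) x * v i x) + g x $ j $ k * (\<Sum>i\<in>UNIV. pd i (v i) x)"
      by (simp only: sum.distrib sum_subtractf sum_negf sum_kronecker sum_distrib_left)
    then show ?thesis using \<psi>sym[of j k] by simp
  qed
  have \<Gamma>sym: "\<Gamma> x i j k = \<Gamma> x j i k" for i j k
    unfolding \<Gamma>_def using levi_civita_sym[OF _ V] g(1) by blast
  have gcompat: "(\<Sum>m\<in>UNIV. \<Gamma> x i j m * g x $ m $ k + \<Gamma> x i k m * g x $ j $ m) = pd i (\<lambda>y. g y $ j $ k) x" for i j k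
  proof -
    have pg: "pd a (\<lambda>y. g y $ b $ c) x = pd a (\<lambda>y. g y $ c $ b) x" for a b c
      by (rule pd_cong[OF V]) (rule g(1))
    have "(\<Sum>m\<in>UNIV. \<Gamma> x i j m * g x $ m $ k + \<Gamma> x i k m * g x $ j $ m)
        = (\<Sum>m\<in>UNIV. \<Gamma> x i j m * g x $ m $ k) + (\<Sum>m\<in>UNIV. \<Gamma> x i k m * g x $ m $ j)"
      by (simp add: sum.distrib g(1)[OF V(2), of j])
    then show ?thesis
      unfolding \<Gamma>_def levi_civita_lower[of g x, OF g(1)[OF V(2)] g(2)[OF V(2)]]
      using pg[of i j k] pg[of j i k] pg[of k i j] by (simp add: field_simps)
  qed
  define \<theta> where "\<theta> = (\<Sum>i\<in>UNIV. pd i (v i) x) + (\<Sum>m\<in>UNIV. v m x * (\<Sum>i\<in>UNIV. \<Gamma> x i m i))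
      - (n - 2) * (\<Sum>m\<in>UNIV. v m x * \<psi> m x)"
  have "ric (\<lambda>y. (1 / (F y)\<^sup>2) *\<^sub>R g y) x j k = ric g x j k
    + (n - 2) / F x * hessian \<Gamma> F x j k + \<theta> * g x $ j $ k" for j k
  proof -
    have pdLC: "pd a (\<lambda>y. levi_civita (\<lambda>y. (1 / (F y)\<^sup>2) *\<^sub>R g y) y i j k) x
        = pd a (\<lambda>y. \<Gamma> y i j k) x + pd a (\<lambda>y. C y i j k) x" for a i j k
      by (subst pd_cong[OF V LC]) (simp_all add: pd_add[OF d\<Gamma>' dC])
    have hess: "hessian \<Gamma> F x j k = F x * (pd j (\<psi> k) x + \<psi> j x * \<psi> k x - (\<Sum>m\<in>UNIV. \<Gamma> x j k m * \<psi> m x))"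
    proof -
      have "pd j (pd k F) x = pd j (\<lambda>y. \<psi> k y * F y) x"
        by (rule pd_cong[OF V]) (use F0 in \<open>simp add: \<psi>_def\<close>)
      also have "\<dots> = \<psi> k x * pd j F x + pd j (\<psi> k) x * F x"
        by (rule pd_mult[OF d\<psi> dF(1)[OF V(2)]])
      finally have 1: "pd j (pd k F) x = F x * (pd j (\<psi> k) x + \<psi> j x * \<psi> k x)"
        using F0[OF V(2)] by (simp add: \<psi>_def field_simps)
      have 2: "(\<Sum>m\<in>UNIV. \<Gamma> x j k m * pd m F x) = F x * (\<Sum>m\<in>UNIV. \<Gamma> x j k m * \<psi> m x)"
        unfolding sum_distrib_left using F0[OF V(2)] by (intro sum.cong refl) (simp add: \<psi>_def)
      show ?thesis unfolding hessian_def 1 2 by (simp add: algebra_simps)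
    qed
    note Q = ricci_conformal_quadratic_part[where \<Gamma> = "\<Gamma> x" and C = "C x" and g = "\<lambda>i j. g x $ i $ j"
      and \<psi> = "\<lambda>i. \<psi> i x" and v = "\<lambda>i. v i x" and j = j and k = k,
      OF \<Gamma>sym g(1)[OF V(2)] gv[OF V(2)] C_def, unfolded gcompat]
    have "ric (\<lambda>y. (1 / (F y)\<^sup>2) *\<^sub>R g y) x j k
      = (\<Sum>i\<in>UNIV. pd i (\<lambda>y. \<Gamma> y j k i) x - pd j (\<lambda>y. \<Gamma> y i k i) x)
        + (\<Sum>i\<in>UNIV. pd i (\<lambda>y. C y j k i) x) - (\<Sum>i\<in>UNIV. pd j (\<lambda>y. C y i k i) x)
        + (\<Sum>i\<in>UNIV. \<Sum>m\<in>UNIV. (\<Gamma> x j k m + C x j k m) * (\<Gamma> x i m i + C x i m i)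
        - (\<Gamma> x i k m + C x i k m) * (\<Gamma> x j m i + C x j m i))"
      unfolding ricci_def riem_def pdLC LC[OF V(2)] by (simp add: sum.distrib sum_subtractf)
    also have "\<dots> = ric g x j k + (n - 2) * (pd j (\<psi> k) x + \<psi> j x * \<psi> k x - (\<Sum>m\<in>UNIV. \<Gamma> x j k m * \<psi> m x)) + \<theta> * g x $ j $ k"
    proof -
      have R: "ric g x j k = (\<Sum>i\<in>UNIV. pd i (\<lambda>y. \<Gamma> y j k i) x - pd j (\<lambda>y. \<Gamma> y i k i) x)
          + (\<Sum>i\<in>UNIV. \<Sum>m\<in>UNIV. \<Gamma> x j k m * \<Gamma> x i m i - \<Gamma> x i k m * \<Gamma> x j m i)"
        by (simp only: ricci_def riem_def \<Gamma>_def[symmetric] sum.distrib)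
      have com: "(\<Sum>i\<in>UNIV. pd i (\<lambda>y. g y $ j $ k) x * v i x) = (\<Sum>i\<in>UNIV. v i x * pd i (\<lambda>y. g y $ j $ k) x)"
        by (simp add: mult.commute)
      show ?thesis
        unfolding divC trdC Q R com \<theta>_def n_def[symmetric] by argo
    qed
    finally show ?thesis unfolding hess using F0[OF V(2)] by simp
  qed
  then show ?thesis unfolding \<Gamma>_def n_def by blast
qed

section \<open>Affine surfaces with a parallel nilpotent tensor\<close>

lemma matrix_eq_2: "(A :: real ^ 2 ^ 2) = B \<longleftrightarrow> A $ 1 $ 1 = B $ 1 $ 1 \<and> A $ 1 $ 2 = B $ 1 $ 2
    \<and> A $ 2 $ 1 = B $ 2 $ 1 \<and> A $ 2 $ 2 = B $ 2 $ 2"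
  by (auto simp: vec_eq_iff forall_2)

lemma nilpotent_2:
  fixes T :: "real ^ 2 ^ 2"
  assumes "T ** T = 0"
  shows "T $ 2 $ 2 = - T $ 1 $ 1" "T $ 1 $ 1 * T $ 1 $ 1 + T $ 1 $ 2 * T $ 2 $ 1 = 0"
proof -
  have *: "T $ 1 $ 1 * T $ 1 $ 1 + T $ 1 $ 2 * T $ 2 $ 1 = 0"
    "T $ 1 $ 2 * (T $ 1 $ 1 + T $ 2 $ 2) = 0"
    "T $ 2 $ 1 * T $ 1 $ 2 + T $ 2 $ 2 * T $ 2 $ 2 = 0"
    using assms by (simp_all add: matrix_eq_2 matrix_matrix_mult_def sum_2 algebra_simps)
  then show "T $ 2 $ 2 = - T $ 1 $ 1" by (cases "T $ 1 $ 2 = 0") auto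
  show "T $ 1 $ 1 * T $ 1 $ 1 + T $ 1 $ 2 * T $ 2 $ 1 = 0" by (rule *)
qed

text \<open>A matrix commuting with a nonzero nilpotent \<open>T\<close> is \<open>\<alpha> I + \<beta> T\<close>, hence acts on the kernel of \<open>T\<close>
  as half its trace.\<close>

lemma kernel_commutant_nilpotent:
  fixes T R :: "real ^ 2 ^ 2"
  assumes T: "T ** T = 0" "T \<noteq> 0" and com: "R ** T = T ** R" and tr: "R $ 1 $ 1 + R $ 2 $ 2 \<noteq> 0"
    and "T *v b = 0" "R *v b = 0"
  shows "b = 0"
proof -
  define a c d where "a = T $ 1 $ 1" and "c = T $ 1 $ 2" and "d = T $ 2 $ 1"
  define p q r s where "p = R $ 1 $ 1" and "q = R $ 1 $ 2" and "r = R $ 2 $ 1" and "s = R $ 2 $ 2"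
  have T22: "T $ 2 $ 2 = - a" and n: "a * a + c * d = 0"
    using nilpotent_2[OF T(1)] by (auto simp: a_def c_def d_def)
  have com': "p * c - q * a = a * q + c * s" "r * a + s * d = d * p - a * r"
    using com by (auto simp: matrix_eq_2 matrix_matrix_mult_def sum_2 T22 a_def[symmetric] c_def[symmetric]
        d_def[symmetric] p_def[symmetric] q_def[symmetric] r_def[symmetric] s_def[symmetric])
  have ker: "a * b $ 1 + c * b $ 2 = 0" "d * b $ 1 - a * b $ 2 = 0"
      "p * b $ 1 + q * b $ 2 = 0" "r * b $ 1 + s * b $ 2 = 0"
    using assms(5,6) by (auto simp: vec_eq_iff forall_2 matrix_vector_mult_def sum_2 T22 a_def[symmetric] c_def[symmetric]
        d_def[symmetric] p_def[symmetric] q_def[symmetric] r_def[symmetric] s_def[symmetric])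
  have "c \<noteq> 0 \<or> d \<noteq> 0"
    using T(2) n T22 by (auto simp: matrix_eq_2 a_def c_def d_def)
  moreover have "p + s \<noteq> 0" using tr by (simp add: p_def s_def)
  moreover have "c * ((p + s) * b $ 1) = 0"
    using com'(1) ker by algebra
  moreover have "d * ((p + s) * b $ 2) = 0"
    using com'(2) ker by algebra
  ultimately show ?thesis
    using ker by (auto simp: vec_eq_iff forall_2)
qed

text \<open>The Ricci identity for a parallel vector field, obtained from Schwarz's theorem.\<close>

lemma riem_parallel_vector:
  fixes \<Gamma> :: "2 christ"
  assumes U: "open U" "x \<in> U"
    and \<Gamma>: "\<And>i j k. smooth_on U (\<lambda>y. \<Gamma> y i j k)"
    and b: "\<And>k. smooth_on U (b k)"
    and Db: "\<And>y i l. y \<in> U \<Longrightarrow> pd i (b l) y = - (\<Sum>k\<in>UNIV. \<Gamma> y i k l * b k y)"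
  shows "(\<Sum>k\<in>UNIV. riem \<Gamma> x i j k l * b k x) = 0"
proof -
  have d: "(\<lambda>y. \<Gamma> y i j k) differentiable (at x)" "b k differentiable (at x)" for i j k
    using \<Gamma> b U smooth_on_differentiable by blast+
  have 2: "pd j (pd i (b l)) x = - (\<Sum>k\<in>UNIV. pd j (\<lambda>y. \<Gamma> y i k l) x * b k x)
     + (\<Sum>k\<in>UNIV. \<Gamma> x i k l * (\<Sum>m\<in>UNIV. \<Gamma> x j m k * b m x))" for i j
    by (subst pd_cong[OF U Db], assumption)
      (simp add: sum_2 pd_minus pd_diff pd_add pd_mult d differentiable_minus differentiable_diff differentiable_add differentiable_mult Db[OF U(2)] algebra_simps)
  show ?thesis
    using pd_commute[OF U b, of i j l]
    unfolding 2 riem_def by (simp add: sum_2 algebra_simps)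
qed

lemma riem_parallel_endomorphism:
  fixes \<Gamma> :: "2 christ"
  assumes U: "open U" "x \<in> U"
    and \<Gamma>: "\<And>i j k. smooth_on U (\<lambda>y. \<Gamma> y i j k)"
    and T: "\<And>k j. smooth_on U (\<lambda>y. T y $ k $ j)"
    and DT: "\<And>y i k j. y \<in> U \<Longrightarrow> pd i (\<lambda>y. T y $ k $ j) y
        + (\<Sum>m\<in>UNIV. \<Gamma> y i m k * T y $ m $ j - \<Gamma> y i j m * T y $ k $ m) = 0"
  shows "(\<chi> l k. riem \<Gamma> x i j k l) ** T x = T x ** (\<chi> l k. riem \<Gamma> x i j k l)"
proof -
  have d: "(\<lambda>y. \<Gamma> y i j k) differentiable (at x)" "(\<lambda>y. T y $ k $ j) differentiable (at x)" for i j k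
    using \<Gamma> T U smooth_on_differentiable by blast+
  have DT': "pd i (\<lambda>y. T y $ k $ j) y = (\<Sum>m\<in>UNIV. \<Gamma> y i j m * T y $ k $ m - \<Gamma> y i m k * T y $ m $ j)" if "y \<in> U" for i j k y
    using DT[OF that, of i k j] by (simp add: sum_subtractf)
  have 2: "pd j (pd i (\<lambda>y. T y $ k $ l)) x
      = (\<Sum>m\<in>UNIV. pd j (\<lambda>y. \<Gamma> y i l m) x * T x $ k $ m - pd j (\<lambda>y. \<Gamma> y i m k) x * T x $ m $ l
          + \<Gamma> x i l m * (\<Sum>n\<in>UNIV. \<Gamma> x j m n * T x $ k $ n - \<Gamma> x j n k * T x $ n $ m)
          - \<Gamma> x i m k * (\<Sum>n\<in>UNIV. \<Gamma> x j l n * T x $ m $ n - \<Gamma> x j n m * T x $ n $ l))" for i j k l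
    by (subst pd_cong[OF U DT'], assumption)
      (simp add: sum_2 pd_diff pd_add pd_mult d differentiable_diff differentiable_add differentiable_mult DT'[OF U(2)] algebra_simps)
  have "(\<Sum>m\<in>UNIV. riem \<Gamma> x i j m k * T x $ m $ l) = (\<Sum>m\<in>UNIV. T x $ k $ m * riem \<Gamma> x i j l m)" for k l
    using pd_commute[OF U T, of i j k l]
    unfolding 2 riem_def by (simp add: sum_2 algebra_simps)
  then show ?thesis by (simp add: vec_eq_iff matrix_matrix_mult_def)
qed

text \<open>In dimension two each component of the Ricci tensor off the diagonal is a single component of
  the curvature operator \<open>R(\<partial>\<^sub>1,\<partial>\<^sub>2)\<close>.\<close>

lemma riem_trace_eq_ricci_skew:
  fixes \<Gamma> :: "2 christ"
  shows "riem \<Gamma> x 1 2 1 1 + riem \<Gamma> x 1 2 2 2 = 2 * ricci_skew \<Gamma> x 2 1"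
proof -
  have "riem \<Gamma> x i j k l = - riem \<Gamma> x j i k l" for i j k l
    by (simp add: riem_def sum_subtractf)
  from this[of 2 1] this[of 2 2] this[of 1 1] show ?thesis
    by (simp add: ricci_skew_def ricci_def sum_2)
qed

locale nilpotent_affine_chart =
  fixes U :: "(real ^ 2) set" and \<Gamma> :: "2 christ" and T :: "real ^ 2 \<Rightarrow> real ^ 2 ^ 2"
  assumes openU: "open U"
    and smooth_\<Gamma>: "smooth_on U (\<lambda>y. \<Gamma> y i j k)"
    and torsion_free: "y \<in> U \<Longrightarrow> \<Gamma> y i j k = \<Gamma> y j i k"
    and smooth_T: "smooth_on U (\<lambda>y. T y $ k $ j)"
    and T_nilpotent: "y \<in> U \<Longrightarrow> T y ** T y = 0"
    and T_parallel: "y \<in> U \<Longrightarrow> pd i (\<lambda>y. T y $ k $ j) y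
        + (\<Sum>m\<in>UNIV. \<Gamma> y i m k * T y $ m $ j - \<Gamma> y i j m * T y $ k $ m) = 0"
    and ricci_skew: "y \<in> U \<Longrightarrow> ricci_skew \<Gamma> y 2 1 \<noteq> 0"
begin

lemma pd_T: "y \<in> U \<Longrightarrow> pd i (\<lambda>y. T y $ k $ j) y = (\<Sum>m\<in>UNIV. \<Gamma> y i j m * T y $ k $ m - \<Gamma> y i m k * T y $ m $ j)"
  using T_parallel[of y i k j] by (simp add: sum_subtractf)

lemma differentiable_T: "y \<in> U \<Longrightarrow> (\<lambda>y. T y $ k $ j) differentiable (at y)"
  using smooth_T smooth_on_differentiable by blast

lemma differentiable_\<Gamma>: "y \<in> U \<Longrightarrow> (\<lambda>y. \<Gamma> y i j k) differentiable (at y)"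
  using smooth_\<Gamma> smooth_on_differentiable by blast

lemma subchart: "open W \<Longrightarrow> W \<subseteq> U \<Longrightarrow> nilpotent_affine_chart W \<Gamma> T"
  using torsion_free T_nilpotent T_parallel ricci_skew
  by unfold_locales (auto intro: smooth_on_subset[OF smooth_\<Gamma>] smooth_on_subset[OF smooth_T])

lemma curvature_commutes:
  "x \<in> U \<Longrightarrow> (\<chi> l k. riem \<Gamma> x i j k l) ** T x = T x ** (\<chi> l k. riem \<Gamma> x i j k l)"
  by (rule riem_parallel_endomorphism[OF openU]) (auto intro: smooth_\<Gamma> smooth_T T_parallel)

text \<open>Differentiating \<open>T b = 0\<close> gives \<open>\<eta> T = 0\<close>, so \<open>b\<close> is parallel; the curvature then kills \<open>b\<close>, but
  it acts on the kernel of \<open>T\<close> as a nonzero scalar.\<close>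

lemma homothetic_kernel_field_zero:
  assumes b: "\<And>k. smooth_on U (b k)"
    and Tb: "\<And>y k. y \<in> U \<Longrightarrow> (\<Sum>j\<in>UNIV. T y $ k $ j * b j y) = 0"
    and Db: "\<And>y i l. y \<in> U \<Longrightarrow> pd i (b l) y + (\<Sum>k\<in>UNIV. \<Gamma> y i k l * b k y) = (if i = l then \<eta> y else 0)"
    and T0: "\<And>y. y \<in> U \<Longrightarrow> T y \<noteq> 0"
    and x: "x \<in> U"
  shows "b k x = 0" "\<eta> x = 0"
proof -
  have db: "b k differentiable (at y)" if "y \<in> U" for k y using b that smooth_on_differentiable by blast
  have \<eta>: "\<eta> y = 0" if y: "y \<in> U" for y
  proof -
    have "T y $ k $ i * \<eta> y = 0" for k i
    proof -
      have "pd i (\<lambda>y. \<Sum>j\<in>UNIV. T y $ k $ j * b j y) y = pd i (\<lambda>y. 0) y"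
        by (rule pd_cong[OF openU y Tb])
      then have "(\<Sum>j\<in>UNIV. pd i (\<lambda>y. T y $ k $ j) y * b j y + T y $ k $ j * pd i (b j) y) = 0"
        by (simp add: sum_2 pd_add pd_mult db[OF y] differentiable_T[OF y] differentiable_mult)
      moreover have "pd i (b j) y = (if i = j then \<eta> y else 0) - (\<Sum>k\<in>UNIV. \<Gamma> y i k j * b k y)" for j
        using Db[OF y, of i j] by simp
      ultimately have e: "(\<Sum>j\<in>UNIV. pd i (\<lambda>y. T y $ k $ j) y * b j y
          + T y $ k $ j * ((if i = j then \<eta> y else 0) - (\<Sum>k\<in>UNIV. \<Gamma> y i k j * b k y))) = 0" by simp
      have "T y $ k $ i * \<eta> y - (\<Sum>m\<in>UNIV. \<Gamma> y i m k * (\<Sum>j\<in>UNIV. T y $ m $ j * b j y)) = 0"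
        using e exhaust_2[of i] unfolding pd_T[OF y] by (auto simp: sum_2 algebra_simps)
      then show ?thesis by (simp add: Tb[OF y])
    qed
    moreover obtain k i where "T y $ k $ i \<noteq> 0" using T0[OF y] by (auto simp: vec_eq_iff)
    ultimately show ?thesis using mult_eq_0_iff by blast
  qed
  show "\<eta> x = 0" using \<eta> x by blast
  have Db': "pd i (b l) y = - (\<Sum>k\<in>UNIV. \<Gamma> y i k l * b k y)" if "y \<in> U" for y i l
    using Db[OF that, of i l] \<eta>[OF that] by (auto split: if_splits)
  have "(\<chi> k. b k x) = 0"
  proof (rule kernel_commutant_nilpotent[OF T_nilpotent[OF x] T0[OF x] curvature_commutes[OF x, of 1 2]])
    show "(\<chi> l k. riem \<Gamma> x 1 2 k l) $ 1 $ 1 + (\<chi> l k. riem \<Gamma> x 1 2 k l) $ 2 $ 2 \<noteq> 0"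
      using riem_trace_eq_ricci_skew[of \<Gamma> x] ricci_skew[OF x] by simp
    show "T x *v (\<chi> k. b k x) = 0" using Tb[OF x] by (simp add: matrix_vector_mult_def vec_eq_iff)
    show "(\<chi> l k. riem \<Gamma> x 1 2 k l) *v (\<chi> k. b k x) = 0"
      using riem_parallel_vector[OF openU x smooth_\<Gamma> b Db'] by (simp add: matrix_vector_mult_def vec_eq_iff)
  qed
  then show "b k x = 0" by (simp add: vec_eq_iff)
qed

text \<open>The covectors that annihilate the image of \<open>T\<close> form a parallel subbundle.\<close>

lemma annihilator_parallel:
  assumes w: "\<And>k. w k differentiable (at y)" and y: "y \<in> U"
    and wT: "\<And>y j. y \<in> U \<Longrightarrow> (\<Sum>k\<in>UNIV. w k y * T y $ k $ j) = 0"
  shows "(\<Sum>k\<in>UNIV. (pd i (w k) y - (\<Sum>m\<in>UNIV. \<Gamma> y i k m * w m y)) * T y $ k $ j) = 0"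
proof -
  have "pd i (\<lambda>y. \<Sum>k\<in>UNIV. w k y * T y $ k $ j) y = pd i (\<lambda>y. 0) y"
    by (rule pd_cong[OF openU y wT])
  then have "(\<Sum>k\<in>UNIV. pd i (w k) y * T y $ k $ j + w k y * pd i (\<lambda>y. T y $ k $ j) y) = 0"
    by (simp add: sum_2 pd_add pd_mult w differentiable_T[OF y] differentiable_mult)
  then have "(\<Sum>k\<in>UNIV. (pd i (w k) y - (\<Sum>m\<in>UNIV. \<Gamma> y i k m * w m y)) * T y $ k $ j)
      + (\<Sum>m\<in>UNIV. \<Gamma> y i j m * (\<Sum>k\<in>UNIV. w k y * T y $ k $ m)) = 0"
    unfolding pd_T[OF y] by (simp add: sum_2 algebra_simps)
  then show ?thesis by (simp add: wT[OF y])
qed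

text \<open>The one-form \<open>w = 2 d\<phi> - \<phi> dh\<close> satisfies \<open>D w = - d\<phi> \<otimes> dh\<close>.  Since \<open>w \<circ> T = 0\<close> is preserved by
  \<open>D\<close>, either \<open>d\<phi>\<close> or \<open>dh \<circ> T\<close> vanishes, and in both cases \<open>dh \<circ> T = 0\<close>.  Then \<open>d\<phi>\<close> and the
  Hessian of \<open>h\<close> live on the line of annihilators of the image of \<open>T\<close>, which makes the curvature
  annihilate \<open>w\<close>, and \<open>w = 0\<close> follows as for vector fields in the kernel of \<open>T\<close>.\<close>

lemma soliton_conformal_factor_critical:
  assumes \<phi>: "smooth_on U \<phi>" "\<And>y. y \<in> U \<Longrightarrow> \<phi> y > 0" and h: "smooth_on U h"
    and T0: "\<And>y. y \<in> U \<Longrightarrow> T y \<noteq> 0"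
    and E: "\<And>y i j. y \<in> U \<Longrightarrow> 2 * hessian \<Gamma> \<phi> y i j = \<phi> y * hessian \<Gamma> h y i j"
    and wT: "\<And>y j. y \<in> U \<Longrightarrow> (\<Sum>k\<in>UNIV. (2 * pd k \<phi> y - \<phi> y * pd k h y) * T y $ k $ j) = 0"
    and x: "x \<in> U"
  shows "pd k h x = 0"
proof -
  define w where "w k y = 2 * pd k \<phi> y - \<phi> y * pd k h y" for k y
  have d: "\<phi> differentiable (at y)" "pd k \<phi> differentiable (at y)" "pd k h differentiable (at y)"
      "pd j (pd k \<phi>) differentiable (at y)" "pd j (pd k h) differentiable (at y)" if "y \<in> U" for k j y
    using \<phi> h that smooth_on_differentiable smooth_on_pd by blast+
  have dw: "w k differentiable (at y)" if "y \<in> U" for k y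
    unfolding w_def[abs_def] using d[OF that]
    by (intro differentiable_diff differentiable_mult differentiable_const)
  have wT': "(\<Sum>k\<in>UNIV. w k y * T y $ k $ j) = 0" if "y \<in> U" for j y
    using wT[OF that, of j] by (simp add: w_def)
  have pdw: "pd i (w k) y = 2 * pd i (pd k \<phi>) y - pd i \<phi> y * pd k h y - \<phi> y * pd i (pd k h) y" if "y \<in> U" for i k y
    unfolding w_def[abs_def] using d[OF that]
    by (simp add: pd_diff pd_mult differentiable_mult)
  have Dw: "pd i (w k) y = (\<Sum>m\<in>UNIV. \<Gamma> y i k m * w m y) - pd i \<phi> y * pd k h y" if "y \<in> U" for i k y
    unfolding pdw[OF that] using E[OF that, of i k] by (simp add: hessian_def w_def sum_2 algebra_simps)
  have hT: "(\<Sum>k\<in>UNIV. pd k h y * T y $ k $ j) = 0" if y: "y \<in> U" for j y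
  proof -
    let ?s = "\<Sum>k\<in>UNIV. pd k h y * T y $ k $ j"
    have s: "pd i \<phi> y * ?s = 0" for i
      using annihilator_parallel[OF dw[OF y] y wT', of i j] by (simp add: Dw[OF y] sum_2 algebra_simps)
    \<comment> \<open>multiplying \<open>w(T) = 0\<close> by \<open>?s\<close> removes the \<open>d\<phi>\<close> term and leaves \<open>\<phi>\<close> times a square\<close>
    have "(\<Sum>k\<in>UNIV. T y $ k $ j * (2 * (pd k \<phi> y * ?s))) - ?s * (\<Sum>k\<in>UNIV. w k y * T y $ k $ j) = \<phi> y * ?s * ?s"
      by (simp add: w_def sum_2 algebra_simps)
    then have "\<phi> y * ?s * ?s = 0" by (simp only: s wT'[OF y]) simp
    then show ?thesis using \<phi>(2)[OF y] by simp
  qed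
  have \<phi>T: "(\<Sum>k\<in>UNIV. pd k \<phi> y * T y $ k $ j) = 0" if y: "y \<in> U" for j y
    using wT'[OF y, of j] hT[OF y, of j] by (simp add: w_def sum_2) algebra
  have HT: "(\<Sum>k\<in>UNIV. hessian \<Gamma> h y i k * T y $ k $ j) = 0" if y: "y \<in> U" for i j y
    using annihilator_parallel[OF d(3)[OF y] y hT, of i j] by (simp add: hessian_def)
  have Hsym: "hessian \<Gamma> h y i j = hessian \<Gamma> h y j i" if y: "y \<in> U" for i j y
    using pd_commute[OF openU y h, of i j] torsion_free[OF y, of i j] by (simp add: hessian_def)
  have det0: "pd 1 \<phi> y * hessian \<Gamma> h y 2 k = pd 2 \<phi> y * hessian \<Gamma> h y 1 k" if y: "y \<in> U" for k y
  proof -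
    obtain i j where ij: "T y $ i $ j \<noteq> 0" using T0[OF y] by (auto simp: vec_eq_iff)
    have a: "pd 1 \<phi> y * T y $ 1 $ j + pd 2 \<phi> y * T y $ 2 $ j = 0"
      using \<phi>T[OF y, of j] by (simp add: sum_2)
    have b: "hessian \<Gamma> h y 1 k * T y $ 1 $ j + hessian \<Gamma> h y 2 k * T y $ 2 $ j = 0"
      using HT[OF y, of k j] by (simp add: sum_2 Hsym[OF y, of k])
    have "T y $ 1 $ j * (pd 1 \<phi> y * hessian \<Gamma> h y 2 k - pd 2 \<phi> y * hessian \<Gamma> h y 1 k) = 0"
      "T y $ 2 $ j * (pd 1 \<phi> y * hessian \<Gamma> h y 2 k - pd 2 \<phi> y * hessian \<Gamma> h y 1 k) = 0"
      using a b by algebra+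
    then show ?thesis using ij exhaust_2[of i] by auto
  qed
  \<comment> \<open>the Ricci identity for \<open>w\<close>; by \<open>det0\<close> the contribution of \<open>d\<phi> \<otimes> dh\<close> drops out\<close>
  have wR: "(\<Sum>m\<in>UNIV. riem \<Gamma> y 1 2 k m * w m y) = 0" if y: "y \<in> U" for k y
  proof -
    have 2: "pd j (pd i (w k)) y = (\<Sum>m\<in>UNIV. pd j (\<lambda>y. \<Gamma> y i k m) y * w m y
        + \<Gamma> y i k m * ((\<Sum>l\<in>UNIV. \<Gamma> y j m l * w l y) - pd j \<phi> y * pd m h y))
        - pd j (pd i \<phi>) y * pd k h y - pd i \<phi> y * pd j (pd k h) y" for i j
      by (subst pd_cong[OF openU y Dw], assumption)
        (simp add: sum_2 pd_diff pd_add pd_mult dw[OF y] d[OF y] differentiable_\<Gamma>[OF y]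
          differentiable_diff differentiable_add differentiable_mult Dw[OF y] algebra_simps)
    have "smooth_on U (w k)"
      unfolding w_def[abs_def]
      by (intro smooth_on_diff smooth_on_mult smooth_on_const smooth_on_pd \<phi> h openU)
    then have "pd 2 (pd 1 (w k)) y = pd 1 (pd 2 (w k)) y"
      by (rule pd_commute[OF openU y])
    then show ?thesis
      using det0[OF y, of k] pd_commute[OF openU y \<phi>(1), of 1 2]
      unfolding 2 riem_def hessian_def by (simp add: sum_2 algebra_simps)
  qed
  have w0: "w k y = 0" if y: "y \<in> U" for k y
  proof -
    let ?R = "\<chi> l k. riem \<Gamma> y 1 2 k l"
    have "(\<chi> k. w k y) = 0"
    proof (rule kernel_commutant_nilpotent[of "transpose (T y)" "transpose ?R"])
      show "transpose (T y) ** transpose (T y) = 0"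
        using T_nilpotent[OF y] by (simp add: matrix_transpose_mul[symmetric]) (simp add: transpose_def vec_eq_iff)
      show "transpose (T y) \<noteq> 0" using T0[OF y] by (auto simp: transpose_def vec_eq_iff)
      show "transpose ?R ** transpose (T y) = transpose (T y) ** transpose ?R"
        using curvature_commutes[OF y, of 1 2] by (metis matrix_transpose_mul)
      show "transpose ?R $ 1 $ 1 + transpose ?R $ 2 $ 2 \<noteq> 0"
        using riem_trace_eq_ricci_skew[of \<Gamma> y] ricci_skew[OF y] by (simp add: transpose_def)
      show "transpose (T y) *v (\<chi> k. w k y) = 0"
        using wT'[OF y] by (simp add: matrix_vector_mult_def vec_eq_iff transpose_def mult.commute)
      show "transpose ?R *v (\<chi> k. w k y) = 0"
        using wR[OF y] by (simp add: matrix_vector_mult_def vec_eq_iff transpose_def)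
    qed
    then show ?thesis by (simp add: vec_eq_iff)
  qed
  have "pd k (w k) x = pd k (\<lambda>y. 0) x" by (rule pd_cong[OF openU x w0])
  then have "pd k \<phi> x * pd k h x = 0" using Dw[OF x, of k k] w0[OF x] by simp
  moreover have "2 * pd k \<phi> x = \<phi> x * pd k h x" using w0[OF x, of k] by (simp add: w_def)
  ultimately show ?thesis using \<phi>(2)[OF x] by (metis less_irrefl mult_eq_0_iff)
qed

end

section \<open>Walker metrics\<close>

lemma pd_base:
  fixes f :: "real ^ 'n::finite \<Rightarrow> real"
  assumes "f differentiable (at (base \<xi>))"
  shows "pd (Inl i) (\<lambda>\<xi>. f (base \<xi>)) \<xi> = pd i f (base \<xi>)"
    "pd (Inr i) (\<lambda>\<xi>. f (base \<xi>)) \<xi> = 0"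
    "(\<lambda>\<xi>. f (base \<xi>)) differentiable (at \<xi>)"
proof -
  have b: "(\<lambda>\<eta>. base \<eta> $ m) = (\<lambda>\<eta>. \<eta> $ Inl m)" for m :: 'n by (simp add: base_def)
  have db: "(\<lambda>\<eta>. base \<eta> $ m) differentiable (at \<xi>)" for m :: 'n
    unfolding b by (rule differentiable_component)
  note pc = pd_compose[OF db assms]
  show "pd (Inl i) (\<lambda>\<xi>. f (base \<xi>)) \<xi> = pd i f (base \<xi>)" "pd (Inr i) (\<lambda>\<xi>. f (base \<xi>)) \<xi> = 0"
    "(\<lambda>\<xi>. f (base \<xi>)) differentiable (at \<xi>)"
    unfolding pc(1) b pd_component
    by (simp_all add: sum_kronecker pc(2) if_distrib[of "\<lambda>z. _ * z"] cong: if_cong)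
qed

lemma continuous_base: "continuous_on UNIV (base :: real ^ ('n::finite + 'n) \<Rightarrow> real ^ 'n)"
  unfolding base_def by (intro continuous_intros)

lemma open_base_vimage: "open U \<Longrightarrow> open {\<xi>. base \<xi> \<in> U}"
  using continuous_on_open_vimage[OF open_UNIV, of base] continuous_base by (auto simp: vimage_def)

lemma smooth_on_base:
  fixes f :: "real ^ 'n::finite \<Rightarrow> real"
  assumes U: "open U" and "smooth_on U f"
  shows "smooth_on {\<xi>. base \<xi> \<in> U} (\<lambda>\<xi>. f (base \<xi>))"
proof -
  have "Ck_on k (\<lambda>\<xi>. f (base \<xi>)) {\<xi>. base \<xi> \<in> U}" if "Ck_on k f U" for k
    using that
  proof (induction k arbitrary: f)
    case 0
    then show ?case
      by (auto intro!: continuous_on_compose2[OF _ continuous_on_subset[OF continuous_base]])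
  next
    case (Suc k)
    have "Ck_on k (pd s (\<lambda>\<xi>. f (base \<xi>))) {\<xi>. base \<xi> \<in> U}" for s :: "'n + 'n"
    proof (cases s)
      case (Inl i)
      show ?thesis unfolding Inl
        by (rule Ck_on_cong[OF open_base_vimage[OF U], of "\<lambda>\<xi>. pd i f (base \<xi>)"])
          (use Suc in \<open>auto simp: pd_base\<close>)
    next
      case (Inr i)
      show ?thesis unfolding Inr
        by (rule Ck_on_cong[OF open_base_vimage[OF U], of "\<lambda>\<xi>. 0"])
          (use Suc in \<open>auto simp: pd_base Ck_on_const\<close>)
    qed
    then show ?case using Suc.prems by (auto intro: pd_base)
  qed
  then show ?thesis using assms by (simp add: smooth_on_def)
qed

text \<open>The skew part of the Ricci tensor of a torsion free connection is the curvature of the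
  connection induced on densities, which here is flat because the trace of \<open>\<Gamma>\<close> vanishes.\<close>

lemma ricci_symmetric:
  fixes \<Gamma> :: "'n::finite christ"
  assumes V: "open V" "x \<in> V"
    and sym: "\<And>i j k. \<Gamma> x i j k = \<Gamma> x j i k"
    and d: "\<And>i j k. (\<lambda>y. \<Gamma> y i j k) differentiable (at x)"
    and pdsym: "\<And>i j k l. pd l (\<lambda>y. \<Gamma> y i j k) x = pd l (\<lambda>y. \<Gamma> y j i k) x"
    and tr: "\<And>y k. y \<in> V \<Longrightarrow> (\<Sum>i\<in>UNIV. \<Gamma> y i k i) = 0"
  shows "ricci \<Gamma> x j k = ricci \<Gamma> x k j"
proof -
  have trd: "(\<Sum>i\<in>UNIV. pd j (\<lambda>y. \<Gamma> y i k i) x) = 0" for j k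
  proof -
    have "(\<Sum>i\<in>UNIV. pd j (\<lambda>y. \<Gamma> y i k i) x) = pd j (\<lambda>y. \<Sum>i\<in>UNIV. \<Gamma> y i k i) x"
      by (rule pd_sum[symmetric]) (auto intro: d)
    also have "\<dots> = pd j (\<lambda>y. 0) x" by (rule pd_cong[OF V tr])
    finally show ?thesis by simp
  qed
  have tr': "(\<Sum>i\<in>UNIV. \<Sum>m\<in>UNIV. \<Gamma> x j k m * \<Gamma> x i m i) = 0" for j k
    by (subst sum.swap) (simp add: sum_distrib_left[symmetric] tr[OF V(2)])
  have r: "ricci \<Gamma> x j k = (\<Sum>i\<in>UNIV. pd i (\<lambda>y. \<Gamma> y j k i) x) - (\<Sum>i\<in>UNIV. \<Sum>m\<in>UNIV. \<Gamma> x i k m * \<Gamma> x j m i)" for j k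
    unfolding ricci_def riem_def by (simp add: sum.distrib sum_subtractf trd tr')
  have "(\<Sum>i\<in>UNIV. \<Sum>m\<in>UNIV. \<Gamma> x i k m * \<Gamma> x j m i) = (\<Sum>i\<in>UNIV. \<Sum>m\<in>UNIV. \<Gamma> x i j m * \<Gamma> x k m i)"
    by (subst sum.swap) (simp add: sym[of _ k] sym[of j] mult.commute)
  then show ?thesis unfolding r by (simp add: pdsym[where i = j and j = k])
qed

definition walker :: "('n \<Rightarrow> 'n \<Rightarrow> real ^ ('n::finite + 'n) \<Rightarrow> real) \<Rightarrow> real ^ ('n + 'n) \<Rightarrow> real ^ ('n + 'n) ^ ('n + 'n)"
  where "walker A \<xi> = (\<chi> s t. case s of
       Inl i \<Rightarrow> (case t of Inl j \<Rightarrow> A i j \<xi> | Inr j \<Rightarrow> if i = j then 1 else 0)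
     | Inr i \<Rightarrow> (case t of Inl j \<Rightarrow> if i = j then 1 else 0 | Inr j \<Rightarrow> 0))"

lemma walker_components [simp]:
  "walker A \<xi> $ Inl i $ Inl j = A i j \<xi>"
  "walker A \<xi> $ Inl i $ Inr j = (if i = j then 1 else 0)"
  "walker A \<xi> $ Inr i $ Inl j = (if i = j then 1 else 0)"
  "walker A \<xi> $ Inr i $ Inr j = 0"
  by (simp_all add: walker_def)

lemma walker_inverse:
  "matrix_inv (walker A \<xi>) = (\<chi> s t. case s of
       Inl i \<Rightarrow> (case t of Inl j \<Rightarrow> 0 | Inr j \<Rightarrow> if i = j then 1 else 0)
     | Inr i \<Rightarrow> (case t of Inl j \<Rightarrow> if i = j then 1 else 0 | Inr j \<Rightarrow> - A i j \<xi>))" (is "_ = ?B")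
  "matrix_inv (walker A \<xi>) ** walker A \<xi> = mat 1"
proof -
  have "(walker A \<xi> ** ?B) $ s $ t = mat 1 $ s $ t" for s t
    by (cases s; cases t) (simp_all add: matrix_matrix_mult_def mat_def sum_UNIV_Plus sum_kronecker
        if_distrib[of "\<lambda>z. _ * z"] if_distrib[of "\<lambda>z. z * _"] cong: if_cong)
  then have *: "walker A \<xi> ** ?B = mat 1" by (simp add: vec_eq_iff)
  show 1: "matrix_inv (walker A \<xi>) = ?B"
    by (rule matrix_inv_eqI[OF *]) (use * matrix_left_right_inverse in blast)
  show "matrix_inv (walker A \<xi>) ** walker A \<xi> = mat 1"
    unfolding 1 using * matrix_left_right_inverse by blast
qed

lemma walker_inverse_components [simp]:
  "matrix_inv (walker A \<xi>) $ Inl i $ Inl j = 0"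
  "matrix_inv (walker A \<xi>) $ Inl i $ Inr j = (if i = j then 1 else 0)"
  "matrix_inv (walker A \<xi>) $ Inr i $ Inl j = (if i = j then 1 else 0)"
  "matrix_inv (walker A \<xi>) $ Inr i $ Inr j = - A i j \<xi>"
  by (simp_all add: walker_inverse)

lemma levi_civita_walker:
  "levi_civita (walker A) \<xi> (Inl i) (Inl j) (Inl k) = - pd (Inr k) (A i j) \<xi> / 2"
  "levi_civita (walker A) \<xi> (Inl i) (Inr j) (Inl k) = 0"
  "levi_civita (walker A) \<xi> (Inr i) (Inl j) (Inl k) = 0"
  "levi_civita (walker A) \<xi> (Inr i) (Inr j) s = 0"
  "levi_civita (walker A) \<xi> (Inl i) (Inr j) (Inr k) = pd (Inr j) (A i k) \<xi> / 2"
  "levi_civita (walker A) \<xi> (Inr j) (Inl i) (Inr k) = pd (Inr j) (A i k) \<xi> / 2"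
  "levi_civita (walker A) \<xi> (Inl i) (Inl j) (Inr k) = (pd (Inl i) (A j k) \<xi> + pd (Inl j) (A i k) \<xi>
     - pd (Inl k) (A i j) \<xi> + (\<Sum>l\<in>UNIV. A k l \<xi> * pd (Inr l) (A i j) \<xi>)) / 2"
proof -
  show "levi_civita (walker A) \<xi> (Inr i) (Inr j) s = 0"
    by (cases s) (simp_all add: levi_civita_def sum_UNIV_Plus)
qed (simp_all add: levi_civita_def sum_UNIV_Plus sum_kronecker sum_negf
    if_distrib[of "\<lambda>z. z * _"] cong: if_cong)

locale walker_chart =
  fixes V :: "(real ^ ('n::finite + 'n)) set" and A :: "'n \<Rightarrow> 'n \<Rightarrow> real ^ ('n + 'n) \<Rightarrow> real"
  assumes openV: "open V"
    and smooth_A: "smooth_on V (A i j)"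
    and sym_A: "\<xi> \<in> V \<Longrightarrow> A i j \<xi> = A j i \<xi>"
begin

lemma differentiable_A: "\<xi> \<in> V \<Longrightarrow> A i j differentiable (at \<xi>)"
  and differentiable_pd_A: "\<xi> \<in> V \<Longrightarrow> pd s (A i j) differentiable (at \<xi>)"
  using smooth_A smooth_on_differentiable smooth_on_pd by blast+

lemma pd_A_sym: "\<xi> \<in> V \<Longrightarrow> pd s (A i j) \<xi> = pd s (A j i) \<xi>"
  by (rule pd_cong[OF openV _ sym_A])

lemma walker_sym: "\<xi> \<in> V \<Longrightarrow> walker A \<xi> $ s $ t = walker A \<xi> $ t $ s"
  by (cases s; cases t) (auto simp: sym_A)

lemma differentiable_walker: "\<xi> \<in> V \<Longrightarrow> (\<lambda>\<xi>. walker A \<xi> $ s $ t) differentiable (at \<xi>)"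
  by (cases s; cases t) (auto simp: differentiable_A)

lemma differentiable_walker_inverse: "\<xi> \<in> V \<Longrightarrow> (\<lambda>\<xi>. matrix_inv (walker A \<xi>) $ s $ t) differentiable (at \<xi>)"
  by (cases s; cases t) (auto simp: differentiable_A intro: differentiable_minus)

lemma differentiable_levi_civita: "\<xi> \<in> V \<Longrightarrow> (\<lambda>\<xi>. levi_civita (walker A) \<xi> s t u) differentiable (at \<xi>)"
  by (cases s; cases t; cases u; simp only: levi_civita_walker;
      intro differentiable_divide differentiable_minus differentiable_add differentiable_diff differentiable_mult
        differentiable_sum ballI differentiable_const differentiable_A differentiable_pd_A; simp)

text \<open>Lowering the last index with \<open>g\<close> turns a base index into a fibre index, so these components
  determine the Weyl tensor with a vertical last argument.  They involve only the Christoffel symbols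
  with an upper base index, most of which vanish.\<close>

lemma riem_walker_base:
  assumes \<xi>: "\<xi> \<in> V"
  shows "riem (levi_civita (walker A)) \<xi> (Inr i) (Inr j) (Inl k) (Inl l) = 0"
    "riem (levi_civita (walker A)) \<xi> (Inl i) (Inr j) (Inl k) (Inl l) = pd (Inr j) (pd (Inr l) (A i k)) \<xi> / 2"
    "riem (levi_civita (walker A)) \<xi> (Inl i) (Inl j) (Inl k) (Inl l)
      = pd (Inl j) (pd (Inr l) (A i k)) \<xi> / 2 - pd (Inl i) (pd (Inr l) (A j k)) \<xi> / 2
        + (\<Sum>m\<in>UNIV. pd (Inr m) (A j k) \<xi> * pd (Inr l) (A i m) \<xi> - pd (Inr m) (A i k) \<xi> * pd (Inr l) (A j m) \<xi>) / 4"
  by (simp_all add: riem_def sum_UNIV_Plus levi_civita_walker pd_minus pd_divide differentiable_pd_A[OF \<xi>]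
      differentiable_minus differentiable_divide_const sum_divide_distrib diff_divide_distrib)

text \<open>The determinant of a Walker metric is constant.\<close>

lemma trace_levi_civita: "\<xi> \<in> V \<Longrightarrow> (\<Sum>s\<in>UNIV. levi_civita (walker A) \<xi> s t s) = 0"
  by (cases t) (simp_all add: sum_UNIV_Plus levi_civita_walker pd_A_sym sum.distrib[symmetric])

lemma ric_walker_sym: "\<xi> \<in> V \<Longrightarrow> ric (walker A) \<xi> s t = ric (walker A) \<xi> t s"
proof (rule ricci_symmetric[OF openV])
  assume \<xi>: "\<xi> \<in> V"
  show S: "levi_civita (walker A) \<xi> i j k = levi_civita (walker A) \<xi> j i k" if "\<xi> \<in> V" for i j k \<xi>
    using levi_civita_sym[OF _ openV that] walker_sym by blast
  show "pd l (\<lambda>y. levi_civita (walker A) y i j k) \<xi> = pd l (\<lambda>y. levi_civita (walker A) y j i k) \<xi>" for i j k l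
    by (rule pd_cong[OF openV \<xi>]) (rule S)
qed (auto intro: differentiable_levi_civita trace_levi_civita)

lemma ric_walker_fibre:
  assumes \<xi>: "\<xi> \<in> V"
  shows "ric (walker A) \<xi> (Inr i) (Inr j) = 0"
    "ric (walker A) \<xi> (Inl i) (Inr j) = (\<Sum>m\<in>UNIV. pd (Inr m) (pd (Inr j) (A i m)) \<xi>) / 2"
    "ric (walker A) \<xi> (Inr j) (Inl i) = (\<Sum>m\<in>UNIV. pd (Inr m) (pd (Inr j) (A i m)) \<xi>) / 2"
proof -
  show "ric (walker A) \<xi> (Inr i) (Inr j) = 0"
    by (simp add: ricci_def riem_def sum_UNIV_Plus levi_civita_walker)
  show 1: "ric (walker A) \<xi> (Inl i) (Inr j) = (\<Sum>m\<in>UNIV. pd (Inr m) (pd (Inr j) (A i m)) \<xi>) / 2"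
    by (simp add: ricci_def riem_def sum_UNIV_Plus levi_civita_walker pd_divide differentiable_pd_A[OF \<xi>]
        sum_divide_distrib)
  show "ric (walker A) \<xi> (Inr j) (Inl i) = (\<Sum>m\<in>UNIV. pd (Inr m) (pd (Inr j) (A i m)) \<xi>) / 2"
    using 1 ric_walker_sym[OF \<xi>] by simp
qed

end

section \<open>Modified Riemannian extensions\<close>

lemma pd_fibre: "pd (Inl i) (\<lambda>\<xi>. fibre \<xi> $ k) \<xi> = 0" "pd (Inr i) (\<lambda>\<xi>. fibre \<xi> $ k) \<xi> = (if i = k then 1 else 0)"
  by (simp_all add: fibre_def pd_component)

lemma differentiable_fibre: "(\<lambda>\<xi>. fibre \<xi> $ k) differentiable (at \<xi>)"
  by (simp add: fibre_def differentiable_component)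

lemma smooth_on_fibre: "smooth_on V (\<lambda>\<xi>. fibre \<xi> $ k)"
  by (simp add: fibre_def smooth_on_component)

lemma join_base_fibre [simp]: "join (base \<xi>) (fibre \<xi>) = \<xi>"
  by (auto simp: join_def base_def fibre_def vec_eq_iff split: sum.split)

lemma differentiable_join: "(\<lambda>x. join x y $ s) differentiable (at x)"
  by (cases s) (auto simp: differentiable_component)

lemma open_slice:
  assumes "open V"
  shows "open {x. join x y \<in> V}"
proof -
  have "(\<lambda>x. join x y $ s) = (\<lambda>x. case s of Inl i \<Rightarrow> x $ i | Inr i \<Rightarrow> y $ i)" for s
    by (auto split: sum.split)
  then have "continuous_on UNIV (\<lambda>x. join x y $ s)" for s
    by (cases s) (auto intro!: continuous_intros)
  then have "continuous_on UNIV (\<lambda>x. join x y)"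
    using continuous_on_vec_lambda[of UNIV "\<lambda>s x. join x y $ s"] by simp
  then show ?thesis
    using open_vimage[OF assms, of "\<lambda>x. join x y"] by (simp add: vimage_def)
qed

lemma pd_slice:
  assumes "F differentiable (at (join x y))"
  shows "pd i (\<lambda>x. F (join x y)) x = pd (Inl i) F (join x y)" "(\<lambda>x. F (join x y)) differentiable (at x)"
proof -
  note pc = pd_compose[where F = "\<lambda>x. join x y", OF differentiable_join assms]
  show "pd i (\<lambda>x. F (join x y)) x = pd (Inl i) F (join x y)"
    unfolding pc(1) by (simp add: sum_UNIV_Plus pd_component sum_kronecker
      if_distrib[of "\<lambda>z. _ * z"] cong: if_cong)
qed (rule pd_compose(2)[where F = "\<lambda>x. join x y", OF differentiable_join assms])

lemma smooth_on_slice: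
  assumes V: "open V" and "smooth_on V F"
  shows "smooth_on {x. join x y \<in> V} (\<lambda>x. F (join x y))"
proof -
  have "Ck_on k (\<lambda>x. F (join x y)) {x. join x y \<in> V}" if "Ck_on (Suc k) F V" for k
    using that
  proof (induction k arbitrary: F)
    case 0
    then show ?case
      by (auto intro!: continuous_at_imp_continuous_on differentiable_imp_continuous_within pd_slice)
  next
    case (Suc k)
    have "Ck_on k (pd i (\<lambda>x. F (join x y))) {x. join x y \<in> V}" for i
      by (rule Ck_on_cong[OF open_slice[OF V], of _ "\<lambda>x. pd (Inl i) F (join x y)"])
        (use Suc.prems pd_slice(1)[of F] in \<open>auto intro!: Suc.IH\<close>)
    then show ?case using Suc.prems by (auto intro: pd_slice)
  qed
  then show ?thesis using assms by (simp add: smooth_on_def del: Ck_on.simps)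
qed

locale extension_chart = nilpotent_affine_chart U \<Gamma> T for U \<Gamma> T +
  fixes \<Phi> :: "real ^ 2 \<Rightarrow> real ^ 2 ^ 2"
  assumes smooth_\<Phi>: "smooth_on U (\<lambda>y. \<Phi> y $ i $ j)"
    and sym_\<Phi>: "y \<in> U \<Longrightarrow> \<Phi> y $ i $ j = \<Phi> y $ j $ i"
begin

definition "\<Omega> = {\<xi> :: real ^ (2 + 2). base \<xi> \<in> U}"

text \<open>The base components of the one-form \<open>\<iota>T\<close>.\<close>

definition u :: "2 \<Rightarrow> real ^ (2 + 2) \<Rightarrow> real" where
  "u i \<xi> = (\<Sum>r\<in>UNIV. fibre \<xi> $ r * T (base \<xi>) $ r $ i)"

text \<open>The block of the metric tangent to the base.\<close>

definition A :: "2 \<Rightarrow> 2 \<Rightarrow> real ^ (2 + 2) \<Rightarrow> real" where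
  "A i j \<xi> = u i \<xi> * u j \<xi> - 2 * (\<Sum>k\<in>UNIV. fibre \<xi> $ k * \<Gamma> (base \<xi>) i j k) + \<Phi> (base \<xi>) $ i $ j"

lemma modified_extension_eq_walker:
  assumes "\<Gamma>' a = \<Gamma>" "\<Phi>' a = \<Phi>" "T' a = T"
  shows "modified_extension \<Gamma>' \<Phi>' T' a = walker A"
proof -
  have "modified_extension \<Gamma>' \<Phi>' T' a \<xi> $ s $ t = walker A \<xi> $ s $ t" for \<xi> s t
    by (cases s; cases t) (simp_all add: assms modified_extension_def sym_prod_def iota11_def
        riemann_extension_def pullback02_def A_def u_def)
  then show ?thesis by (simp add: vec_eq_iff fun_eq_iff)
qed

lemma open_\<Omega>: "open \<Omega>"
  unfolding \<Omega>_def by (rule open_base_vimage[OF openU])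

lemma smooth_u: "smooth_on \<Omega> (u i)"
  unfolding u_def[abs_def] \<Omega>_def
  by (intro smooth_on_sum smooth_on_mult open_base_vimage openU smooth_on_fibre smooth_on_base smooth_T finite)

lemma smooth_A: "smooth_on \<Omega> (A i j)"
proof -
  have s: "smooth_on \<Omega> (\<lambda>\<xi>. f (base \<xi>))" if "smooth_on U f" for f
    unfolding \<Omega>_def by (rule smooth_on_base[OF openU that])
  show ?thesis
    unfolding A_def[abs_def]
    by (intro smooth_on_add smooth_on_diff smooth_on_sum smooth_on_mult open_\<Omega> smooth_on_fibre
      smooth_on_const s[OF smooth_\<Gamma>] s[OF smooth_\<Phi>] smooth_u finite)
qed

sublocale W: walker_chart \<Omega> A
proof (unfold_locales, rule open_\<Omega>, rule smooth_A)
  show "A i j \<xi> = A j i \<xi>" if "\<xi> \<in> \<Omega>" for i j \<xi>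
    using that unfolding A_def \<Omega>_def by (simp add: torsion_free[of _ i j] sym_\<Phi>[of _ i j] mult.commute)
qed

lemma differentiable_u: "\<xi> \<in> \<Omega> \<Longrightarrow> u i differentiable (at \<xi>)"
  using smooth_u smooth_on_differentiable by blast

lemma differentiable_lift: "\<xi> \<in> \<Omega> \<Longrightarrow> (\<lambda>\<xi>. \<Gamma> (base \<xi>) i j k) differentiable (at \<xi>)"
    "\<xi> \<in> \<Omega> \<Longrightarrow> (\<lambda>\<xi>. T (base \<xi>) $ k $ j) differentiable (at \<xi>)"
    "\<xi> \<in> \<Omega> \<Longrightarrow> (\<lambda>\<xi>. \<Phi> (base \<xi>) $ i $ j) differentiable (at \<xi>)"
  unfolding \<Omega>_def
  using pd_base(3)[OF differentiable_\<Gamma>] pd_base(3)[OF differentiable_T]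
    pd_base(3)[OF smooth_on_differentiable[OF smooth_\<Phi>]] by auto

lemma pd_fibre_lift: "\<xi> \<in> \<Omega> \<Longrightarrow> pd (Inr l) (\<lambda>\<xi>. \<Gamma> (base \<xi>) i j k) \<xi> = 0"
    "\<xi> \<in> \<Omega> \<Longrightarrow> pd (Inr l) (\<lambda>\<xi>. T (base \<xi>) $ k $ j) \<xi> = 0"
    "\<xi> \<in> \<Omega> \<Longrightarrow> pd (Inr l) (\<lambda>\<xi>. \<Phi> (base \<xi>) $ i $ j) \<xi> = 0"
  unfolding \<Omega>_def
  using pd_base(2)[OF differentiable_\<Gamma>] pd_base(2)[OF differentiable_T]
    pd_base(2)[OF smooth_on_differentiable[OF smooth_\<Phi>]] by auto

lemma pd_fibre_u: "\<xi> \<in> \<Omega> \<Longrightarrow> pd (Inr l) (u i) \<xi> = T (base \<xi>) $ l $ i"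
  unfolding u_def[abs_def]
  by (simp add: pd_sum pd_mult differentiable_fibre differentiable_mult differentiable_lift pd_fibre_lift pd_fibre
      sum_kronecker)

lemma pd_fibre_A:
  assumes \<xi>: "\<xi> \<in> \<Omega>"
  shows "pd (Inr l) (A i j) \<xi> = T (base \<xi>) $ l $ i * u j \<xi> + u i \<xi> * T (base \<xi>) $ l $ j - 2 * \<Gamma> (base \<xi>) i j l"
proof -
  have "pd (Inr l) (\<lambda>\<xi>. \<Sum>k\<in>UNIV. fibre \<xi> $ k * \<Gamma> (base \<xi>) i j k) \<xi> = \<Gamma> (base \<xi>) i j l"
    by (simp add: pd_sum pd_mult differentiable_fibre differentiable_mult differentiable_lift[OF \<xi>]
        pd_fibre_lift[OF \<xi>] pd_fibre sum_kronecker)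
  moreover have "(\<lambda>\<xi>. \<Sum>k\<in>UNIV. fibre \<xi> $ k * \<Gamma> (base \<xi>) i j k) differentiable (at \<xi>)"
    by (intro differentiable_sum ballI differentiable_mult differentiable_fibre differentiable_lift \<xi> finite)
  ultimately show ?thesis
    unfolding A_def[abs_def]
    by (simp add: pd_add pd_diff pd_mult differentiable_add differentiable_diff differentiable_mult
        differentiable_u[OF \<xi>] differentiable_lift[OF \<xi>] pd_fibre_lift[OF \<xi>] pd_fibre_u[OF \<xi>])
qed

lemma pd_fibre_fibre_A:
  assumes \<xi>: "\<xi> \<in> \<Omega>"
  shows "pd (Inr m) (pd (Inr l) (A i j)) \<xi>
    = T (base \<xi>) $ l $ i * T (base \<xi>) $ m $ j + T (base \<xi>) $ m $ i * T (base \<xi>) $ l $ j"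
  by (subst pd_cong[OF open_\<Omega> \<xi> pd_fibre_A], assumption)
    (simp add: pd_add pd_diff pd_mult differentiable_add differentiable_diff differentiable_mult
        differentiable_u[OF \<xi>] differentiable_lift[OF \<xi>] pd_fibre_lift[OF \<xi>] pd_fibre_u[OF \<xi>])

lemma T_trace: "y \<in> U \<Longrightarrow> T y $ 2 $ 2 = - T y $ 1 $ 1"
  by (rule nilpotent_2(1)[OF T_nilpotent])

lemma T_square: "y \<in> U \<Longrightarrow> (\<Sum>m\<in>UNIV. T y $ i $ m * T y $ m $ j) = 0"
  using T_nilpotent[of y] by (simp add: vec_eq_iff matrix_matrix_mult_def)

text \<open>The mixed components are traces of the second fibre derivatives of \<open>A\<close>, which are the
  symmetrised products of two copies of \<open>T\<close>; they vanish since \<open>T\<close> is trace free and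
  squares to zero.\<close>

lemma ric_fibre:
  assumes \<xi>: "\<xi> \<in> \<Omega>"
  shows "ric (walker A) \<xi> (Inr i) s = 0" "ric (walker A) \<xi> s (Inr i) = 0"
proof -
  have y: "base \<xi> \<in> U" using \<xi> by (simp add: \<Omega>_def)
  have "(\<Sum>m\<in>UNIV. pd (Inr m) (pd (Inr j) (A i m)) \<xi>) = 0" for i j
    using T_square[OF y, of j i] T_trace[OF y]
    by (simp add: pd_fibre_fibre_A[OF \<xi>] sum_2 algebra_simps)
  then show "ric (walker A) \<xi> (Inr i) s = 0" "ric (walker A) \<xi> s (Inr i) = 0"
    by (cases s; simp add: W.ric_walker_fibre[OF \<xi>])+
qed

lemma u_zero: "fibre \<xi> = 0 \<Longrightarrow> u i \<xi> = 0"
  by (simp add: u_def)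


text \<open>Here \<open>\<beta>\<close> is the fibre gradient of the conformal factor \<open>F\<close>.  The three blocks of the equation
  \<open>2 Hes F - F Hes h = \<theta> g\<close> are differentiated along the fibres to separate the powers of \<open>y\<close>; what
  remains are equations on the slices \<open>y = const\<close>, which are copies of an open subset of the surface.\<close>

lemma conformally_einstein_soliton_critical:
  assumes V: "open V" "V \<subseteq> \<Omega>" and F: "smooth_on V F" "\<And>\<xi>. \<xi> \<in> V \<Longrightarrow> F \<xi> > 0"
    and h: "smooth_on U h" and T0: "\<And>y. y \<in> U \<Longrightarrow> T y \<noteq> 0" and x0: "join x 0 \<in> V"
    and soliton: "\<And>\<xi> s t. \<xi> \<in> V \<Longrightarrow>
      hessian (levi_civita (walker A)) (\<lambda>\<xi>. h (base \<xi>)) \<xi> s t + ric (walker A) \<xi> s t = lam * walker A \<xi> $ s $ t"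
    and einstein: "\<And>\<xi> s t. \<xi> \<in> V \<Longrightarrow>
      ric (\<lambda>\<xi>. (1 / (F \<xi>)\<^sup>2) *\<^sub>R walker A \<xi>) \<xi> s t = mu * ((1 / (F \<xi>)\<^sup>2) *\<^sub>R walker A \<xi>) $ s $ t"
  shows "pd k h x = 0"
proof -
  let ?h = "\<lambda>\<xi> :: real ^ (2 + 2). h (base \<xi>)"
  let ?H = "hessian (levi_civita (walker A))"
  define \<beta> where "\<beta> j = pd (Inr j) F" for j
  have \<Omega>: "\<xi> \<in> \<Omega>" "base \<xi> \<in> U" if "\<xi> \<in> V" for \<xi> using that V by (auto simp: \<Omega>_def)
  have "\<exists>\<theta>. \<forall>s t. 2 * ?H F \<xi> s t - F \<xi> * ?H ?h \<xi> s t = \<theta> * walker A \<xi> $ s $ t" if \<xi>: "\<xi> \<in> V" for \<xi>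
  proof -
    obtain \<theta> where \<theta>: "\<And>s t. ric (\<lambda>\<xi>. (1 / (F \<xi>)\<^sup>2) *\<^sub>R walker A \<xi>) \<xi> s t
        = ric (walker A) \<xi> s t + 2 / F \<xi> * ?H F \<xi> s t + \<theta> * walker A \<xi> $ s $ t"
      using ricci_conformal[OF V(1) \<xi> F W.walker_sym[OF \<Omega>(1)] walker_inverse(2) W.differentiable_walker[OF \<Omega>(1)]
        W.differentiable_walker_inverse[OF \<Omega>(1)[OF \<xi>]] W.differentiable_levi_civita[OF \<Omega>(1)[OF \<xi>]]] by auto
    have "2 * ?H F \<xi> s t - F \<xi> * ?H ?h \<xi> s t = (F \<xi> * (mu / (F \<xi>)\<^sup>2 - lam - \<theta>)) * walker A \<xi> $ s $ t" for s t
    proof -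
      have "2 / F \<xi> * ?H F \<xi> s t - ?H ?h \<xi> s t = (mu / (F \<xi>)\<^sup>2 - lam - \<theta>) * walker A \<xi> $ s $ t"
        using \<theta>[of s t] soliton[OF \<xi>, of s t] einstein[OF \<xi>, of s t] by (simp add: algebra_simps)
      moreover have "2 * ?H F \<xi> s t = F \<xi> * (2 / F \<xi> * ?H F \<xi> s t)" using F(2)[OF \<xi>] by simp
      ultimately show ?thesis by algebra
    qed
    then show ?thesis by blast
  qed
  then obtain \<theta> where E: "\<And>\<xi> s t. \<xi> \<in> V \<Longrightarrow> 2 * ?H F \<xi> s t - F \<xi> * ?H ?h \<xi> s t = \<theta> \<xi> * walker A \<xi> $ s $ t"
    by metis
  have dh: "h differentiable (at y)" "pd i h differentiable (at y)" "pd j (pd i h) differentiable (at y)"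
    if "y \<in> U" for y i j
    using h that smooth_on_differentiable smooth_on_pd by blast+
  have pdh: "pd (Inl i) ?h \<xi> = pd i h (base \<xi>)" "pd (Inr i) ?h \<xi> = 0" if "\<xi> \<in> V" for \<xi> i
    using pd_base[OF dh(1)[OF \<Omega>(2)[OF that]]] by auto
  have pdpdh: "pd s (pd (Inr i) ?h) \<xi> = 0" "pd (Inl j) (pd (Inl i) ?h) \<xi> = pd j (pd i h) (base \<xi>)" if "\<xi> \<in> V" for \<xi> s i j
  proof -
    show "pd s (pd (Inr i) ?h) \<xi> = 0" by (subst pd_cong[OF V(1) that pdh(2)]) auto
    show "pd (Inl j) (pd (Inl i) ?h) \<xi> = pd j (pd i h) (base \<xi>)"
      by (subst pd_cong[OF V(1) that pdh(1)]) (auto simp: pd_base[OF dh(2)[OF \<Omega>(2)[OF that]]])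
  qed
  have dF: "F differentiable (at \<xi>)" "pd s F differentiable (at \<xi>)" "pd t (pd s F) differentiable (at \<xi>)"
    if "\<xi> \<in> V" for \<xi> s t
    using F that smooth_on_differentiable smooth_on_pd by blast+
  note lc = levi_civita_walker
  \<comment> \<open>vertical block: \<open>F\<close> is affine on the fibres\<close>
  have \<beta>\<beta>: "pd (Inr i) (\<beta> j) \<xi> = 0" if "\<xi> \<in> V" for \<xi> i j
    using E[OF that, of "Inr i" "Inr j"]
    by (simp add: hessian_def lc pdpdh[OF that] \<beta>_def)
  \<comment> \<open>mixed block: up to the terms of \<open>A\<close> quadratic in \<open>y\<close>, \<open>D\<beta>\<close> is a multiple of the identity\<close>
  have N: "2 * (pd (Inl i) (\<beta> j) \<xi> - (\<Sum>k\<in>UNIV. pd (Inr j) (A i k) \<xi> * \<beta> k \<xi>) / 2)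
      = \<theta> \<xi> * (if i = j then 1 else 0)" if "\<xi> \<in> V" for \<xi> i j
    using E[OF that, of "Inl i" "Inr j"]
    by (simp add: hessian_def lc pdpdh[OF that] pdh[OF that] sum_UNIV_Plus \<beta>_def sum_divide_distrib)
  define N' where "N' i j \<xi> = pd (Inl i) (\<beta> j) \<xi> - (\<Sum>k\<in>UNIV. pd (Inr j) (A i k) \<xi> * \<beta> k \<xi>) / 2" for i j \<xi>
  define \<tau> where "\<tau> l \<xi> = (\<Sum>k\<in>UNIV. T (base \<xi>) $ l $ k * \<beta> k \<xi>)" for l \<xi>
  have d\<beta>: "\<beta> j differentiable (at \<xi>)" "pd s (\<beta> j) differentiable (at \<xi>)" if "\<xi> \<in> V" for \<xi> s j
    using dF[OF that] by (auto simp: \<beta>_def)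
  have pdN: "pd (Inr l) (N' i j) \<xi> = - (T (base \<xi>) $ j $ i * \<tau> l \<xi> + T (base \<xi>) $ l $ i * \<tau> j \<xi>) / 2"
    if \<xi>: "\<xi> \<in> V" for \<xi> i j l
  proof -
    have 0: "pd (Inr l) (pd (Inl i) (\<beta> j)) \<xi> = 0"
    proof -
      have "pd (Inr l) (pd (Inl i) (\<beta> j)) \<xi> = pd (Inl i) (pd (Inr l) (\<beta> j)) \<xi>"
        unfolding \<beta>_def by (rule pd_commute[OF V(1) \<xi>]) (intro smooth_on_pd F)
      also have "\<dots> = 0" by (subst pd_cong[OF V(1) \<xi> \<beta>\<beta>]) auto
      finally show ?thesis .
    qed
    show ?thesis
      unfolding N'_def[abs_def] \<tau>_def
      by (simp add: sum_2 pd_diff pd_divide pd_add pd_mult differentiable_add differentiable_mult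
          differentiable_divide_const d\<beta>[OF \<xi>] W.differentiable_pd_A[OF \<Omega>(1)[OF \<xi>]] 0 \<beta>\<beta>[OF \<xi>]
          pd_fibre_fibre_A[OF \<Omega>(1)[OF \<xi>]])
        (simp add: algebra_simps)
  qed
  \<comment> \<open>the trace-free part of the mixed block is linear in \<open>y\<close>, with coefficient a symmetrisation of
      \<open>T \<otimes> \<tau>\<close> for \<open>\<tau> = T \<beta>\<close>; the trace of that coefficient vanishes anyway because \<open>T\<close> squares to zero\<close>
  have \<tau>0: "\<tau> l \<xi> = 0" if \<xi>: "\<xi> \<in> V" for \<xi> l
  proof -
    let ?T = "T (base \<xi>)"
    have N12: "N' i j \<xi> = 0" if "i \<noteq> j" "\<xi> \<in> V" for i j \<xi>
      using N[OF that(2), of i j] that(1) by (simp add: N'_def)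
    have N11: "N' 1 1 \<xi> - N' 2 2 \<xi> = 0" if "\<xi> \<in> V" for \<xi>
      using N[OF that, of 1 1] N[OF that, of 2 2] by (simp add: N'_def)
    have dN: "N' i j differentiable (at \<xi>)" for i j
      unfolding N'_def[abs_def]
      by (intro differentiable_diff differentiable_divide_const differentiable_sum ballI differentiable_mult finite
          d\<beta> W.differentiable_pd_A \<xi> \<Omega>)
    have off: "?T $ j $ i * \<tau> l \<xi> + ?T $ l $ i * \<tau> j \<xi> = 0" if "i \<noteq> j" for i j l
    proof -
      have "pd (Inr l) (N' i j) \<xi> = pd (Inr l) (\<lambda>\<xi>. 0) \<xi>"
        by (rule pd_cong[OF V(1) \<xi>]) (rule N12[OF that])
      then show ?thesis unfolding pdN[OF \<xi>] by simp
    qed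
    have pd0: "pd (Inr l) (\<lambda>\<xi>. N' 1 1 \<xi> - N' 2 2 \<xi>) \<xi> = pd (Inr l) (\<lambda>\<xi>. 0) \<xi>" for l
      by (rule pd_cong[OF V(1) \<xi>]) (rule N11)
    have dg: "?T $ 1 $ 1 * \<tau> l \<xi> + ?T $ l $ 1 * \<tau> 1 \<xi> = ?T $ 2 $ 2 * \<tau> l \<xi> + ?T $ l $ 2 * \<tau> 2 \<xi>" for l
      using pd0[of l] unfolding pd_diff[OF dN dN] pdN[OF \<xi>] by simp
    have "(\<Sum>m\<in>UNIV. ?T $ l $ m * \<tau> m \<xi>) = (\<Sum>k\<in>UNIV. (\<Sum>m\<in>UNIV. ?T $ l $ m * ?T $ m $ k) * \<beta> k \<xi>)" for l
      unfolding \<tau>_def by (simp add: sum_2 algebra_simps)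
    then have tt: "?T $ l $ 1 * \<tau> 1 \<xi> + ?T $ l $ 2 * \<tau> 2 \<xi> = 0" for l
      by (simp add: T_square[OF \<Omega>(2)[OF \<xi>]] sum_2)
    have M: "?T $ j $ i * \<tau> l \<xi> + ?T $ l $ i * \<tau> j \<xi> = 0" for i j l
    proof (cases "i = j")
      case True
      have "?T $ 1 $ 1 * \<tau> l \<xi> + ?T $ l $ 1 * \<tau> 1 \<xi> = 0" "?T $ 2 $ 2 * \<tau> l \<xi> + ?T $ l $ 2 * \<tau> 2 \<xi> = 0"
        using dg[of l] tt[of l] T_trace[OF \<Omega>(2)[OF \<xi>]] by algebra+
      then show ?thesis using True exhaust_2[of i] by auto
    qed (rule off)
    obtain j i where ij: "?T $ j $ i \<noteq> 0" using T0[OF \<Omega>(2)[OF \<xi>]] by (auto simp: vec_eq_iff)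
    then have "\<tau> j \<xi> = 0" using M[of j i j] by simp
    then show ?thesis using M[of j i l] ij by simp
  qed
  have ub: "(\<Sum>k\<in>UNIV. u k \<xi> * \<beta> k \<xi>) = 0" if "\<xi> \<in> V" for \<xi>
  proof -
    have "(\<Sum>k\<in>UNIV. u k \<xi> * \<beta> k \<xi>) = (\<Sum>r\<in>UNIV. fibre \<xi> $ r * \<tau> r \<xi>)"
      by (simp add: u_def \<tau>_def sum_2 algebra_simps)
    then show ?thesis by (simp add: \<tau>0[OF that])
  qed
  have D\<beta>: "pd (Inl i) (\<beta> j) \<xi> + (\<Sum>k\<in>UNIV. \<Gamma> (base \<xi>) i k j * \<beta> k \<xi>) = (if i = j then \<theta> \<xi> / 2 else 0)" if "\<xi> \<in> V" for \<xi> i j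
  proof -
    have "(\<Sum>k\<in>UNIV. pd (Inr j) (A i k) \<xi> * \<beta> k \<xi>)
       = T (base \<xi>) $ j $ i * (\<Sum>k\<in>UNIV. u k \<xi> * \<beta> k \<xi>) + u i \<xi> * \<tau> j \<xi> - 2 * (\<Sum>k\<in>UNIV. \<Gamma> (base \<xi>) i k j * \<beta> k \<xi>)"
      by (simp add: pd_fibre_A[OF \<Omega>(1)[OF that]] sum_2 \<tau>_def algebra_simps)
    then show ?thesis using N[OF that, of i j] by (simp add: ub[OF that] \<tau>0[OF that] split: if_splits)
  qed
  have \<beta>0: "\<beta> j \<xi> = 0" "\<theta> \<xi> = 0" if \<xi>: "\<xi> \<in> V" for \<xi> j
  proof -
    define y where "y = fibre \<xi>"
    define W where "W = {x. join x y \<in> V}"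
    have W: "W \<subseteq> U" using \<Omega>(2) by (force simp: W_def)
    interpret S: nilpotent_affine_chart W \<Gamma> T
      by (rule subchart[OF _ W]) (simp add: W_def open_slice[OF V(1)])
    have sb: "smooth_on W (\<lambda>x. \<beta> k (join x y))" for k
      unfolding W_def \<beta>_def by (rule smooth_on_slice[OF V(1)]) (rule smooth_on_pd[OF F(1)])
    have Tb: "(\<Sum>j\<in>UNIV. T x $ k $ j * \<beta> j (join x y)) = 0" if "x \<in> W" for x k
      using \<tau>0[of "join x y" k] that by (simp add: W_def \<tau>_def)
    have Db: "pd i (\<lambda>x. \<beta> l (join x y)) x + (\<Sum>k\<in>UNIV. \<Gamma> x i k l * \<beta> k (join x y))
        = (if i = l then \<theta> (join x y) / 2 else 0)" if "x \<in> W" for x i l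
      using D\<beta>[of "join x y" i l] that by (simp add: W_def pd_slice[OF d\<beta>(1)])
    have T0': "T x \<noteq> 0" if "x \<in> W" for x using T0 W that by blast
    have "base \<xi> \<in> W" using \<xi> by (simp add: W_def y_def)
    from S.homothetic_kernel_field_zero[OF sb Tb Db T0' this]
    show "\<beta> j \<xi> = 0" "\<theta> \<xi> = 0" by (simp_all add: y_def)
  qed
  \<comment> \<open>base block; the Christoffel symbols with an upper fibre index, which contain the base derivatives
      of \<open>A\<close>, are multiplied by \<open>\<beta> = 0\<close>\<close>
  have E3: "2 * pd (Inl i) (pd (Inl j) F) \<xi> - F \<xi> * pd i (pd j h) (base \<xi>)
      + (\<Sum>k\<in>UNIV. pd (Inr k) (A i j) \<xi> / 2 * (2 * pd (Inl k) F \<xi> - F \<xi> * pd k h (base \<xi>))) = 0" if "\<xi> \<in> V" for \<xi> i j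
    using E[OF that, of "Inl i" "Inl j"] \<beta>0[OF that]
    by (simp add: hessian_def lc pdpdh[OF that] pdh[OF that] sum_UNIV_Plus \<beta>_def sum_2 algebra_simps)
  \<comment> \<open>the coefficient of \<open>y\<close> in \<open>E3\<close> is again a symmetrised product with \<open>T\<close>\<close>
  have \<sigma>: "(\<Sum>k\<in>UNIV. (2 * pd (Inl k) F \<xi> - F \<xi> * pd k h (base \<xi>)) * T (base \<xi>) $ k $ j) = 0" if \<xi>: "\<xi> \<in> V" for \<xi> j
  proof -
    let ?T = "T (base \<xi>)"
    define \<sigma> where "\<sigma> j = (\<Sum>k\<in>UNIV. (2 * pd (Inl k) F \<xi> - F \<xi> * pd k h (base \<xi>)) * ?T $ k $ j)" for j
    have QF: "pd (Inr l) F \<xi> = 0" if "\<xi> \<in> V" for l \<xi> using \<beta>0[OF that] by (simp add: \<beta>_def)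
    have QPF: "pd (Inr l) (pd (Inl i) F) \<xi> = 0" if "\<xi> \<in> V" for l i \<xi>
      unfolding pd_commute[OF V(1) that F(1)] by (subst pd_cong[OF V(1) that QF]) auto
    have QPPF: "pd (Inr l) (pd (Inl i) (pd (Inl j) F)) \<xi> = 0" for l i j
      unfolding pd_commute[OF V(1) \<xi> smooth_on_pd[OF F(1)], of "Inr l"] by (subst pd_cong[OF V(1) \<xi> QPF]) auto
    have M: "\<sigma> i * ?T $ l $ j + ?T $ l $ i * \<sigma> j = 0" for i j l
    proof -
      have "pd (Inr l) (\<lambda>\<xi>. 2 * pd (Inl i) (pd (Inl j) F) \<xi> - F \<xi> * pd i (pd j h) (base \<xi>)
        + (\<Sum>k\<in>UNIV. pd (Inr k) (A i j) \<xi> / 2 * (2 * pd (Inl k) F \<xi> - F \<xi> * pd k h (base \<xi>)))) \<xi> = pd (Inr l) (\<lambda>\<xi>. 0) \<xi>"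
        by (rule pd_cong[OF V(1) \<xi> E3])
      then have "(\<Sum>k\<in>UNIV. pd (Inr l) (pd (Inr k) (A i j)) \<xi> / 2 * (2 * pd (Inl k) F \<xi> - F \<xi> * pd k h (base \<xi>))) = 0"
        by (simp add: sum_2 pd_diff pd_divide pd_add pd_mult differentiable_add differentiable_diff differentiable_mult
          differentiable_divide_const dF[OF \<xi>] pd_base[OF dh(2)[OF \<Omega>(2)[OF \<xi>]]] pd_base[OF dh(3)[OF \<Omega>(2)[OF \<xi>]]]
          W.differentiable_pd_A[OF \<Omega>(1)[OF \<xi>]] QF[OF \<xi>] QPF[OF \<xi>] QPPF)
      then show ?thesis
        unfolding \<sigma>_def by (simp add: pd_fibre_fibre_A[OF \<Omega>(1)[OF \<xi>]] sum_2 field_simps)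
    qed
    obtain l i where li: "?T $ l $ i \<noteq> 0" using T0[OF \<Omega>(2)[OF \<xi>]] by (auto simp: vec_eq_iff)
    then have "\<sigma> i = 0" using M[of i l i] by simp
    then have "\<sigma> j = 0" using M[of i l j] li by simp
    then show ?thesis by (simp add: \<sigma>_def)
  qed
  define W where "W = {x. join x 0 \<in> V}"
  have W: "W \<subseteq> U" using \<Omega>(2) by (force simp: W_def)
  interpret S: nilpotent_affine_chart W \<Gamma> T
    by (rule subchart[OF _ W]) (simp add: W_def open_slice[OF V(1)])
  have F': "smooth_on W (\<lambda>x. F (join x 0))"
    unfolding W_def by (rule smooth_on_slice[OF V(1) F(1)])
  have pF: "pd i (\<lambda>x. F (join x 0)) y = pd (Inl i) F (join y 0)" if "y \<in> W" for y i
    using that by (simp add: W_def pd_slice[OF dF(1)])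
  have ppF: "pd j (pd i (\<lambda>x. F (join x 0))) y = pd (Inl j) (pd (Inl i) F) (join y 0)" if "y \<in> W" for y i j
    using that by (subst pd_cong[OF S.openU that pF]) (auto simp: W_def pd_slice[OF dF(2)])
  show ?thesis
  proof (rule S.soliton_conformal_factor_critical[OF F'])
    show "0 < F (join y 0)" if "y \<in> W" for y using F(2) that by (simp add: W_def)
    show "smooth_on W h" using smooth_on_subset[OF h W] .
    show "T y \<noteq> 0" if "y \<in> W" for y using T0 W that by blast
    show "2 * hessian \<Gamma> (\<lambda>x. F (join x 0)) y i j = F (join y 0) * hessian \<Gamma> h y i j" if "y \<in> W" for y i j
      using E3[of "join y 0" i j] pd_fibre_A[of "join y 0"] that \<Omega>(1)
      by (simp add: W_def[unfolded set_eq_iff] hessian_def ppF[OF that] pF[OF that] u_zero sum_2 algebra_simps)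
    show "(\<Sum>k\<in>UNIV. (2 * pd k (\<lambda>x. F (join x 0)) y - F (join y 0) * pd k h y) * T y $ k $ j) = 0" if "y \<in> W" for y j
      using \<sigma>[of "join y 0" j] that by (simp add: pF[OF that]) (simp add: W_def)
    show "x \<in> W" using x0 by (simp add: W_def)
  qed
qed

end

section \<open>The Hodge star and half conformal flatness\<close>

lemma UNIV_2_plus_2: "(UNIV :: (2 + 2) set) = {Inl 1, Inl 2, Inr 1, Inr 2}"
  by (auto simp: UNIV_sum UNIV_2)

lemma det_2_plus_2:
  fixes B :: "'a::comm_ring_1 ^ (2 + 2) ^ (2 + 2)"
  shows "det B =
    B$(Inl 1)$(Inl 1) * B$(Inl 2)$(Inl 2) * B$(Inr 1)$(Inr 1) * B$(Inr 2)$(Inr 2)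
    - B$(Inl 1)$(Inl 1) * B$(Inl 2)$(Inl 2) * B$(Inr 1)$(Inr 2) * B$(Inr 2)$(Inr 1)
    - B$(Inl 1)$(Inl 1) * B$(Inl 2)$(Inr 1) * B$(Inr 1)$(Inl 2) * B$(Inr 2)$(Inr 2)
    + B$(Inl 1)$(Inl 1) * B$(Inl 2)$(Inr 1) * B$(Inr 1)$(Inr 2) * B$(Inr 2)$(Inl 2)
    + B$(Inl 1)$(Inl 1) * B$(Inl 2)$(Inr 2) * B$(Inr 1)$(Inl 2) * B$(Inr 2)$(Inr 1)
    - B$(Inl 1)$(Inl 1) * B$(Inl 2)$(Inr 2) * B$(Inr 1)$(Inr 1) * B$(Inr 2)$(Inl 2)
    - B$(Inl 1)$(Inl 2) * B$(Inl 2)$(Inl 1) * B$(Inr 1)$(Inr 1) * B$(Inr 2)$(Inr 2)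
    + B$(Inl 1)$(Inl 2) * B$(Inl 2)$(Inl 1) * B$(Inr 1)$(Inr 2) * B$(Inr 2)$(Inr 1)
    + B$(Inl 1)$(Inl 2) * B$(Inl 2)$(Inr 1) * B$(Inr 1)$(Inl 1) * B$(Inr 2)$(Inr 2)
    - B$(Inl 1)$(Inl 2) * B$(Inl 2)$(Inr 1) * B$(Inr 1)$(Inr 2) * B$(Inr 2)$(Inl 1)
    - B$(Inl 1)$(Inl 2) * B$(Inl 2)$(Inr 2) * B$(Inr 1)$(Inl 1) * B$(Inr 2)$(Inr 1)
    + B$(Inl 1)$(Inl 2) * B$(Inl 2)$(Inr 2) * B$(Inr 1)$(Inr 1) * B$(Inr 2)$(Inl 1)
    + B$(Inl 1)$(Inr 1) * B$(Inl 2)$(Inl 1) * B$(Inr 1)$(Inl 2) * B$(Inr 2)$(Inr 2)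
    - B$(Inl 1)$(Inr 1) * B$(Inl 2)$(Inl 1) * B$(Inr 1)$(Inr 2) * B$(Inr 2)$(Inl 2)
    - B$(Inl 1)$(Inr 1) * B$(Inl 2)$(Inl 2) * B$(Inr 1)$(Inl 1) * B$(Inr 2)$(Inr 2)
    + B$(Inl 1)$(Inr 1) * B$(Inl 2)$(Inl 2) * B$(Inr 1)$(Inr 2) * B$(Inr 2)$(Inl 1)
    + B$(Inl 1)$(Inr 1) * B$(Inl 2)$(Inr 2) * B$(Inr 1)$(Inl 1) * B$(Inr 2)$(Inl 2)
    - B$(Inl 1)$(Inr 1) * B$(Inl 2)$(Inr 2) * B$(Inr 1)$(Inl 2) * B$(Inr 2)$(Inl 1)
    - B$(Inl 1)$(Inr 2) * B$(Inl 2)$(Inl 1) * B$(Inr 1)$(Inl 2) * B$(Inr 2)$(Inr 1)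
    + B$(Inl 1)$(Inr 2) * B$(Inl 2)$(Inl 1) * B$(Inr 1)$(Inr 1) * B$(Inr 2)$(Inl 2)
    + B$(Inl 1)$(Inr 2) * B$(Inl 2)$(Inl 2) * B$(Inr 1)$(Inl 1) * B$(Inr 2)$(Inr 1)
    - B$(Inl 1)$(Inr 2) * B$(Inl 2)$(Inl 2) * B$(Inr 1)$(Inr 1) * B$(Inr 2)$(Inl 1)
    - B$(Inl 1)$(Inr 2) * B$(Inl 2)$(Inr 1) * B$(Inr 1)$(Inl 1) * B$(Inr 2)$(Inl 2)
    + B$(Inl 1)$(Inr 2) * B$(Inl 2)$(Inr 1) * B$(Inr 1)$(Inl 2) * B$(Inr 2)$(Inl 1)"
proof -
  have f: "finite {Inl 2 :: 2 + 2, Inr 1, Inr 2}" "Inl 1 \<notin> {Inl 2 :: 2 + 2, Inr 1, Inr 2}"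
    "finite {Inr 1 :: 2 + 2, Inr 2}" "Inl 2 \<notin> {Inr 1 :: 2 + 2, Inr 2}"
    "finite {Inr 2 :: 2 + 2}" "Inr 1 \<notin> {Inr 2 :: 2 + 2}"
    by auto
  show ?thesis
    unfolding det_def UNIV_2_plus_2
    unfolding sum_over_permutations_insert[OF f(1,2)]
    unfolding sum_over_permutations_insert[OF f(3,4)]
    unfolding sum_over_permutations_insert[OF f(5,6)]
    unfolding permutes_sing
    by (simp add: sign_swap_id permutation_swap_id sign_compose sign_id swap_id_eq permutation_compose
        transpose_def mult.assoc)
qed


lemma det_walker: "det (walker A \<xi> :: real ^ (2 + 2) ^ (2 + 2)) = 1"
  by (simp add: det_2_plus_2)

lemma perm_symbol_rows:
  "perm_symbol (Inl 1) (Inl 2) p q = (if p = Inr 1 \<and> q = Inr 2 then 1 else if p = Inr 2 \<and> q = Inr 1 then -1 else 0)"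
  "perm_symbol (Inl 1) (Inr 2) p q = (if p = Inl 2 \<and> q = Inr 1 then 1 else if p = Inr 1 \<and> q = Inl 2 then -1 else 0)"
  "perm_symbol (Inl 2) (Inr 1) p q = (if p = Inl 1 \<and> q = Inr 2 then 1 else if p = Inr 2 \<and> q = Inl 1 then -1 else 0)"
proof -
  have "p \<in> {Inl 1, Inl 2, Inr 1, Inr 2}" "q \<in> {Inl 1, Inl 2, Inr 1, Inr 2}"
    using UNIV_2_plus_2 by blast+
  then show
    "perm_symbol (Inl 1) (Inl 2) p q = (if p = Inr 1 \<and> q = Inr 2 then 1 else if p = Inr 2 \<and> q = Inr 1 then -1 else 0)"
    "perm_symbol (Inl 1) (Inr 2) p q = (if p = Inl 2 \<and> q = Inr 1 then 1 else if p = Inr 1 \<and> q = Inl 2 then -1 else 0)"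
    "perm_symbol (Inl 2) (Inr 1) p q = (if p = Inl 1 \<and> q = Inr 2 then 1 else if p = Inr 2 \<and> q = Inl 1 then -1 else 0)"
    by (auto simp: perm_symbol_def det_2_plus_2 axis_def)
qed

lemma weyl_skew: "weyl g x j i k l = - weyl g x i j k l"
proof -
  have "riem \<Gamma> x j i k m = - riem \<Gamma> x i j k m" for \<Gamma> m
    by (simp add: riem_def sum_subtractf)
  then have "riem_low g x j i k l = - riem_low g x i j k l"
    by (simp add: riem_low_def sum_negf)
  then show ?thesis
    unfolding weyl_def by (simp add: diff_divide_distrib add_divide_distrib algebra_simps)
qed

lemma star_weyl_row:
  assumes P: "\<And>p q. perm_symbol i j p q = (if p = a \<and> q = b then 1 else if p = b \<and> q = a then -1 else 0)" and "a \<noteq> b"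
  shows "star_weyl s g x i j k l = s * sqrt \<bar>det (g x)\<bar> *
    (\<Sum>u\<in>UNIV. \<Sum>v\<in>UNIV. matrix_inv (g x) $ a $ u * matrix_inv (g x) $ b $ v * weyl g x u v k l)"
proof -
  let ?I = "matrix_inv (g x)"
  let ?c = "s * sqrt \<bar>det (g x)\<bar>"
  define X where "X p q = (\<Sum>u\<in>UNIV. \<Sum>v\<in>UNIV. ?I $ p $ u * ?I $ q $ v * weyl g x u v k l)" for p q
  have skew: "X b a = - X a b"
  proof -
    have "X b a = (\<Sum>u\<in>UNIV. \<Sum>v\<in>UNIV. ?I $ b $ v * ?I $ a $ u * weyl g x v u k l)"
      unfolding X_def by (rule sum.swap)
    also have "\<dots> = - X a b"
      unfolding X_def sum_negf[symmetric] by (intro sum.cong refl) (subst weyl_skew, simp add: mult_ac)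
    finally show ?thesis .
  qed
  have "star_weyl s g x i j k l = (\<Sum>p\<in>UNIV. \<Sum>q\<in>UNIV. ?c * perm_symbol i j p q * X p q) / 2"
    unfolding star_weyl_def X_def vol_form_def sum_distrib_left by (simp add: mult_ac)
  also have "(\<Sum>p\<in>UNIV. \<Sum>q\<in>UNIV. ?c * perm_symbol i j p q * X p q)
      = (\<Sum>p\<in>UNIV. \<Sum>q\<in>UNIV. (if p = a then 1 else 0) * ((if q = b then 1 else 0) * (?c * X p q))
          - (if p = b then 1 else 0) * ((if q = a then 1 else 0) * (?c * X p q)))"
    unfolding P by (intro sum.cong refl) (use \<open>a \<noteq> b\<close> in auto)
  also have "\<dots> = ?c * X a b - ?c * X b a"
    by (simp only: sum_subtractf sum_distrib_left[symmetric] sum_kronecker)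
  finally have "star_weyl s g x i j k l = ?c * X a b" unfolding skew by simp
  then show ?thesis unfolding X_def .
qed

text \<open>Up to terms in which the first two slots are vertical, the first two bivectors are eigenvectors
  of the Hodge star for \<open>-s\<close>; \<open>\<partial>\<^sub>1 \<and> \<partial>\<^sub>2\<close> is one for \<open>s\<close> up to terms with a vertical slot.\<close>

lemma star_weyl_walker:
  "star_weyl s (walker A) \<xi> (Inl 1) (Inr 2) k l
    = - s * (weyl (walker A) \<xi> (Inl 1) (Inr 2) k l + A 1 1 \<xi> * weyl (walker A) \<xi> (Inr 2) (Inr 1) k l)"
  "star_weyl s (walker A) \<xi> (Inl 2) (Inr 1) k l
    = - s * (weyl (walker A) \<xi> (Inl 2) (Inr 1) k l + A 2 2 \<xi> * weyl (walker A) \<xi> (Inr 1) (Inr 2) k l)"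
  "star_weyl s (walker A) \<xi> (Inl 1) (Inl 2) k l = s * (weyl (walker A) \<xi> (Inl 1) (Inl 2) k l
      - (\<Sum>m\<in>UNIV. A 2 m \<xi> * weyl (walker A) \<xi> (Inl 1) (Inr m) k l)
      + (\<Sum>m\<in>UNIV. A 1 m \<xi> * weyl (walker A) \<xi> (Inl 2) (Inr m) k l)
      + (\<Sum>m\<in>UNIV. \<Sum>n\<in>UNIV. A 1 m \<xi> * A 2 n \<xi> * weyl (walker A) \<xi> (Inr m) (Inr n) k l))"
proof -
  let ?W = "\<lambda>u v. weyl (walker A) \<xi> u v k l"
  have W: "?W u u = 0" "?W (Inr i) (Inl j) = - ?W (Inl j) (Inr i)" "?W (Inl 2) (Inl 1) = - ?W (Inl 1) (Inl 2)"
    for u and i j :: 2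
    using weyl_skew[of "walker A" \<xi> u u k l] by (auto intro: weyl_skew)
  show
    "star_weyl s (walker A) \<xi> (Inl 1) (Inr 2) k l = - s * (?W (Inl 1) (Inr 2) + A 1 1 \<xi> * ?W (Inr 2) (Inr 1))"
    "star_weyl s (walker A) \<xi> (Inl 2) (Inr 1) k l = - s * (?W (Inl 2) (Inr 1) + A 2 2 \<xi> * ?W (Inr 1) (Inr 2))"
    "star_weyl s (walker A) \<xi> (Inl 1) (Inl 2) k l = s * (?W (Inl 1) (Inl 2)
      - (\<Sum>m\<in>UNIV. A 2 m \<xi> * ?W (Inl 1) (Inr m)) + (\<Sum>m\<in>UNIV. A 1 m \<xi> * ?W (Inl 2) (Inr m))
      + (\<Sum>m\<in>UNIV. \<Sum>n\<in>UNIV. A 1 m \<xi> * A 2 n \<xi> * ?W (Inr m) (Inr n)))"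
    by (simp_all only: star_weyl_row[OF perm_symbol_rows(1), simplified] star_weyl_row[OF perm_symbol_rows(2), simplified]
          star_weyl_row[OF perm_symbol_rows(3), simplified] det_walker)
      (simp_all add: sum_UNIV_Plus sum_2 W algebra_simps)
qed

context extension_chart
begin

lemma scal_zero: "\<xi> \<in> \<Omega> \<Longrightarrow> scal (walker A) \<xi> = 0"
  by (simp add: scal_def sum_UNIV_Plus ric_fibre)

lemma riem_low_fibre: "riem_low (walker A) \<xi> i j k (Inr l) = riem (levi_civita (walker A)) \<xi> i j k (Inl l)"
  by (simp add: riem_low_def sum_UNIV_Plus sum_kronecker)

lemma weyl_components:
  assumes \<xi>: "\<xi> \<in> \<Omega>"
  shows "weyl (walker A) \<xi> (Inr i) (Inr j) (Inl k) (Inr l) = 0"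
    "weyl (walker A) \<xi> (Inl i) (Inr j) (Inl k) (Inr l)
      = (T (base \<xi>) $ l $ i * T (base \<xi>) $ j $ k + T (base \<xi>) $ j $ i * T (base \<xi>) $ l $ k) / 2"
    "weyl (walker A) \<xi> (Inl i) (Inl j) (Inl k) (Inr l) = riem (levi_civita (walker A)) \<xi> (Inl i) (Inl j) (Inl k) (Inl l)
      - (ric (walker A) \<xi> (Inl j) (Inl k) * (if i = l then 1 else 0)
         - ric (walker A) \<xi> (Inl i) (Inl k) * (if j = l then 1 else 0)) / 2"
  unfolding weyl_def riem_low_fibre scal_zero[OF \<xi>]
  by (simp_all only: W.riem_walker_base[OF \<xi>] pd_fibre_fibre_A[OF \<xi>] ric_fibre[OF \<xi>] walker_components) simp_all

text \<open>The zero section is where \<open>\<iota>T\<close> and its derivatives along the base vanish, so that the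
  Walker metric has the Christoffel symbols of \<open>D\<close> as its base part.\<close>

lemma riem_zero_section:
  assumes x: "x \<in> U"
  shows "riem (levi_civita (walker A)) (join x 0) (Inl i) (Inl j) (Inl k) (Inl l) = riem \<Gamma> x i j k l"
proof -
  let ?\<xi> = "join x 0 :: real ^ (2 + 2)"
  have \<xi>: "?\<xi> \<in> \<Omega>" using x by (simp add: \<Omega>_def)
  have u0: "u i ?\<xi> = 0" for i by (simp add: u_zero)
  have pu: "pd (Inl m) (u i) ?\<xi> = 0" for m i
    unfolding u_def[abs_def]
    by (simp add: pd_sum pd_mult differentiable_fibre differentiable_mult differentiable_lift[OF \<xi>] pd_fibre)
  have p\<Gamma>: "pd (Inl m) (\<lambda>\<xi>. \<Gamma> (base \<xi>) i j k) ?\<xi> = pd m (\<lambda>y. \<Gamma> y i j k) x" for m i j k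
    using pd_base(1)[of "\<lambda>y. \<Gamma> y i j k" ?\<xi>] differentiable_\<Gamma>[OF x] by simp
  have ppA: "pd (Inl m) (pd (Inr l) (A i j)) ?\<xi> = - 2 * pd m (\<lambda>y. \<Gamma> y i j l) x" for m l i j
    by (subst pd_cong[OF open_\<Omega> \<xi> pd_fibre_A], assumption)
      (simp add: pd_add pd_diff pd_mult differentiable_add differentiable_diff differentiable_mult
        differentiable_u[OF \<xi>] differentiable_lift[OF \<xi>] u0 pu p\<Gamma>)
  show ?thesis
    unfolding W.riem_walker_base(3)[OF \<xi>] ppA pd_fibre_A[OF \<xi>] riem_def[of \<Gamma>]
    by (simp add: u0 sum_2 field_simps)
qed

text \<open>If \<open>e s = -1\<close>, the components on \<open>\<partial>\<^sub>1 \<and> \<partial>\<^sub>2\<^sub>'\<close> and \<open>\<partial>\<^sub>2 \<and> \<partial>\<^sub>1\<^sub>'\<close> are the squares of the two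
  off-diagonal entries of \<open>T\<close>, which cannot both vanish.  If \<open>e s = 1\<close>, contracting the last two slots
  of the row \<open>\<partial>\<^sub>1 \<and> \<partial>\<^sub>2\<close> removes the terms with a vertical slot and the symmetric Ricci tensor, and
  leaves the trace of the curvature of the surface.\<close>

lemma weyl_pm_nonzero:
  assumes x: "x \<in> U" and T0: "T x \<noteq> 0" and s: "s = 1 \<or> s = -1" and e: "e = 1 \<or> e = -1"
  shows "\<exists>i j k l. weyl_pm e s (walker A) (join x 0) i j k l \<noteq> 0"
proof (rule ccontr)
  let ?\<xi> = "join x 0 :: real ^ (2 + 2)"
  let ?W = "weyl (walker A) ?\<xi>"
  assume "\<not> ?thesis"
  then have Z: "?W i j k l + e * star_weyl s (walker A) ?\<xi> i j k l = 0" for i j k l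
    by (simp add: weyl_pm_def)
  have \<xi>: "?\<xi> \<in> \<Omega>" using x by (simp add: \<Omega>_def)
  note W = weyl_components[OF \<xi>]
  show False
  proof (cases "e = s")
    case False
    then have es: "e * s = -1" using e s by auto
    have 1: "?W (Inl 1) (Inr 2) (Inl 1) (Inr 2) = 0"
      using Z[of "Inl 1" "Inr 2" "Inl 1" "Inr 2"] es unfolding star_weyl_walker W(1) by algebra
    have 2: "?W (Inl 2) (Inr 1) (Inl 2) (Inr 1) = 0"
      using Z[of "Inl 2" "Inr 1" "Inl 2" "Inr 1"] es unfolding star_weyl_walker W(1) by algebra
    have "T x $ 2 $ 1 = 0" "T x $ 1 $ 2 = 0"
      using 1 2 unfolding W(2) by simp_all
    moreover have "T x $ 1 $ 1 = 0"
      using nilpotent_2(2)[OF T_nilpotent[OF x]] calculation by simp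
    ultimately show False
      using T0 T_trace[OF x] by (simp add: matrix_eq_2)
  next
    case True
    then have es: "e * s = 1" using s by auto
    have m: "(\<Sum>k\<in>UNIV. ?W (Inl i) (Inr m) (Inl k) (Inr k)) = 0" for i m
      unfolding W(2) using T_square[OF x, of m i] T_trace[OF x] by (simp add: sum_2 field_simps)
    have "(\<Sum>k\<in>UNIV. ?W (Inl 1) (Inl 2) (Inl k) (Inr k) + e * star_weyl s (walker A) ?\<xi> (Inl 1) (Inl 2) (Inl k) (Inr k)) = 0"
      by (simp add: Z)
    then have "2 * (\<Sum>k\<in>UNIV. ?W (Inl 1) (Inl 2) (Inl k) (Inr k)) = 0"
      using m[of 1 1] m[of 1 2] m[of 2 1] m[of 2 2] es
      unfolding star_weyl_walker sum_2 W(1) by algebra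
    then have "riem \<Gamma> x 1 2 1 1 + riem \<Gamma> x 1 2 2 2 = 0"
      using W.ric_walker_sym[OF \<xi>, of "Inl 2" "Inl 1"]
      unfolding W(3) riem_zero_section[OF x] by (simp add: sum_2)
    then show False using riem_trace_eq_ricci_skew[of \<Gamma> x] ricci_skew[OF x] by simp
  qed
qed

end

section \<open>From charts to the surface\<close>

lemma cpar_chart:
  assumes "x \<in> crange M a"
  shows "cpar M a x \<in> cdom M a" "crd M a (cpar M a x) = x"
  using assms unfolding crange_def cpar_def by (auto intro: inv_into_into f_inv_into_f)

lemma cpar_crd: "inj_on (crd M a) (cdom M a) \<Longrightarrow> p \<in> cdom M a \<Longrightarrow> cpar M a (crd M a p) = p"
  by (simp add: cpar_def)

lemma smooth_atlasD:
  assumes "smooth_atlas M" "a \<in> idx M"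
  shows "inj_on (crd M a) (cdom M a)" "open (crange M a)" "cdom M a \<subseteq> pts M"
    "b \<in> idx M \<Longrightarrow> open (overlap M a b)"
    "b \<in> idx M \<Longrightarrow> smooth_on (overlap M a b) (\<lambda>x. transition M a b x $ k)"
  using assms unfolding smooth_atlas_def by auto

lemma transition_overlap:
  assumes M: "smooth_atlas M" "a \<in> idx M" "b \<in> idx M" and x: "x \<in> overlap M a b"
  shows "transition M a b x \<in> overlap M b a" "transition M b a (transition M a b x) = x" "x \<in> crange M a"
proof -
  obtain p where p: "p \<in> cdom M a" "p \<in> cdom M b" "x = crd M a p"
    using x by (auto simp: overlap_def)
  have "cpar M a x = p" "cpar M b (crd M b p) = p"
    using p smooth_atlasD(1)[OF M(1)] M cpar_crd by metis+
  then show "transition M a b x \<in> overlap M b a" "transition M b a (transition M a b x) = x" "x \<in> crange M a"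
    using p by (auto simp: transition_def overlap_def crange_def)
qed

lemma jac_inverse:
  assumes M: "smooth_atlas M" "a \<in> idx M" "b \<in> idx M" and x: "x \<in> overlap M a b"
  shows "jac M b a (transition M a b x) ** jac M a b x = mat 1"
proof -
  have "(\<Sum>m\<in>UNIV. pd m (\<lambda>y. transition M b a y $ k) (transition M a b x) * pd i (\<lambda>y. transition M a b y $ m) x)
      = (if i = k then 1 else 0)" for i k
  proof -
    have "pd i (\<lambda>y. transition M b a (transition M a b y) $ k) x = pd i (\<lambda>y. y $ k) x"
      by (rule pd_cong[OF smooth_atlasD(4)[OF M] x]) (simp add: transition_overlap[OF M])
    then show ?thesis
      using pd_compose(1)[of "transition M a b" x "\<lambda>y. transition M b a y $ k" i]
        smooth_on_differentiable[OF smooth_atlasD(5)[OF M] x]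
        smooth_on_differentiable[OF smooth_atlasD(5)[OF M(1,3,2)] transition_overlap(1)[OF M x]]
      by (simp add: pd_component)
  qed
  then show ?thesis
    by (simp add: matrix_matrix_mult_def jac_def mat_def vec_eq_iff eq_commute)
qed

text \<open>A predicate that is locally constant in every chart has open level sets in the manifold topology.\<close>

lemma connected_locally_constant:
  assumes M: "smooth_atlas M" "connected_space (mtop M)" and p0: "p0 \<in> pts M" "P p0"
    and loc: "\<And>a x. a \<in> idx M \<Longrightarrow> x \<in> crange M a \<Longrightarrow>
      \<exists>r>0. ball x r \<subseteq> crange M a \<and> (\<forall>y\<in>ball x r. P (cpar M a y) = P (cpar M a x))"
    and p: "p \<in> pts M"
  shows "P p"
proof -
  have op: "openin (mtop M) W \<longleftrightarrow> W \<subseteq> pts M \<and> (\<forall>a\<in>idx M. open (crd M a ` (W \<inter> cdom M a)))" for W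
    by (rule openin_mtop) (rule smooth_atlasD(1)[OF M(1)])
  have opQ: "openin (mtop M) {p \<in> pts M. Q p}"
    if Q: "\<And>a x. a \<in> idx M \<Longrightarrow> x \<in> crange M a \<Longrightarrow>
      \<exists>r>0. ball x r \<subseteq> crange M a \<and> (\<forall>y\<in>ball x r. Q (cpar M a y) = Q (cpar M a x))" for Q
    unfolding op
  proof (intro conjI ballI)
    fix a assume a: "a \<in> idx M"
    show "open (crd M a ` ({p \<in> pts M. Q p} \<inter> cdom M a))"
      unfolding open_contains_ball
    proof
      fix x assume "x \<in> crd M a ` ({p \<in> pts M. Q p} \<inter> cdom M a)"
      then obtain q where q: "q \<in> cdom M a" "Q q" "x = crd M a q" by auto
      then have x: "x \<in> crange M a" "cpar M a x = q"
        using cpar_crd[OF smooth_atlasD(1)[OF M(1) a]] by (auto simp: crange_def)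
      obtain r where r: "r > 0" "ball x r \<subseteq> crange M a" "\<And>y. y \<in> ball x r \<Longrightarrow> Q (cpar M a y)"
        using Q[OF a x(1)] q x(2) by auto
      have "y \<in> crd M a ` ({p \<in> pts M. Q p} \<inter> cdom M a)" if "y \<in> ball x r" for y
      proof -
        have "y \<in> crange M a" using r that by blast
        then show ?thesis
          using cpar_chart[of y M a] r(3)[OF that] smooth_atlasD(3)[OF M(1) a]
          by (intro image_eqI[of _ _ "cpar M a y"]) auto
      qed
      then show "\<exists>r>0. ball x r \<subseteq> crd M a ` ({p \<in> pts M. Q p} \<inter> cdom M a)" using r(1) by blast
    qed
  qed auto
  have 1: "openin (mtop M) {p \<in> pts M. P p}" by (rule opQ[OF loc])
  have 2: "openin (mtop M) {p \<in> pts M. \<not> P p}" by (rule opQ) (use loc in blast)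
  have "topspace (mtop M) \<subseteq> pts M" using op openin_topspace by blast
  then have top: "topspace (mtop M) \<subseteq> {p \<in> pts M. P p} \<union> {p \<in> pts M. \<not> P p}" by blast
  have "{p \<in> pts M. P p} \<inter> {p \<in> pts M. \<not> P p} = {}" by blast
  with M(2) 1 2 top have "{p \<in> pts M. P p} = {} \<or> {p \<in> pts M. \<not> P p} = {}"
    unfolding connected_space_def by blast
  then show ?thesis using p p0 by blast
qed

text \<open>Along the segment from \<open>p\<close> to \<open>q\<close> the equation for \<open>T\<close> is a linear ordinary differential equation.
  Gronwall's argument is applied to the sum \<open>N\<close> of the
  squares of the components: \<open>N' \<le> C N\<close> makes \<open>exp (-C t) N\<close> nonincreasing.\<close>

lemma parallel_zero_propagates:
  fixes T :: "real ^ 'n::finite \<Rightarrow> real ^ 'n ^ 'n"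
  assumes B: "compact B" "convex B" "B \<subseteq> U"
    and \<Gamma>: "\<And>i j k. continuous_on U (\<lambda>y. \<Gamma> y i j k)"
    and dT: "\<And>y k j. y \<in> U \<Longrightarrow> (\<lambda>y. T y $ k $ j) differentiable (at y)"
    and par: "\<And>y i k j. y \<in> U \<Longrightarrow> pd i (\<lambda>y. T y $ k $ j) y
        + (\<Sum>m\<in>UNIV. \<Gamma> y i m k * T y $ m $ j - \<Gamma> y i j m * T y $ k $ m) = 0"
    and pq: "p \<in> B" "q \<in> B" and "T p = 0"
  shows "T q = 0"
proof -
  define n where "n = real CARD('n)"
  define v where "v = q - p"
  define N where "N y = (\<Sum>k\<in>UNIV. \<Sum>j\<in>UNIV. (T y $ k $ j)\<^sup>2)" for y
  define \<gamma> where "\<gamma> t = p + t *\<^sub>R v" for t :: real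
  have \<gamma>B: "\<gamma> t \<in> B" if "0 \<le> t" "t \<le> 1" for t
    using convexD[OF B(2) pq, of "1 - t" t] that by (simp add: \<gamma>_def v_def algebra_simps)
  have "\<exists>K. \<forall>y\<in>B. \<bar>\<Gamma> y i j k\<bar> \<le> K" for i j k
    using compact_imp_bounded[OF compact_continuous_image[OF continuous_on_subset[OF \<Gamma> B(3)] B(1)]]
    unfolding bounded_iff by force
  then obtain K where K: "\<And>i j k y. y \<in> B \<Longrightarrow> \<bar>\<Gamma> y i j k\<bar> \<le> K i j k" by metis
  define L where "L = (\<Sum>i\<in>UNIV. \<Sum>j\<in>UNIV. \<Sum>k\<in>UNIV. \<bar>K i j k\<bar>)"
  have L: "\<bar>\<Gamma> y i j k\<bar> \<le> L" if "y \<in> B" for y i j k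
  proof -
    have "\<bar>K i j k\<bar> \<le> (\<Sum>k\<in>UNIV. \<bar>K i j k\<bar>)" by (rule member_le_sum) auto
    also have "\<dots> \<le> (\<Sum>j\<in>UNIV. \<Sum>k\<in>UNIV. \<bar>K i j k\<bar>)"
      by (rule member_le_sum[of j UNIV "\<lambda>j. \<Sum>k\<in>UNIV. \<bar>K i j k\<bar>"]) (auto intro: sum_nonneg)
    also have "\<dots> \<le> L" unfolding L_def
      by (rule member_le_sum[of i UNIV "\<lambda>i. \<Sum>j\<in>UNIV. \<Sum>k\<in>UNIV. \<bar>K i j k\<bar>"]) (auto intro!: sum_nonneg)
    finally show ?thesis using K[OF that, of i j k] by linarith
  qed
  have TN: "\<bar>T y $ k $ j\<bar> \<le> sqrt (N y)" for y k j
  proof -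
    have "(T y $ k $ j)\<^sup>2 \<le> (\<Sum>j\<in>UNIV. (T y $ k $ j)\<^sup>2)" by (rule member_le_sum) auto
    also have "\<dots> \<le> N y" unfolding N_def
      by (rule member_le_sum[of k UNIV "\<lambda>k. \<Sum>j\<in>UNIV. (T y $ k $ j)\<^sup>2"]) (auto intro: sum_nonneg)
    finally show ?thesis using real_le_rsqrt[of "\<bar>T y $ k $ j\<bar>" "N y"] by simp
  qed
  have N0: "N y \<ge> 0" for y unfolding N_def by (intro sum_nonneg) auto
  have L0: "L \<ge> 0" unfolding L_def by (intro sum_nonneg) auto
  have pdT: "\<bar>pd i (\<lambda>y. T y $ k $ j) y\<bar> \<le> n * (2 * L * sqrt (N y))" if y: "y \<in> B" for y i k j
  proof -
    have "\<bar>\<Gamma> y i m k * T y $ m $ j - \<Gamma> y i j m * T y $ k $ m\<bar> \<le> 2 * L * sqrt (N y)" for m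
    proof -
      have "\<bar>\<Gamma> y i m k * T y $ m $ j\<bar> \<le> L * sqrt (N y)" "\<bar>\<Gamma> y i j m * T y $ k $ m\<bar> \<le> L * sqrt (N y)"
        unfolding abs_mult by (intro mult_mono L TN y L0 abs_ge_zero)+
      then show ?thesis by linarith
    qed
    then have "(\<Sum>m\<in>UNIV. \<bar>\<Gamma> y i m k * T y $ m $ j - \<Gamma> y i j m * T y $ k $ m\<bar>) \<le> n * (2 * L * sqrt (N y))"
      unfolding n_def by (intro sum_bounded_above) auto
    note b = this
    have e: "pd i (\<lambda>y. T y $ k $ j) y = - (\<Sum>m\<in>UNIV. \<Gamma> y i m k * T y $ m $ j - \<Gamma> y i j m * T y $ k $ m)"
      using par[of y i k j] B(3) y by (simp add: add_eq_0_iff subset_iff)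
    show ?thesis
      unfolding e abs_minus_cancel by (rule order_trans[OF sum_abs b])
  qed
  define T' where "T' k j t = (\<Sum>i\<in>UNIV. v $ i * pd i (\<lambda>y. T y $ k $ j) (\<gamma> t))" for k j t
  have dT': "((\<lambda>t. T (\<gamma> t) $ k $ j) has_real_derivative T' k j t) (at t)" if "0 \<le> t" "t \<le> 1" for k j t
  proof -
    have "(\<gamma> has_derivative (\<lambda>s. s *\<^sub>R v)) (at t)"
      unfolding \<gamma>_def[abs_def] by (auto intro!: derivative_eq_intros)
    moreover have "\<gamma> t \<in> U" using \<gamma>B[OF that] B(3) by blast
    ultimately have "((\<lambda>t. T (\<gamma> t) $ k $ j) has_derivative
        (\<lambda>s. \<Sum>i\<in>UNIV. (s *\<^sub>R v) $ i * pd i (\<lambda>y. T y $ k $ j) (\<gamma> t))) (at t)"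
      by (intro has_derivative_compose[OF _ has_derivative_pd[OF dT]])
    moreover have "(\<lambda>s. \<Sum>i\<in>UNIV. (s *\<^sub>R v) $ i * pd i (\<lambda>y. T y $ k $ j) (\<gamma> t)) = (*) (T' k j t)"
      by (simp add: fun_eq_iff T'_def sum_distrib_left sum_distrib_right mult_ac)
    ultimately show ?thesis by (simp add: has_field_derivative_def)
  qed
  have T'b: "\<bar>T' k j t\<bar> \<le> n * (norm v * (n * (2 * L * sqrt (N (\<gamma> t)))))" if "0 \<le> t" "t \<le> 1" for k j t
  proof -
    have "\<bar>T' k j t\<bar> \<le> (\<Sum>i\<in>UNIV. \<bar>v $ i * pd i (\<lambda>y. T y $ k $ j) (\<gamma> t)\<bar>)"
      unfolding T'_def by (rule sum_abs)
    also have "\<dots> \<le> n * (norm v * (n * (2 * L * sqrt (N (\<gamma> t)))))"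
      unfolding n_def abs_mult
      by (intro sum_bounded_above mult_mono pdT[unfolded n_def] \<gamma>B that component_le_norm_cart) auto
    finally show ?thesis .
  qed
  define C where "C = n * (n * (2 * (n * (norm v * (n * (2 * L))))))"
  define N' where "N' t = (\<Sum>k\<in>UNIV. \<Sum>j\<in>UNIV. 2 * T (\<gamma> t) $ k $ j * T' k j t)" for t
  have dN: "((\<lambda>t. N (\<gamma> t)) has_real_derivative N' t) (at t)" if "0 \<le> t" "t \<le> 1" for t
    unfolding N_def N'_def
    by (auto intro!: derivative_eq_intros dT' that sum.cong)
  have N'b: "N' t \<le> C * N (\<gamma> t)" if t: "0 \<le> t" "t \<le> 1" for t
  proof -
    let ?R = "sqrt (N (\<gamma> t))"
    have 1: "2 * T (\<gamma> t) $ k $ j * T' k j t \<le> 2 * (?R * (n * (norm v * (n * (2 * L * ?R)))))" for k j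
    proof -
      have "T (\<gamma> t) $ k $ j * T' k j t \<le> \<bar>T (\<gamma> t) $ k $ j\<bar> * \<bar>T' k j t\<bar>"
        by (simp add: abs_mult[symmetric])
      also have "\<dots> \<le> ?R * (n * (norm v * (n * (2 * L * ?R))))"
        by (intro mult_mono TN T'b t) (auto simp: N0)
      finally show ?thesis by linarith
    qed
    have "N' t \<le> n * (n * (2 * (?R * (n * (norm v * (n * (2 * L * ?R)))))))"
      unfolding N'_def n_def by (intro sum_bounded_above 1[unfolded n_def])
    also have "\<dots> = C * (?R * ?R)" by (simp add: C_def)
    finally show ?thesis using N0 by simp
  qed
  have "exp (- C * 1) * N (\<gamma> 1) \<le> exp (- C * 0) * N (\<gamma> 0)"
  proof (rule DERIV_nonpos_imp_nonincreasing[of 0 1 "\<lambda>t. exp (- C * t) * N (\<gamma> t)"])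
    fix t :: real assume t: "0 \<le> t" "t \<le> 1"
    have "((\<lambda>t. exp (- C * t) * N (\<gamma> t)) has_real_derivative exp (- C * t) * (N' t - C * N (\<gamma> t))) (at t)"
      by (auto intro!: derivative_eq_intros dN t simp: algebra_simps)
    moreover have "exp (- C * t) * (N' t - C * N (\<gamma> t)) \<le> 0"
      using N'b[OF t] by (intro mult_nonneg_nonpos) auto
    ultimately show "\<exists>y. ((\<lambda>t. exp (- C * t) * N (\<gamma> t)) has_real_derivative y) (at t) \<and> y \<le> 0" by blast
  qed simp
  moreover have "N (\<gamma> 0) = 0" using \<open>T p = 0\<close> by (simp add: N_def \<gamma>_def)
  ultimately have "N q \<le> 0" by (simp add: \<gamma>_def v_def mult_le_0_iff)
  then have "N q = 0" using N0[of q] by simp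
  then show ?thesis using TN[of q] by (simp add: vec_eq_iff)
qed

lemma parallel11_nowhere_zero:
  fixes M :: "('p, 'i, 'n::finite) mfd"
  assumes M: "smooth_atlas M" "connected_space (mtop M)"
    and \<Gamma>: "affine_connection M \<Gamma>" and T: "tensor11 M T" "parallel11 M \<Gamma> T"
    and nz: "a0 \<in> idx M" "x0 \<in> crange M a0" "T a0 x0 \<noteq> 0"
    and a: "a \<in> idx M" "x \<in> crange M a"
  shows "T a x \<noteq> 0"
proof -
  define P where "P p \<longleftrightarrow> (\<exists>a\<in>idx M. p \<in> cdom M a \<and> T a (crd M a p) \<noteq> 0)" for p
  have change: "T b (crd M b p) = 0" if ab: "a \<in> idx M" "b \<in> idx M" "p \<in> cdom M a" "p \<in> cdom M b" "T a (crd M a p) = 0" for a b p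
  proof -
    let ?x = "crd M a p"
    have x: "?x \<in> overlap M a b" using ab by (auto simp: overlap_def)
    have tr: "transition M a b ?x = crd M b p"
      using ab cpar_crd[OF smooth_atlasD(1)[OF M(1) ab(1)]] by (simp add: transition_def)
    have "jac M b a (transition M a b ?x) ** jac M a b ?x = mat 1" by (rule jac_inverse[OF M(1) ab(1,2) x])
    then have inv: "jac M a b ?x ** jac M b a (transition M a b ?x) = mat 1"
      using matrix_left_right_inverse by blast
    have "jac M a b ?x ** T a ?x = T b (transition M a b ?x) ** jac M a b ?x"
      using T(1) ab(1,2) x unfolding tensor11_def by blast
    then have "T b (crd M b p) ** jac M a b ?x = jac M a b ?x ** T a ?x" unfolding tr by simp
    also have "\<dots> = 0" using ab(5) by (simp add: matrix_matrix_mult_def vec_eq_iff)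
    finally have "(T b (crd M b p) ** jac M a b ?x) ** jac M b a (transition M a b ?x) = 0"
      by (simp add: matrix_matrix_mult_def vec_eq_iff)
    then show ?thesis by (simp add: matrix_mul_assoc[symmetric] inv)
  qed
  have P: "P (cpar M a x) \<longleftrightarrow> T a x \<noteq> 0" if "a \<in> idx M" "x \<in> crange M a" for a x
  proof
    show "T a x \<noteq> 0" if "P (cpar M a x)"
      using that change[OF \<open>a \<in> idx M\<close> _ cpar_chart(1)[OF \<open>x \<in> crange M a\<close>]]
      unfolding P_def cpar_chart(2)[OF \<open>x \<in> crange M a\<close>] by blast
    show "P (cpar M a x)" if "T a x \<noteq> 0"
      unfolding P_def using cpar_chart[OF \<open>x \<in> crange M a\<close>] \<open>a \<in> idx M\<close> that by auto
  qed
  have "P (cpar M a x)"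
  proof (rule connected_locally_constant[OF M, where P = P and p = "cpar M a x" and ?p0.0 = "cpar M a0 x0"])
    show "P (cpar M a0 x0)" using P[OF nz(1,2)] nz(3) by simp
    show "cpar M a0 x0 \<in> pts M" using cpar_chart(1)[OF nz(2)] smooth_atlasD(3)[OF M(1) nz(1)] by blast
    show "cpar M a x \<in> pts M" using cpar_chart(1)[OF a(2)] smooth_atlasD(3)[OF M(1) a(1)] by blast
    fix a x assume a: "a \<in> idx M" and x: "x \<in> crange M a"
    obtain r where r: "r > 0" "cball x r \<subseteq> crange M a"
      using smooth_atlasD(2)[OF M(1) a] x open_contains_cball by blast
    have "T a y = 0 \<longleftrightarrow> T a x = 0" if "y \<in> cball x r" for y
    proof -
      have z: "T a q = 0" if "p \<in> cball x r" "q \<in> cball x r" "T a p = 0" for p q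
      proof (rule parallel_zero_propagates[where T = "T a" and \<Gamma> = "\<Gamma> a",
          OF compact_cball convex_cball r(2) _ _ _ that])
        show "continuous_on (crange M a) (\<lambda>y. \<Gamma> a y i j k)" for i j k
          using \<Gamma> a smooth_on_continuous unfolding affine_connection_def by blast
        show "(\<lambda>y. T a y $ k $ j) differentiable (at y)" if "y \<in> crange M a" for y k j
          using T(1) a smooth_on_differentiable that unfolding tensor11_def by blast
        show "pd i (\<lambda>y. T a y $ k $ j) y + (\<Sum>m\<in>UNIV. \<Gamma> a y i m k * T a y $ m $ j - \<Gamma> a y i j m * T a y $ k $ m) = 0"
          if "y \<in> crange M a" for y i k j
          using T(2) a that unfolding parallel11_def by blast
      qed
      have "x \<in> cball x r" using r(1) by simp
      then show ?thesis using z[of x y] z[of y x] that by blast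
    qed
    then have "P (cpar M a y) = P (cpar M a x)" if "y \<in> ball x r" for y
      using that r(2) ball_subset_cball[of x r] P[OF a x] P[OF a, of y] by blast
    moreover have "ball x r \<subseteq> crange M a" using r(2) ball_subset_cball[of x r] by blast
    ultimately show "\<exists>r>0. ball x r \<subseteq> crange M a \<and> (\<forall>y\<in>ball x r. P (cpar M a y) = P (cpar M a x))"
      using r(1) by blast
  qed
  then show ?thesis using P[OF a] by simp
qed

lemma nonconstant_has_noncritical_point:
  fixes M :: "('p, 'i, 'n::finite) mfd"
  assumes M: "smooth_atlas M" "connected_space (mtop M)" and h: "smooth_function M h" "\<not> h constant_on pts M"
  shows "\<exists>a\<in>idx M. \<exists>x\<in>crange M a. \<exists>k. pd k (\<lambda>x. h (cpar M a x)) x \<noteq> 0"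
proof (rule ccontr)
  assume "\<not> ?thesis"
  then have pd0: "pd k (\<lambda>x. h (cpar M a x)) x = 0" if "a \<in> idx M" "x \<in> crange M a" for a x k
    using that by blast
  have "pts M \<noteq> {}" using h(2) by (auto simp: constant_on_def)
  then obtain p0 where p0: "p0 \<in> pts M" by blast
  have "h p = h p0" if "p \<in> pts M" for p
  proof (rule connected_locally_constant[OF M p0, where P = "\<lambda>p. h p = h p0", OF _ _ that])
    fix a x assume a: "a \<in> idx M" and x: "x \<in> crange M a"
    obtain r where r: "r > 0" "ball x r \<subseteq> crange M a"
      using smooth_atlasD(2)[OF M(1) a] x openE by blast
    have "\<exists>c. \<forall>y\<in>ball x r. h (cpar M a y) = c"
    proof (rule has_derivative_zero_constant[OF convex_ball])
      fix y assume "y \<in> ball x r"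
      then have y: "y \<in> crange M a" using r by blast
      have "(\<lambda>x. h (cpar M a x)) differentiable (at y)"
        using h(1) a y smooth_on_differentiable unfolding smooth_function_def by blast
      from has_derivative_pd[OF this] show "((\<lambda>y. h (cpar M a y)) has_derivative (\<lambda>h. 0)) (at y within ball x r)"
        by (simp add: pd0[OF a y] has_derivative_at_withinI)
    qed
    then show "\<exists>r>0. ball x r \<subseteq> crange M a \<and> (\<forall>y\<in>ball x r. (h (cpar M a y) = h p0) = (h (cpar M a x) = h p0))"
      using r by (intro exI[of _ r]) auto
  qed simp
  then show False using h(2) by (auto simp: constant_on_def)
qed

lemma cotangent_simps [simp]:
  "idx (cotangent M) = idx M"
  "cdom (cotangent M) a = {(p, \<alpha>). p \<in> cdom M a \<and> covector M p \<alpha>}"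
  "pts (cotangent M) = {(p, \<alpha>). p \<in> pts M \<and> covector M p \<alpha>}"
  "crd (cotangent M) a (p, \<alpha>) = join (crd M a p) (\<alpha> a)"
  by (simp_all add: cotangent_def)

lemma covector_zero: "covector M p (\<lambda>_. 0)"
  by (simp add: covector_def)

lemma zero_section_crange: "x \<in> crange M a \<Longrightarrow> join x 0 \<in> crange (cotangent M) a"
  by (force simp: crange_def covector_zero image_iff)

lemma join_eq_iff: "join x y = join x' y' \<longleftrightarrow> x = x' \<and> y = y'"
  by (metis join_simps(3,4))

text \<open>By its transformation law a covector is determined by its components in a single chart.\<close>

lemma inj_on_cotangent:
  assumes M: "smooth_atlas M" and a: "a \<in> idx M"
  shows "inj_on (crd (cotangent M) a) (cdom (cotangent M) a)"
proof (rule inj_onI)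
  fix x y
  assume x: "x \<in> cdom (cotangent M) a" and y: "y \<in> cdom (cotangent M) a"
    and eq: "crd (cotangent M) a x = crd (cotangent M) a y"
  obtain p \<alpha> q \<beta> where xy: "x = (p, \<alpha>)" "y = (q, \<beta>)" by (metis surj_pair)
  have p: "p \<in> cdom M a" "covector M p \<alpha>" "q \<in> cdom M a" "covector M q \<beta>"
    using x y by (simp_all add: xy)
  have c: "crd M a p = crd M a q" "\<alpha> a = \<beta> a"
    using eq by (simp_all add: xy join_eq_iff)
  have pq: "q = p" using inj_onD[OF smooth_atlasD(1)[OF M a] c(1) p(1,3)] by simp
  have cv: "\<gamma> b = (if b \<in> idx M \<and> p \<in> cdom M b then transpose (jac M b a (crd M b p)) *v \<gamma> a else 0)"
    if \<gamma>: "covector M p \<gamma>" for \<gamma> b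
  proof (cases "b \<in> idx M \<and> p \<in> cdom M b")
    case True
    then show ?thesis using \<gamma> a p(1) unfolding covector_def if_P[OF True] by blast
  next
    case False
    then show ?thesis using \<gamma> unfolding covector_def if_not_P[OF False] by blast
  qed
  have "\<alpha> b = \<beta> b" for b
    unfolding cv[OF p(2), of b] cv[OF p(4)[unfolded pq], of b] c(2) ..
  then show "x = y" by (simp add: xy pq fun_eq_iff)
qed

lemma cpar_cotangent:
  assumes M: "smooth_atlas M" and a: "a \<in> idx M" and \<xi>: "\<xi> \<in> crange (cotangent M) a"
  shows "fst (cpar (cotangent M) a \<xi>) = cpar M a (base \<xi>)"
proof -
  obtain p \<alpha> where p: "cpar (cotangent M) a \<xi> = (p, \<alpha>)" by fastforce
  have "p \<in> cdom M a" "join (crd M a p) (\<alpha> a) = \<xi>"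
    using cpar_chart[OF \<xi>] unfolding p by auto
  then show ?thesis
    using cpar_crd[OF smooth_atlasD(1)[OF M a]] unfolding p by auto
qed


lemma hessian_cong:
  assumes "open V" "x \<in> V" "\<And>y. y \<in> V \<Longrightarrow> f y = g y"
  shows "hessian \<Gamma> f x i j = hessian \<Gamma> g x i j"
proof -
  have "pd k f y = pd k g y" if "y \<in> V" for k y
    by (rule pd_cong[OF assms(1) that assms(3)])
  then show ?thesis
    unfolding hessian_def using pd_cong[OF assms(1,2), of "pd j f" "pd j g"] assms(2) by simp
qed

lemma extension_chartI:
  assumes S: "affine_surface S \<Gamma>" and T: "tensor11 S T" "nilpotent11 S T" "parallel11 S \<Gamma> T"
    and ric: "ricci_nowhere_symmetric S \<Gamma>" and \<Phi>: "sym_tensor02 S \<Phi>" and a: "a \<in> idx S"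
  shows "extension_chart (crange S a) (\<Gamma> a) (T a) (\<Phi> a)"
proof
  have S': "smooth_atlas S" "affine_connection S \<Gamma>" "torsion_free S \<Gamma>"
    using S unfolding affine_surface_def smooth_manifold_def by blast+
  show "open (crange S a)" by (rule smooth_atlasD(2)[OF S'(1) a])
  show "smooth_on (crange S a) (\<lambda>y. \<Gamma> a y i j k)" for i j k
    using S'(2)[unfolded affine_connection_def, THEN conjunct1] a by blast
  show "\<Gamma> a y i j k = \<Gamma> a y j i k" if "y \<in> crange S a" for y i j k
    using S'(3) a that unfolding torsion_free_def by blast
  show "smooth_on (crange S a) (\<lambda>y. T a y $ k $ j)" for k j
    using T(1)[unfolded tensor11_def, THEN conjunct1] a by blast
  show "T a y ** T a y = 0" if "y \<in> crange S a" for y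
    using T(2)[unfolded nilpotent11_def, THEN conjunct1] a that by blast
  show "pd i (\<lambda>y. T a y $ k $ j) y + (\<Sum>m\<in>UNIV. \<Gamma> a y i m k * T a y $ m $ j - \<Gamma> a y i j m * T a y $ k $ m) = 0"
    if "y \<in> crange S a" for y i k j
    using T(3) a that unfolding parallel11_def by blast
  show "ricci_skew (\<Gamma> a) y 2 1 \<noteq> 0" if y: "y \<in> crange S a" for y
  proof -
    obtain i j where ij: "ricci_skew (\<Gamma> a) y i j \<noteq> 0"
      using ric a y unfolding ricci_nowhere_symmetric_def by blast
    have "ricci_skew (\<Gamma> a) y i i = 0" for i by (simp add: ricci_skew_def)
    moreover have "ricci_skew (\<Gamma> a) y 1 2 = - ricci_skew (\<Gamma> a) y 2 1"
      by (simp add: ricci_skew_def field_split_simps)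
    ultimately show ?thesis using ij exhaust_2[of i] exhaust_2[of j] by force
  qed
  show "smooth_on (crange S a) (\<lambda>y. \<Phi> a y $ i $ j)" for i j
    using \<Phi>[unfolded sym_tensor02_def, THEN conjunct1] a by blast
  show "\<Phi> a y $ i $ j = \<Phi> a y $ j $ i" if "y \<in> crange S a" for y i j
  proof -
    have "transpose (\<Phi> a y) = \<Phi> a y" using \<Phi>[unfolded sym_tensor02_def, THEN conjunct2, THEN conjunct1] a that by blast
    then have "transpose (\<Phi> a y) $ i $ j = \<Phi> a y $ i $ j" by simp
    then show ?thesis by (simp add: transpose_def)
  qed
qed

theorem mainTheorem9:
  fixes S :: "('p, 'i, 2) mfd"
    and \<Gamma> :: "'i \<Rightarrow> 2 christ"
    and T \<Phi> :: "'i \<Rightarrow> real ^ 2 \<Rightarrow> real ^ 2 ^ 2"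
    and h :: "'p \<Rightarrow> real"
  assumes "affine_surface S \<Gamma>"
    and "tensor11 S T" and "nilpotent11 S T" and "parallel11 S \<Gamma> T"
    and "ricci_nowhere_symmetric S \<Gamma>"
    and "sym_tensor02 S \<Phi>"
    and "smooth_function S h" and "\<not> h constant_on pts S"
    and "gradient_ricci_soliton (cotangent S) (modified_extension \<Gamma> \<Phi> T) (h \<circ> fst)"
    and "bach_flat (cotangent S) (modified_extension \<Gamma> \<Phi> T)"
  shows "\<not> half_conformally_flat (cotangent S) (modified_extension \<Gamma> \<Phi> T) \<and>
         \<not> conformally_einstein (cotangent S) (modified_extension \<Gamma> \<Phi> T)"
proof -
  have M: "smooth_atlas S" "connected_space (mtop S)" and aff: "affine_connection S \<Gamma>"
    using assms(1) unfolding affine_surface_def smooth_manifold_def by blast+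
  note chart = extension_chartI[OF assms(1-6)]
  obtain a1 x1 where a1: "a1 \<in> idx S" "x1 \<in> crange S a1" "T a1 x1 \<noteq> 0"
    using assms(3) unfolding nilpotent11_def by blast
  have T0: "T a x \<noteq> 0" if "a \<in> idx S" "x \<in> crange S a" for a x
    by (rule parallel11_nowhere_zero[OF M aff assms(2,4) a1 that])
  have "\<not> half_conformally_flat (cotangent S) (modified_extension \<Gamma> \<Phi> T)"
  proof
    assume "half_conformally_flat (cotangent S) (modified_extension \<Gamma> \<Phi> T)"
    then obtain ori where ori: "orientation (cotangent S) ori"
      and sd: "self_dual (cotangent S) ori (modified_extension \<Gamma> \<Phi> T)
        \<or> anti_self_dual (cotangent S) ori (modified_extension \<Gamma> \<Phi> T)"
      unfolding half_conformally_flat_def by blast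
    interpret extension_chart "crange S a1" "\<Gamma> a1" "T a1" "\<Phi> a1" by (rule chart[OF a1(1)])
    have g: "modified_extension \<Gamma> \<Phi> T a1 = walker A" by (rule modified_extension_eq_walker) auto
    let ?\<xi> = "join x1 0 :: real ^ (2 + 2)"
    have \<xi>: "?\<xi> \<in> crange (cotangent S) a1" by (rule zero_section_crange[OF a1(2)])
    have s: "ori a1 ?\<xi> = 1 \<or> ori a1 ?\<xi> = -1"
      using ori \<xi> a1(1) unfolding orientation_def by force
    obtain e where e: "e = 1 \<or> e = -1" and "\<And>i j k l. weyl_pm e (ori a1 ?\<xi>) (walker A) ?\<xi> i j k l = 0"
      using sd \<xi> a1(1) unfolding self_dual_def anti_self_dual_def g[symmetric] by fastforce
    then show False using weyl_pm_nonzero[OF a1(2,3) s e] by blast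
  qed
  moreover have "\<not> conformally_einstein (cotangent S) (modified_extension \<Gamma> \<Phi> T)"
  proof
    assume ce: "conformally_einstein (cotangent S) (modified_extension \<Gamma> \<Phi> T)"
    obtain a x k where a: "a \<in> idx S" and x: "x \<in> crange S a" and k: "pd k (\<lambda>x. h (cpar S a x)) x \<noteq> 0"
      using nonconstant_has_noncritical_point[OF M assms(7,8)] by blast
    interpret extension_chart "crange S a" "\<Gamma> a" "T a" "\<Phi> a" by (rule chart[OF a])
    have g: "modified_extension \<Gamma> \<Phi> T a = walker A" by (rule modified_extension_eq_walker) auto
    define p where "p = cpar S a x"
    have p: "p \<in> cdom S a" "crd S a p = x" "p \<in> pts S"
      using cpar_chart[OF x] smooth_atlasD(3)[OF M(1) a] by (auto simp: p_def)
    let ?p = "(p, \<lambda>_. 0 :: real ^ 2)"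
    have "?p \<in> pts (cotangent S)" using p by (simp add: covector_zero)
    then obtain U \<phi> where U: "openin (mtop (cotangent S)) U" "?p \<in> U" "\<And>q. q \<in> U \<Longrightarrow> \<phi> q > 0"
      and sm: "smooth_function (restrict_mfd (cotangent S) U) \<phi>"
      and ei: "einstein (restrict_mfd (cotangent S) U)
        (conformal_metric (restrict_mfd (cotangent S) U) \<phi> (modified_extension \<Gamma> \<Phi> T))"
      using bspec[OF ce[unfolded conformally_einstein_def] \<open>?p \<in> pts (cotangent S)\<close>]
      by (elim exE conjE) (rule that, auto)
    let ?R = "restrict_mfd (cotangent S) U"
    define V where "V = crange ?R a"
    have V: "V = crd (cotangent S) a ` (U \<inter> cdom (cotangent S) a)"
    proof -
      have "cdom ?R a = U \<inter> cdom (cotangent S) a" "crd ?R a = crd (cotangent S) a"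
        unfolding restrict_mfd_def by auto
      then show ?thesis unfolding V_def crange_def by (simp only:)
    qed
    have VC: "V \<subseteq> crange (cotangent S) a" unfolding V crange_def by (rule image_mono[OF Int_lower2])
    have idR: "a \<in> idx ?R" using a by (simp add: restrict_mfd_def)
    have op: "openin (mtop (cotangent S)) W \<longleftrightarrow> W \<subseteq> pts (cotangent S) \<and>
        (\<forall>a\<in>idx (cotangent S). open (crd (cotangent S) a ` (W \<inter> cdom (cotangent S) a)))" for W
      by (rule openin_mtop, rule inj_on_cotangent[OF M(1)]) (simp only: cotangent_simps(1))
    have openV: "open V" unfolding V using U(1)[unfolded op] a cotangent_simps(1)[of S] by blast
    have V\<Omega>: "V \<subseteq> \<Omega>"
    proof
      fix \<xi> assume "\<xi> \<in> V"
      then have "\<xi> \<in> crange (cotangent S) a" by (rule subsetD[OF VC])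
      then show "\<xi> \<in> \<Omega>" unfolding \<Omega>_def by (simp add: crange_cotangent_subset)
    qed
    define F where "F \<xi> = \<phi> (cpar ?R a \<xi>)" for \<xi>
    have F: "smooth_on V F"
      using sm idR unfolding smooth_function_def V_def F_def[abs_def] by blast
    have F0: "F \<xi> > 0" if "\<xi> \<in> V" for \<xi>
      using cpar_chart(1)[OF that[unfolded V_def]] U(3) unfolding F_def by (simp add: restrict_mfd_def)
    define H where "H x = h (cpar S a x)" for x
    have H: "smooth_on (crange S a) H"
      using assms(7) a unfolding smooth_function_def H_def[abs_def] by blast
    have cm: "conformal_metric ?R \<phi> (modified_extension \<Gamma> \<Phi> T) a = (\<lambda>\<xi>. (1 / (F \<xi>)\<^sup>2) *\<^sub>R walker A \<xi>)"
      by (rule ext) (simp add: conformal_metric_def F_def g)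
    obtain mu where mu': "\<forall>a\<in>idx ?R. \<forall>\<xi>\<in>crange ?R a. \<forall>i j.
        ric (conformal_metric ?R \<phi> (modified_extension \<Gamma> \<Phi> T) a) \<xi> i j
        = mu * conformal_metric ?R \<phi> (modified_extension \<Gamma> \<Phi> T) a \<xi> $ i $ j"
      using ei unfolding einstein_def by (elim exE)
    have mu: "ric (\<lambda>\<xi>. (1 / (F \<xi>)\<^sup>2) *\<^sub>R walker A \<xi>) \<xi> i j = mu * ((1 / (F \<xi>)\<^sup>2) *\<^sub>R walker A \<xi>) $ i $ j"
      if "\<xi> \<in> V" for \<xi> i j
      using mu'[rule_format, OF idR that[unfolded V_def]] unfolding cm .
    obtain lam where lam': "\<forall>a\<in>idx (cotangent S). \<forall>\<xi>\<in>crange (cotangent S) a. \<forall>i j.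
        hessian (levi_civita (modified_extension \<Gamma> \<Phi> T a)) (\<lambda>y. (h \<circ> fst) (cpar (cotangent S) a y)) \<xi> i j
          + ric (modified_extension \<Gamma> \<Phi> T a) \<xi> i j = lam * modified_extension \<Gamma> \<Phi> T a \<xi> $ i $ j"
      using assms(9) unfolding gradient_ricci_soliton_def by (elim conjE exE)
    have lam: "hessian (levi_civita (walker A)) (\<lambda>\<xi>. H (base \<xi>)) \<xi> i j + ric (walker A) \<xi> i j
        = lam * walker A \<xi> $ i $ j" if \<xi>: "\<xi> \<in> V" for \<xi> i j
    proof -
      have \<xi>C: "\<xi> \<in> crange (cotangent S) a" by (rule subsetD[OF VC \<xi>])
      have "(h \<circ> fst) (cpar (cotangent S) a y) = H (base y)" if "y \<in> V" for y
        using cpar_cotangent[OF M(1) a subsetD[OF VC that]] by (simp add: H_def)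
      then have hc: "hessian (levi_civita (walker A)) (\<lambda>y. (h \<circ> fst) (cpar (cotangent S) a y)) \<xi> i j
          = hessian (levi_civita (walker A)) (\<lambda>\<xi>. H (base \<xi>)) \<xi> i j"
        by (rule hessian_cong[OF openV \<xi>])
      have "a \<in> idx (cotangent S)" using a by (simp only: cotangent_simps(1))
      from lam'[rule_format, OF this \<xi>C, of i j] show ?thesis unfolding g hc .
    qed
    have "pd k H x = 0"
    proof (rule conformally_einstein_soliton_critical[OF openV V\<Omega> F F0 H])
      show "T a y \<noteq> 0" if "y \<in> crange S a" for y using T0[OF a that] .
      have "join x 0 = crd (cotangent S) a ?p" using p by simp
      moreover have "?p \<in> U \<inter> cdom (cotangent S) a" using U(2) p(1) by (simp add: covector_zero)
      ultimately show "join x 0 \<in> V" unfolding V by (rule image_eqI)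
      show "hessian (levi_civita (walker A)) (\<lambda>\<xi>. H (base \<xi>)) \<xi> s t + ric (walker A) \<xi> s t = lam * walker A \<xi> $ s $ t"
        if "\<xi> \<in> V" for \<xi> s t by (rule lam[OF that])
      show "ric (\<lambda>\<xi>. (1 / (F \<xi>)\<^sup>2) *\<^sub>R walker A \<xi>) \<xi> s t = mu * ((1 / (F \<xi>)\<^sup>2) *\<^sub>R walker A \<xi>) $ s $ t"
        if "\<xi> \<in> V" for \<xi> s t by (rule mu[OF that])
    qed
    then show False using k unfolding H_def[abs_def] by simp
  qed
  ultimately show ?thesis by blast
qed

end
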